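(* Let $\Sigma$ be a smooth fan with $n$ rays, let $\mathcal E$ be the toric vector bundle with general fiber $E$ defined by $D\in\Delta(\Sigma,\operatorname{Trop}_\star(I_{\mathcal B}))$ with rows $w_1,\dots,w_n$, where $\mathcal B=\{b_1,\dots,b_r\}\subset\operatorname{Sym}(E)$ is a strong Khovanskii basis for $\mathcal E$. Let $\mathcal G=\{f_1,\dots,f_\ell\}\subset\mathcal I_{\mathcal B}$ be a generating set such that for each $i$ the initial forms $\operatorname{in}_{s(w_i)}(f_j)$, $1\le j\le\ell$, generate $\operatorname{in}_{s(w_i)}(\mathcal I_{\mathcal B})$, and $\operatorname{in}_{s(w_i)}(f_j)=f_j|_{X_i=0}$ for all $i,j$. Let $C_{\mathcal G}\subset\Delta(\Sigma,\operatorname{Trop}_\star(I_{\mathcal B}))$ be the set of diagrams $D'$, with rows $w_1',\dots,w_n'$, such that $\operatorname{in}_{s(w_i')}(f)=\operatorname{in}_{s(w_i)}(f)$ for each $f\in\mathcal G$ and each $i$. If $\mathcal E'$ is the bundle defined by $D'\in C_{\mathcal G}$, then $\mathcal R(\mathcal E')$ is finitely generated.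
   Context: $\mathbf k$ is algebraically closed; $\Sigma$ has rays $\varrho_1,\dots,\varrho_n$; $E$ is a finite-dimensional vector space. $\mathcal B$ is a finite set of nonzero homogeneous generators of $\operatorname{Sym}(E)$ (its elements of degree 1, the linear part, span $E$). $I_{\mathcal B}\subset\mathbf k[x_1,\dots,x_r]$ is the ideal of relations among $\mathcal B$ and $L_{\mathcal B}$ the linear ideal of relations among its linear part. For a presentation $p:\mathbf k[x]\to\operatorname{Sym}(E)$ by a generating set and a weight $w$, $\mathfrak v_w(f)=\max\{\min\{\langle w,\alpha\rangle:c_\alpha\neq0\}:p(\sum c_\alpha x^\alpha)=f\}$. $\operatorname{Trop}_\star(I_{\mathcal B})\subset\operatorname{Trop}(I_{\mathcal B})\subset\mathbb Q^r$ is the set of points $(\mathfrak v_w(b_1),\dots,\mathfrak v_w(b_r))$ for $w\in\operatorname{Trop}(L_{\mathcal B})$. $\operatorname{GF}(I_{\mathcal B})$ is the Gröbner fan, $\mathcal K(I_{\mathcal B})$ its subfan supported on $\{(\mathfrak v_w(b_1),\dots,\mathfrak v_w(b_r)):w\in\mathbb Q^r\}$, and an apartment is $\mathcal K(I_{\mathcal B})\cap\tau$ with $\tau$ a maximal cone of $\operatorname{GF}(I_{\mathcal B})$. $\Delta(\Sigma,\operatorname{Trop}_\star(I_{\mathcal B}))$ is the set of $n\times r$ matrices with rows in $\operatorname{Trop}_\star(I_{\mathcal B})$ such that for each $\sigma\in\Sigma$ the rows indexed by rays of $\sigma$ lie in a common apartment. Such a matrix with integer entries defines a toric vector bundle over $Y(\Sigma)$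 with general fiber $E$ whose valuation at the $i$-th primitive ray generator is $\mathfrak v_i:=\mathfrak v_{w_i}$ (matrices to which bundles are attached are taken integral); its section ring is $\mathcal R(\mathcal E)=\bigoplus_{\mathbf r\in\mathbb Z^n}\{f\in\operatorname{Sym}(E):\mathfrak v_i(f)\ge r_i\ \forall i\}\,t^{\mathbf r}\subset\operatorname{Sym}(E)\otimes\mathbf k[t_1^{\pm1},\dots,t_n^{\pm1}]$, isomorphic to the Cox ring of $\mathbb P\mathcal E$. $\mathcal B$ is a strong Khovanskii basis for $\mathcal E$ if $\mathcal R(\mathcal E)$ is generated as a $\mathbf k$-algebra by the $t_i^{-1}$ and the $b_j\prod_it_i^{\mathfrak v_i(b_j)}$. $\mathcal I_{\mathcal B}$ (formed with respect to $D$) is the kernel of $\mathbf k[X_1,\dots,X_n,Y_1,\dots,Y_r]\to\operatorname{Sym}(E)\otimes\mathbf k[t^{\pm1}]$, $X_i\mapsto t_i^{-1}$, $Y_j\mapsto b_j\prod_it_i^{\mathfrak v_i(b_j)}$. For $w\in\operatorname{Trop}(I_{\mathcal B})$, $s(w)\in\operatorname{Trop}(\mathcal I_{\mathcal B})$ is the weight equal to $w_j$ on $Y_j$ and $0$ on every $X_i$. $\operatorname{in}_w(f)$ is the sum of the terms of $f$ of minimal $w$-weight. *)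

theory Defs
  imports "HOL-Analysis.Analysis" "HOL-Computational_Algebra.Polynomial" "HOL-Library.Poly_Mapping"
begin

section \<open>Polynomial rings, ideals, algebras\<close>

text \<open>
  Index sets are initial segments of the naturals: rays are indexed by \<open>i < n\<close>, the elements of
  \<open>\<B>\<close> by \<open>j < r\<close> and a basis of \<open>E\<close> by \<open>{..<m}\<close>.
  The type of polynomials in all variables \<open>'x\<close> contains the polynomial ring \<open>k[V]\<close> on any
  set \<open>V\<close> of variables as the subring \<open>polys V\<close>.
\<close>

type_synonym ('x, 'k) mpoly = "('x \<Rightarrow>\<^sub>0 nat) \<Rightarrow>\<^sub>0 'k"

definition polys :: "'x set \<Rightarrow> ('x, 'k::comm_ring_1) mpoly set" where
  "polys V = {p. \<forall>\<alpha>\<in>Poly_Mapping.keys p. Poly_Mapping.keys \<alpha> \<subseteq> V}"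

definition const :: "'k::comm_ring_1 \<Rightarrow> ('x, 'k) mpoly" where
  "const c = Poly_Mapping.single 0 c"

definition var :: "'x \<Rightarrow> ('x, 'k::comm_ring_1) mpoly" where
  "var x = Poly_Mapping.single (Poly_Mapping.single x 1) 1"

text \<open>Evaluation at \<open>g\<close> in an algebra with structure map \<open>c\<close>.\<close>

definition eval_poly ::
  "('k::comm_ring_1 \<Rightarrow> 'a::comm_ring_1) \<Rightarrow> ('x \<Rightarrow> 'a) \<Rightarrow> ('x, 'k) mpoly \<Rightarrow> 'a" where
  "eval_poly c g p =
     (\<Sum>\<alpha>\<in>Poly_Mapping.keys p. c (Poly_Mapping.lookup p \<alpha>) *
        (\<Prod>x\<in>Poly_Mapping.keys \<alpha>. g x ^ Poly_Mapping.lookup \<alpha> x))"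

definition is_ideal :: "'x set \<Rightarrow> ('x, 'k::comm_ring_1) mpoly set \<Rightarrow> bool" where
  "is_ideal V I \<longleftrightarrow> I \<subseteq> polys V \<and> 0 \<in> I \<and> (\<forall>p\<in>I. \<forall>q\<in>I. p + q \<in> I) \<and>
     (\<forall>p\<in>polys V. \<forall>q\<in>I. p * q \<in> I)"

definition ideal_gen :: "'x set \<Rightarrow> ('x, 'k::comm_ring_1) mpoly set \<Rightarrow> ('x, 'k) mpoly set" where
  "ideal_gen V F = is_ideal V hull F"

definition is_subalgebra :: "('k::comm_ring_1 \<Rightarrow> 'a::comm_ring_1) \<Rightarrow> 'a set \<Rightarrow> bool" where
  "is_subalgebra c A \<longleftrightarrow> range c \<subseteq> A \<and> (\<forall>x\<in>A. \<forall>y\<in>A. x + y \<in> A \<and> x * y \<in> A)"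

definition alg_gen :: "('k::comm_ring_1 \<Rightarrow> 'a::comm_ring_1) \<Rightarrow> 'a set \<Rightarrow> 'a set" where
  "alg_gen c S = is_subalgebra c hull S"

definition fin_gen_algebra :: "('k::comm_ring_1 \<Rightarrow> 'a::comm_ring_1) \<Rightarrow> 'a set \<Rightarrow> bool" where
  "fin_gen_algebra c A \<longleftrightarrow> (\<exists>S. finite S \<and> alg_gen c S = A)"


section \<open>Initial forms, tropical varieties, Groebner fans\<close>

text \<open>
  A weight in \<open>\<rat>\<^sup>V\<close> is a function on all indices of which only the values on \<open>V\<close> matter; hence
  subsets of \<open>\<rat>\<^sup>r\<close> are represented by the cylinders over them in \<open>nat \<Rightarrow> rat\<close>.
\<close>

definition pairing :: "('x \<Rightarrow> rat) \<Rightarrow> ('x \<Rightarrow>\<^sub>0 nat) \<Rightarrow> rat" where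
  "pairing w \<alpha> = (\<Sum>x\<in>Poly_Mapping.keys \<alpha>. w x * of_nat (Poly_Mapping.lookup \<alpha> x))"

definition init_form :: "('x \<Rightarrow> rat) \<Rightarrow> ('x, 'k::comm_ring_1) mpoly \<Rightarrow> ('x, 'k) mpoly" where
  "init_form w f =
     (\<Sum>\<alpha> | \<alpha> \<in> Poly_Mapping.keys f \<and> (\<forall>\<beta>\<in>Poly_Mapping.keys f. pairing w \<alpha> \<le> pairing w \<beta>).
        Poly_Mapping.single \<alpha> (Poly_Mapping.lookup f \<alpha>))"

definition init_ideal ::
  "'x set \<Rightarrow> ('x \<Rightarrow> rat) \<Rightarrow> ('x, 'k::comm_ring_1) mpoly set \<Rightarrow> ('x, 'k) mpoly set" where
  "init_ideal V w I = ideal_gen V (init_form w ` I)"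

definition Trop :: "'x set \<Rightarrow> ('x, 'k::comm_ring_1) mpoly set \<Rightarrow> ('x \<Rightarrow> rat) set" where
  "Trop V I = {w. \<forall>\<alpha>. Poly_Mapping.single \<alpha> 1 \<notin> init_ideal V w I}"

text \<open>
  The cones of the Groebner fan are the Euclidean closures in \<open>\<rat>\<^sup>r\<close> of the classes of weights
  with the same initial ideal.
\<close>

definition closure_rat :: "nat \<Rightarrow> (nat \<Rightarrow> rat) set \<Rightarrow> (nat \<Rightarrow> rat) set" where
  "closure_rat r A = {w. \<forall>\<epsilon>>0. \<exists>w'\<in>A. \<forall>j<r. \<bar>w j - w' j\<bar> < \<epsilon>}"

definition groebner_fan :: "nat \<Rightarrow> (nat, 'k::comm_ring_1) mpoly set \<Rightarrow> (nat \<Rightarrow> rat) set set" where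
  "groebner_fan r I =
     {closure_rat r {w'. init_ideal {..<r} w' I = init_ideal {..<r} w I} | w. True}"

definition groebner_fan_maximal ::
  "nat \<Rightarrow> (nat, 'k::comm_ring_1) mpoly set \<Rightarrow> (nat \<Rightarrow> rat) set set" where
  "groebner_fan_maximal r I =
     {\<tau> \<in> groebner_fan r I. \<forall>\<kappa>\<in>groebner_fan r I. \<tau> \<subseteq> \<kappa> \<longrightarrow> \<kappa> = \<tau>}"


section \<open>Smooth fans\<close>

text \<open>The lattice is \<open>\<int>\<^sup>d\<close> inside \<open>\<real>\<^sup>d\<close>, with \<open>d = CARD('d)\<close>.\<close>

definition lattice :: "(real ^ 'd) set" where
  "lattice = {x. \<forall>k. x $ k \<in> \<int>}"

definition rational_polyhedral_cone :: "(real ^ 'd) set \<Rightarrow> bool" where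
  "rational_polyhedral_cone \<sigma> \<longleftrightarrow> (\<exists>S. finite S \<and> S \<subseteq> lattice \<and> \<sigma> = convex_cone hull S)"

definition is_fan :: "(real ^ 'd) set set \<Rightarrow> bool" where
  "is_fan \<Sigma> \<longleftrightarrow> finite \<Sigma> \<and> \<Sigma> \<noteq> {} \<and>
     (\<forall>\<sigma>\<in>\<Sigma>. rational_polyhedral_cone \<sigma> \<and> \<sigma> \<inter> uminus ` \<sigma> = {0}) \<and>
     (\<forall>\<sigma>\<in>\<Sigma>. \<forall>\<tau>. \<tau> face_of \<sigma> \<and> \<tau> \<noteq> {} \<longrightarrow> \<tau> \<in> \<Sigma>) \<and>
     (\<forall>\<sigma>\<in>\<Sigma>. \<forall>\<tau>\<in>\<Sigma>. (\<sigma> \<inter> \<tau>) face_of \<sigma> \<and> (\<sigma> \<inter> \<tau>) face_of \<tau>)"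

definition lattice_basis :: "(real ^ 'd) set \<Rightarrow> bool" where
  "lattice_basis B \<longleftrightarrow> finite B \<and> independent B \<and>
     lattice = {(\<Sum>v\<in>B. of_int (c v) *\<^sub>R v) | c :: real ^ 'd \<Rightarrow> int. True}"

definition smooth_cone :: "(real ^ 'd) set \<Rightarrow> bool" where
  "smooth_cone \<sigma> \<longleftrightarrow> (\<exists>B S. lattice_basis B \<and> S \<subseteq> B \<and> \<sigma> = convex_cone hull S)"

definition smooth_fan :: "(real ^ 'd) set set \<Rightarrow> bool" where
  "smooth_fan \<Sigma> \<longleftrightarrow> is_fan \<Sigma> \<and> (\<forall>\<sigma>\<in>\<Sigma>. smooth_cone \<sigma>)"

definition rays :: "(real ^ 'd) set set \<Rightarrow> (real ^ 'd) set set" where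
  "rays \<Sigma> = {\<rho> \<in> \<Sigma>. dim \<rho> = 1}"


section \<open>The symmetric algebra and its weight quasivaluations\<close>

text \<open>
  After a choice of basis \<open>E = k\<^sup>m\<close>, so \<open>Sym(E)\<close> is the polynomial ring \<open>k[e\<^sub>0, \<dots>, e\<^bsub>m-1\<^esub>]\<close> and
  \<open>E\<close> is its space of linear forms.
\<close>

type_synonym 'k sym = "(nat, 'k) mpoly"

definition Sym :: "nat \<Rightarrow> 'k::comm_ring_1 sym set" where
  "Sym m = polys {..<m}"

definition homogeneous :: "nat \<Rightarrow> 'k::comm_ring_1 sym \<Rightarrow> bool" where
  "homogeneous d f \<longleftrightarrow> (\<forall>\<alpha>\<in>Poly_Mapping.keys f.
     (\<Sum>x\<in>Poly_Mapping.keys \<alpha>. Poly_Mapping.lookup \<alpha> x) = d)"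

definition lin_part :: "nat \<Rightarrow> (nat \<Rightarrow> 'k::comm_ring_1 sym) \<Rightarrow> nat set" where
  "lin_part r b = {j. j < r \<and> homogeneous 1 (b j)}"

definition homogeneous_generators :: "nat \<Rightarrow> nat \<Rightarrow> (nat \<Rightarrow> 'k::comm_ring_1 sym) \<Rightarrow> bool" where
  "homogeneous_generators m r b \<longleftrightarrow> inj_on b {..<r} \<and>
     (\<forall>j<r. b j \<in> Sym m \<and> b j \<noteq> 0 \<and> (\<exists>d. homogeneous d (b j))) \<and>
     (\<forall>f\<in>Sym m. \<exists>p\<in>polys {..<r}. eval_poly const b p = f) \<and>
     (\<forall>f\<in>Sym m. homogeneous 1 f \<longrightarrow> (\<exists>c. f = (\<Sum>j\<in>lin_part r b. const (c j) * b j)))"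

definition relation_ideal :: "nat set \<Rightarrow> (nat \<Rightarrow> 'k::comm_ring_1 sym) \<Rightarrow> (nat, 'k) mpoly set" where
  "relation_ideal V b = {p \<in> polys V. eval_poly const b p = 0}"

abbreviation I_of :: "nat \<Rightarrow> (nat \<Rightarrow> 'k::comm_ring_1 sym) \<Rightarrow> (nat, 'k) mpoly set" where
  "I_of r b \<equiv> relation_ideal {..<r} b"

abbreviation L_of :: "nat \<Rightarrow> (nat \<Rightarrow> 'k::comm_ring_1 sym) \<Rightarrow> (nat, 'k) mpoly set" where
  "L_of r b \<equiv> relation_ideal (lin_part r b) b"

text \<open>
  The quasivaluation \<open>\<vv>\<^sub>w\<close> of the presentation by the \<open>b\<^sub>j\<close>, \<open>j \<in> V\<close>. The weights \<open>\<langle>w, \<alpha>\<rangle>\<close> have a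
  common denominator, so the supremum is a maximum as soon as it is finite; the zero
  polynomial has minimal weight \<open>\<infinity>\<close>, so \<open>\<vv>\<^sub>w(0) = \<infinity>\<close>.
\<close>

definition wval :: "nat set \<Rightarrow> (nat \<Rightarrow> 'k::comm_ring_1 sym) \<Rightarrow> (nat \<Rightarrow> rat) \<Rightarrow> 'k sym \<Rightarrow> ereal" where
  "wval V b w f = (SUP p \<in> {p \<in> polys V. eval_poly const b p = f}.
     INF \<alpha> \<in> Poly_Mapping.keys p. ereal (of_rat (pairing w \<alpha>)))"

definition Trop_star :: "nat \<Rightarrow> (nat \<Rightarrow> 'k::comm_ring_1 sym) \<Rightarrow> (nat \<Rightarrow> rat) set" where
  "Trop_star r b = {u. \<exists>w \<in> Trop (lin_part r b) (L_of r b).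
     \<forall>j<r. wval (lin_part r b) b w (b j) = ereal (of_rat (u j))}"

definition K_fan :: "nat \<Rightarrow> (nat \<Rightarrow> 'k::comm_ring_1 sym) \<Rightarrow> (nat \<Rightarrow> rat) set set" where
  "K_fan r b = {\<kappa> \<in> groebner_fan r (I_of r b).
     \<kappa> \<subseteq> {u. \<exists>w. \<forall>j<r. wval {..<r} b w (b j) = ereal (of_rat (u j))}}"

text \<open>An apartment is represented by its support, a subset of \<open>\<rat>\<^sup>r\<close>.\<close>

definition apartments :: "nat \<Rightarrow> (nat \<Rightarrow> 'k::comm_ring_1 sym) \<Rightarrow> (nat \<Rightarrow> rat) set set" where
  "apartments r b = {\<Union>(K_fan r b) \<inter> \<tau> | \<tau>. \<tau> \<in> groebner_fan_maximal r (I_of r b)}"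


section \<open>Diagrams and section rings\<close>

text \<open>\<open>\<rho>\<close> enumerates the rays of \<open>\<Sigma>\<close>; row \<open>i\<close> of the matrix \<open>D\<close> is \<open>D i\<close>.\<close>

definition diagrams :: "(real ^ 'd) set set \<Rightarrow> (nat \<Rightarrow> (real ^ 'd) set) \<Rightarrow> nat \<Rightarrow> nat \<Rightarrow>
    (nat \<Rightarrow> 'k::comm_ring_1 sym) \<Rightarrow> (nat \<Rightarrow> nat \<Rightarrow> rat) set" where
  "diagrams \<Sigma> \<rho> n r b = {D. (\<forall>i<n. D i \<in> Trop_star r b) \<and>
     (\<forall>\<sigma>\<in>\<Sigma>. \<exists>A\<in>apartments r b. \<forall>i<n. \<rho> i face_of \<sigma> \<longrightarrow> D i \<in> A)}"

definition integral_diagram :: "nat \<Rightarrow> nat \<Rightarrow> (nat \<Rightarrow> nat \<Rightarrow> rat) \<Rightarrow> bool" where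
  "integral_diagram n r D \<longleftrightarrow> (\<forall>i<n. \<forall>j<r. D i j \<in> \<int>)"

text \<open>
  \<open>Sym(E) \<otimes> k[t\<^sub>1\<^sup>\<plusminus>\<^sup>1, \<dots>, t\<^sub>n\<^sup>\<plusminus>\<^sup>1]\<close> is the ring of Laurent polynomials in \<open>t\<close> with coefficients in
  \<open>Sym(E)\<close>; the coefficient of \<open>t\<^sup>a\<close> in \<open>F\<close> is \<open>lookup F a\<close>.
\<close>

type_synonym 'k laurent = "(nat \<Rightarrow>\<^sub>0 int) \<Rightarrow>\<^sub>0 'k sym"

definition lconst :: "'k::comm_ring_1 \<Rightarrow> 'k laurent" where
  "lconst c = Poly_Mapping.single 0 (const c)"

definition t_inv :: "nat \<Rightarrow> 'k::comm_ring_1 laurent" where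
  "t_inv i = Poly_Mapping.single (Poly_Mapping.single i (- 1)) 1"

text \<open>
  \<open>b\<^sub>j \<Prod>\<^sub>i t\<^sub>i^\<vv>\<^sub>i(b\<^sub>j)\<close>. For an integral diagram all \<open>\<vv>\<^sub>i(b\<^sub>j)\<close> are integers, so the floor is only a
  conversion to type \<open>int\<close>.
\<close>

definition b_lift :: "nat \<Rightarrow> nat \<Rightarrow> (nat \<Rightarrow> 'k::comm_ring_1 sym) \<Rightarrow> (nat \<Rightarrow> nat \<Rightarrow> rat) \<Rightarrow>
    nat \<Rightarrow> 'k laurent" where
  "b_lift n r b D j = Poly_Mapping.single
     (\<Sum>i<n. Poly_Mapping.single i \<lfloor>real_of_ereal (wval {..<r} b (D i) (b j))\<rfloor>) (b j)"

text \<open>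
  The toric vector bundle of an integral diagram \<open>D\<close> is given by its general fiber \<open>E\<close> and the
  valuations \<open>\<vv>\<^sub>i = \<vv>\<^bsub>D i\<^esub>\<close> along the rays, and its section ring is defined in terms of these.
\<close>

definition section_ring :: "nat \<Rightarrow> nat \<Rightarrow> nat \<Rightarrow> (nat \<Rightarrow> 'k::comm_ring_1 sym) \<Rightarrow>
    (nat \<Rightarrow> nat \<Rightarrow> rat) \<Rightarrow> 'k laurent set" where
  "section_ring n m r b D = {F. \<forall>a\<in>Poly_Mapping.keys F.
     Poly_Mapping.keys a \<subseteq> {..<n} \<and> Poly_Mapping.lookup F a \<in> Sym m \<and>
     (\<forall>i<n. wval {..<r} b (D i) (Poly_Mapping.lookup F a)
              \<ge> ereal (of_int (Poly_Mapping.lookup a i)))}"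

definition strong_khovanskii_basis :: "nat \<Rightarrow> nat \<Rightarrow> nat \<Rightarrow> (nat \<Rightarrow> 'k::comm_ring_1 sym) \<Rightarrow>
    (nat \<Rightarrow> nat \<Rightarrow> rat) \<Rightarrow> bool" where
  "strong_khovanskii_basis n m r b D \<longleftrightarrow>
     alg_gen lconst (t_inv ` {..<n} \<union> b_lift n r b D ` {..<r}) = section_ring n m r b D"

text \<open>The variables \<open>X\<^sub>i\<close> and \<open>Y\<^sub>j\<close> are \<open>Inl i\<close> and \<open>Inr j\<close>.\<close>

definition XY_vars :: "nat \<Rightarrow> nat \<Rightarrow> (nat + nat) set" where
  "XY_vars n r = Inl ` {..<n} \<union> Inr ` {..<r}"

definition big_ideal :: "nat \<Rightarrow> nat \<Rightarrow> (nat \<Rightarrow> 'k::comm_ring_1 sym) \<Rightarrow> (nat \<Rightarrow> nat \<Rightarrow> rat) \<Rightarrow>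
    (nat + nat, 'k) mpoly set" where
  "big_ideal n r b D =
     {f \<in> polys (XY_vars n r). eval_poly lconst (case_sum t_inv (b_lift n r b D)) f = 0}"

definition s_weight :: "(nat \<Rightarrow> rat) \<Rightarrow> nat + nat \<Rightarrow> rat" where
  "s_weight w = case_sum (\<lambda>_. 0) w"

definition set_X_zero :: "nat \<Rightarrow> (nat + nat, 'k::comm_ring_1) mpoly \<Rightarrow> (nat + nat, 'k) mpoly" where
  "set_X_zero i f = eval_poly const (\<lambda>v. if v = Inl i then 0 else var v) f"

definition C_set :: "(real ^ 'd) set set \<Rightarrow> (nat \<Rightarrow> (real ^ 'd) set) \<Rightarrow> nat \<Rightarrow> nat \<Rightarrow>
    (nat \<Rightarrow> 'k::comm_ring_1 sym) \<Rightarrow> (nat \<Rightarrow> nat \<Rightarrow> rat) \<Rightarrow>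
    (nat + nat, 'k) mpoly set \<Rightarrow> (nat \<Rightarrow> nat \<Rightarrow> rat) set" where
  "C_set \<Sigma> \<rho> n r b D G = {D' \<in> diagrams \<Sigma> \<rho> n r b.
     \<forall>f\<in>G. \<forall>i<n. init_form (s_weight (D' i)) f = init_form (s_weight (D i)) f}"

end

theory Submission
  imports Defs
begin

text \<open>
  Bundles become statements about weighted presentations. Let \<open>J\<close> be the ideal of relations among
  the \<open>b\<^sub>j\<close>. An element of the section ring of \<open>D\<close> in degree \<open>a\<close> is a \<open>z\<close> such that for each row \<open>i\<close>
  separately \<open>z\<close> has a representation as a polynomial in the \<open>b\<^sub>j\<close> of \<open>D i\<close>-weight at least \<open>a\<^sub>i\<close>; it
  lies in the algebra generated by the \<open>t\<^sub>i\<inverse>\<close> and the lifts of the \<open>b\<^sub>j\<close> iff one representation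
  serves all rows at once (\<open>alg_gen_lifts\<close>). So being a strong Khovanskii basis means that
  representations which are good for the rows one by one can be merged, a property called
  \<open>jointly_reducible\<close> below. It is shown to pass from \<open>D\<close> to \<open>D'\<close>. Thus \<open>\<B>\<close> is a strong
  Khovanskii basis for the bundle of \<open>D'\<close> too, which is more than finite generation.

  The passage from \<open>D\<close> to \<open>D'\<close> changes one row at a time, and along the way a second property is
  carried: every relation whose weights are bounded below by \<open>\<mu>\<close> is a combination of multiples of
  (parts of) elements of the generating set whose formal weights are bounded below by \<open>\<mu>\<close> in all
  rows (\<open>filtered_generators\<close>). For \<open>D\<close> this is the assumption that \<open>\<G>\<close> generates \<open>\<I>\<^sub>\<B>\<close>,
  dehomogenized by \<open>X\<^sub>i = 1\<close>. A generator need not be homogeneous for the \<open>\<int>\<^sup>n\<close>-grading by powers of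
  \<open>t\<close>, so it is cut into its parts \<open>g\<close>. The condition on initial forms, \<open>in(f) = f|\<^bsub>X\<^sub>i=0\<^esub>\<close> for the
  \<open>i\<close>-th rows of both diagrams, says that the same terms of \<open>g\<close> attain the formal weight of \<open>g\<close> for
  the old and for the new row. These terms form the leading part of \<open>g\<close>; it is homogeneous for both
  rows, and it may be zero.

  Changing row \<open>k\<close> (\<open>weight_change\<close>). For the old weight \<open>w\<close> the initial space of \<open>J\<close> is spanned by
  the leading parts, because the generators are filtered. These are also initial parts for the new
  weight \<open>w'\<close>, so one initial space is contained in the other. They are equal, as both have
  complements of the same size: the monomials that form a basis modulo the smaller space are
  independent modulo \<open>J\<close>, and everything can be rewritten in them modulo \<open>J\<close> without lowering \<open>w'\<close>,
  so that they form a basis modulo the larger space too (\<open>initial_in_span_lead\<close>). Suppose now that a representation \<open>p\<close> satisfies the bounds of all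
  other rows, but has \<open>w'\<close>-weight lower than the \<open>w'\<close>-value of the element it represents. Then its
  lowest part \<open>q\<close> lies in the initial space, and so do the \<open>w\<close>-homogeneous parts of \<open>q\<close>. Both
  properties of the old diagram write these as combinations of leading parts of generators that
  satisfy the bounds of the other rows (\<open>span_lead_Q\<close>). Subtracting the same combination of the
  generators themselves raises the \<open>w'\<close>-weight of \<open>p\<close> and keeps the other bounds
  (\<open>cancel_lowest_part\<close>). Iterating this gives both properties for the new row.

  The iteration stops because in each degree \<open>w'\<close> is bounded. The \<open>b\<^sub>j\<close> of positive degree have
  finitely many monomials in a given degree, and a constant \<open>b\<^sub>j\<close> has weight zero
  (\<open>Trop_star_degree_zero\<close>). Membership in \<open>Trop\<^sub>\<star>\<close> is used for this and for the equality
  of \<open>\<vv>\<^sub>i(b\<^sub>j)\<close> with the matrix entry (\<open>Trop_star_wval\<close>).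
\<close>

section \<open>Finitely supported functions and evaluation of polynomials\<close>

lemma poly_mapping_sum_singles:
  "(\<Sum>\<alpha>\<in>Poly_Mapping.keys p. Poly_Mapping.single \<alpha> (Poly_Mapping.lookup p \<alpha>)) = p"
proof (rule poly_mapping_eqI)
  fix k
  show "Poly_Mapping.lookup (\<Sum>\<alpha>\<in>Poly_Mapping.keys p. Poly_Mapping.single \<alpha> (Poly_Mapping.lookup p \<alpha>)) k
    = Poly_Mapping.lookup p k"
    by (cases "k \<in> Poly_Mapping.keys p")
      (auto simp: lookup_sum lookup_single when_def sum.delta' in_keys_iff)
qed

lemma poly_mapping_induct [case_names zero single add]:
  fixes p :: "'b \<Rightarrow>\<^sub>0 'a::comm_monoid_add"
  assumes zero: "P 0"
    and single: "\<And>\<alpha>. \<alpha> \<in> Poly_Mapping.keys p \<Longrightarrow> P (Poly_Mapping.single \<alpha> (Poly_Mapping.lookup p \<alpha>))"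
    and add: "\<And>q q'. P q \<Longrightarrow> P q' \<Longrightarrow> P (q + q')"
  shows "P p"
proof -
  have "P (\<Sum>\<alpha>\<in>A. Poly_Mapping.single \<alpha> (Poly_Mapping.lookup p \<alpha>))"
    if "A \<subseteq> Poly_Mapping.keys p" for A
    using finite_subset[OF that finite_keys] that
    by (induction A rule: finite_induct) (auto intro: zero single add)
  from this[OF order_refl] show ?thesis
    by (simp only: poly_mapping_sum_singles)
qed

text \<open>The part of \<open>p\<close> that is supported on \<open>S\<close>: initial forms, graded components and truncations are
  all of this kind.\<close>

lift_definition restr :: "'b set \<Rightarrow> ('b \<Rightarrow>\<^sub>0 'a::zero) \<Rightarrow> ('b \<Rightarrow>\<^sub>0 'a)"
  is "\<lambda>S f \<beta>. if \<beta> \<in> S then f \<beta> else 0"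
  by (rule finite_subset) auto

lemma lookup_restr [simp]:
  "Poly_Mapping.lookup (restr S p) \<beta> = (if \<beta> \<in> S then Poly_Mapping.lookup p \<beta> else 0)"
  by transfer simp

lemma keys_restr [simp]: "Poly_Mapping.keys (restr S p) = Poly_Mapping.keys p \<inter> S"
  by (auto simp: in_keys_iff split: if_splits)

lemma restr_eq_self: "Poly_Mapping.keys p \<subseteq> S \<Longrightarrow> restr S p = p"
  by (rule poly_mapping_eqI) (auto simp: in_keys_iff)

lemma restr_eq_zero: "Poly_Mapping.keys p \<inter> S = {} \<Longrightarrow> restr S p = 0"
  by (rule poly_mapping_eqI) (auto simp: in_keys_iff)

lemma restr_zero [simp]: "restr S 0 = 0"
  by (rule restr_eq_zero) simp

lemma restr_add: "restr S (p + q) = restr S p + restr S (q :: 'b \<Rightarrow>\<^sub>0 'a::comm_monoid_add)"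
  by (rule poly_mapping_eqI) (auto simp: lookup_add)

lemma restr_sum:
  "restr S (\<Sum>i\<in>A. f i) = (\<Sum>i\<in>A. restr S (f i :: 'b \<Rightarrow>\<^sub>0 'a::comm_monoid_add))"
  by (induction A rule: infinite_finite_induct) (simp_all add: restr_add)

lemma restr_diff: "restr S (p - q) = restr S p - restr S (q :: 'b \<Rightarrow>\<^sub>0 'a::ab_group_add)"
  by (rule poly_mapping_eqI) (auto simp: lookup_minus)

lemma restr_single:
  "restr S (Poly_Mapping.single \<beta> c) = (if \<beta> \<in> S then Poly_Mapping.single \<beta> c else 0)"
  by (rule poly_mapping_eqI) (auto simp: lookup_single when_def)

lemma restr_restr: "restr S (restr S' p) = restr (S \<inter> S') p"
  by (rule poly_mapping_eqI) auto

lemma sum_restr_fibres: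
  fixes p :: "'b \<Rightarrow>\<^sub>0 'a::comm_monoid_add"
  assumes "finite A" "\<phi> ` Poly_Mapping.keys p \<subseteq> A"
  shows "(\<Sum>a\<in>A. restr {\<beta>. \<phi> \<beta> = a} p) = p"
proof (rule poly_mapping_eqI)
  fix k
  show "Poly_Mapping.lookup (\<Sum>a\<in>A. restr {\<beta>. \<phi> \<beta> = a} p) k = Poly_Mapping.lookup p k"
    using assms by (cases "k \<in> Poly_Mapping.keys p")
      (auto simp: lookup_sum sum.delta' in_keys_iff)
qed

lemma keys_sum_subset:
  fixes f :: "'i \<Rightarrow> 'b \<Rightarrow>\<^sub>0 'a::comm_monoid_add"
  shows "(\<And>i. i \<in> A \<Longrightarrow> Poly_Mapping.keys (f i) \<subseteq> S) \<Longrightarrow> Poly_Mapping.keys (sum f A) \<subseteq> S"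
proof (induction A rule: infinite_finite_induct)
  case (insert x F)
  then show ?case using keys_add[of "f x" "sum f F"] by fastforce
qed auto

lemma keys_diff_subset:
  fixes p q :: "'b \<Rightarrow>\<^sub>0 'a::ab_group_add"
  assumes "Poly_Mapping.keys p \<subseteq> S" "Poly_Mapping.keys q \<subseteq> S"
  shows "Poly_Mapping.keys (p - q) \<subseteq> S"
proof
  fix \<beta> assume "\<beta> \<in> Poly_Mapping.keys (p - q)"
  then have "\<beta> \<in> Poly_Mapping.keys p \<or> \<beta> \<in> Poly_Mapping.keys q"
    by (auto simp: in_keys_iff lookup_minus)
  then show "\<beta> \<in> S" using assms by blast
qed

lemma keys_add_subset:
  fixes p q :: "'b \<Rightarrow>\<^sub>0 'a::comm_monoid_add"
  assumes "Poly_Mapping.keys p \<subseteq> S" "Poly_Mapping.keys q \<subseteq> S"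
  shows "Poly_Mapping.keys (p + q) \<subseteq> S"
  using assms keys_add[of p q] by blast

lemma const_mult_single:
  "const c * Poly_Mapping.single \<beta> d = Poly_Mapping.single \<beta> (c * d)"
  by (simp add: const_def mult_single)

lemma lookup_const_mult [simp]: "Poly_Mapping.lookup (const c * p) \<beta> = c * Poly_Mapping.lookup p \<beta>"
  unfolding const_def mult_map_scale_conv_mult[symmetric]
  by (simp add: Poly_Mapping.map.rep_eq when_def)

lemma keys_const_mult: "Poly_Mapping.keys (const c * p) \<subseteq> Poly_Mapping.keys p"
  by (auto simp: in_keys_iff)

lemma restr_const_mult: "restr S (const c * p) = const c * restr S p"
  by (rule poly_mapping_eqI) auto

lemma const_add: "const (c + d) = const c + const d"
  and const_mult: "const (c * d) = const c * const d"
  and const_zero: "const 0 = 0" and const_one: "const 1 = 1"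
  by (simp_all add: const_def single_add mult_single)

interpretation mp: vector_space "\<lambda>c p. const c * (p :: ('x, 'k::field) mpoly)"
  by unfold_locales (simp_all add: const_add const_mult const_one algebra_simps)

text \<open>With coefficients indexed by \<open>L\<close> instead of by vectors, a combination of the \<open>h l\<close> can be
  transported to the same combination of another family, such as the leading parts of the \<open>h l\<close>.\<close>

lemma in_span_imageE:
  fixes h :: "'l \<Rightarrow> ('x, 'k::field) mpoly"
  assumes "p \<in> mp.span (h ` L)"
  obtains A c where "finite A" "A \<subseteq> L" "p = (\<Sum>l\<in>A. const (c l) * h l)"
proof -
  have "\<exists>A c. finite A \<and> A \<subseteq> L \<and> p = (\<Sum>l\<in>A. const (c l) * h l)"
    using assms
  proof (induction rule: mp.span_induct_alt)
    case base
    show ?case by (rule exI[of _ "{}"]) simp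
  next
    case (step c x y)
    then obtain A d l where A: "finite A" "A \<subseteq> L" "y = (\<Sum>l\<in>A. const (d l) * h l)"
      and l: "l \<in> L" "x = h l" by blast
    let ?d = "\<lambda>k. if k = l then c + (if l \<in> A then d l else 0) else d k"
    have "(\<Sum>k\<in>insert l A. const (?d k) * h k) = const (?d l) * h l + (\<Sum>k\<in>A-{l}. const (d k) * h k)"
      using A by (subst sum.insert_remove) (auto intro!: sum.cong)
    also have "\<dots> = const c * x + y"
    proof (cases "l \<in> A")
      case True
      then show ?thesis using A l by (simp add: const_add algebra_simps sum.remove[of A l])
    qed (use A l in \<open>simp add: const_add\<close>)
    finally have "const c * x + y = (\<Sum>k\<in>insert l A. const (?d k) * h k)" ..
    then show ?case
      using A l by (intro exI[of _ "insert l A"] exI[of _ ?d]) auto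
  qed
  then show ?thesis using that by blast
qed

subsection \<open>Evaluation\<close>

definition ring_map :: "('k::comm_ring_1 \<Rightarrow> 'a::comm_ring_1) \<Rightarrow> bool" where
  "ring_map c \<longleftrightarrow> c 0 = 0 \<and> c 1 = 1 \<and> (\<forall>x y. c (x + y) = c x + c y \<and> c (x * y) = c x * c y)"

lemma ring_map_const: "ring_map const"
  by (simp add: ring_map_def const_zero const_one const_add const_mult)

lemma ring_map_lconst: "ring_map lconst"
  by (simp add: ring_map_def lconst_def const_zero const_one const_add const_mult single_add mult_single)

definition mon_eval :: "('x \<Rightarrow> 'a::comm_monoid_mult) \<Rightarrow> ('x \<Rightarrow>\<^sub>0 nat) \<Rightarrow> 'a" where
  "mon_eval g \<alpha> = (\<Prod>x\<in>Poly_Mapping.keys \<alpha>. g x ^ Poly_Mapping.lookup \<alpha> x)"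

lemma mon_eval_superset:
  assumes "finite A" "Poly_Mapping.keys \<alpha> \<subseteq> A"
  shows "mon_eval g \<alpha> = (\<Prod>x\<in>A. g x ^ Poly_Mapping.lookup \<alpha> x)"
  unfolding mon_eval_def
  by (rule prod.mono_neutral_left) (use assms in \<open>auto simp: in_keys_iff\<close>)

lemma mon_eval_add: "mon_eval g (\<alpha> + \<beta>) = mon_eval g \<alpha> * mon_eval g \<beta>"
proof -
  let ?A = "Poly_Mapping.keys \<alpha> \<union> Poly_Mapping.keys \<beta>"
  have "Poly_Mapping.keys (\<alpha> + \<beta>) \<subseteq> ?A" by (rule keys_add)
  then show ?thesis
    by (simp add: mon_eval_superset[of ?A] lookup_add power_add prod.distrib)
qed

lemma mon_eval_zero [simp]: "mon_eval g 0 = 1"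
  by (simp add: mon_eval_def)

lemma mon_eval_single: "mon_eval g (Poly_Mapping.single x k) = g x ^ k"
  by (cases "k = 0") (auto simp: mon_eval_def)

lemma eval_poly_mon:
  "eval_poly c g p = (\<Sum>\<alpha>\<in>Poly_Mapping.keys p. c (Poly_Mapping.lookup p \<alpha>) * mon_eval g \<alpha>)"
  by (simp add: eval_poly_def mon_eval_def)

context
  fixes c :: "'k::comm_ring_1 \<Rightarrow> 'a::comm_ring_1"
  assumes c: "ring_map c"
begin

lemma eval_poly_superset:
  assumes "finite A" "Poly_Mapping.keys p \<subseteq> A"
  shows "eval_poly c g p = (\<Sum>\<alpha>\<in>A. c (Poly_Mapping.lookup p \<alpha>) * mon_eval g \<alpha>)"
  unfolding eval_poly_mon
  by (rule sum.mono_neutral_left) (use assms c in \<open>auto simp: in_keys_iff ring_map_def\<close>)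

lemma eval_poly_add: "eval_poly c g (p + q) = eval_poly c g p + eval_poly c g q"
proof -
  let ?A = "Poly_Mapping.keys p \<union> Poly_Mapping.keys q"
  have "Poly_Mapping.keys (p + q) \<subseteq> ?A" by (rule keys_add)
  then show ?thesis using c
    by (simp add: eval_poly_superset[of ?A] lookup_add ring_map_def distrib_right sum.distrib)
qed

lemma eval_poly_zero [simp]: "eval_poly c g 0 = 0"
  by (simp add: eval_poly_def)

lemma eval_poly_single: "eval_poly c g (Poly_Mapping.single \<alpha> k) = c k * mon_eval g \<alpha>"
  using eval_poly_superset[of "{\<alpha>}" "Poly_Mapping.single \<alpha> k"] by simp

lemma eval_poly_sum: "eval_poly c g (\<Sum>i\<in>A. f i) = (\<Sum>i\<in>A. eval_poly c g (f i))"
  by (induction A rule: infinite_finite_induct) (simp_all add: eval_poly_add)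

lemma eval_poly_minus: "eval_poly c g (p - q) = eval_poly c g p - eval_poly c g q"
  using eval_poly_add[of g "p - q" q] by (simp add: algebra_simps)

lemma eval_poly_mult: "eval_poly c g (p * q) = eval_poly c g p * eval_poly c g q"
proof (induction p rule: poly_mapping_induct)
  case (single \<alpha>)
  show ?case
  proof (induction q rule: poly_mapping_induct)
    case (single \<beta>)
    then show ?case using c
      by (simp add: mult_single eval_poly_single mon_eval_add ring_map_def mult_ac)
  qed (simp_all add: eval_poly_add distrib_left)
qed (simp_all add: eval_poly_add distrib_right)

lemma eval_poly_const: "eval_poly c g (const k) = c k"
  by (simp add: const_def eval_poly_single)

lemma eval_poly_var: "eval_poly c g (var x) = g x"
  using c by (simp add: var_def eval_poly_single mon_eval_single ring_map_def)

lemma eval_poly_power: "eval_poly c g (p ^ k) = eval_poly c g p ^ k"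
proof (induction k)
  case 0
  show ?case using eval_poly_const[of g 1] c by (simp add: const_one ring_map_def)
qed (simp add: eval_poly_mult)

lemma eval_poly_prod: "eval_poly c g (\<Prod>i\<in>A. f i) = (\<Prod>i\<in>A. eval_poly c g (f i))"
proof (induction A rule: infinite_finite_induct)
  case (infinite A)
  then show ?case using eval_poly_power[of g 0 0] by simp
next
  case empty
  then show ?case using eval_poly_power[of g 0 0] by simp
qed (simp add: eval_poly_mult)

end

lemma poly_subst:
  fixes c :: "'k::comm_ring_1 \<Rightarrow> 'a::comm_ring_1"
  assumes "ring_map c"
  shows "eval_poly c g (eval_poly const q p) = eval_poly c (\<lambda>x. eval_poly c g (q x)) p"
  using assms
  by (simp add: eval_poly_mon[of const] eval_poly_mon[of c "\<lambda>x. eval_poly c g (q x)"] mon_eval_def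
      eval_poly_sum eval_poly_mult eval_poly_prod eval_poly_power eval_poly_const)

subsection \<open>The polynomial rings \<open>polys V\<close>\<close>

lemma polys_iff: "p \<in> polys V \<longleftrightarrow> Poly_Mapping.keys p \<subseteq> {\<alpha>. Poly_Mapping.keys \<alpha> \<subseteq> V}"
  by (auto simp: polys_def)

lemma polys_add: "p \<in> polys V \<Longrightarrow> q \<in> polys V \<Longrightarrow> p + q \<in> polys V"
  unfolding polys_iff by (rule keys_add_subset)

lemma polys_diff: "p \<in> polys V \<Longrightarrow> q \<in> polys V \<Longrightarrow> p - q \<in> polys V"
  unfolding polys_iff by (rule keys_diff_subset)

lemma polys_mult: 
  assumes "p \<in> polys V" "q \<in> polys V" shows "p * q \<in> polys V"
proof -
  have "Poly_Mapping.keys (a + b') \<subseteq> V" if "a \<in> Poly_Mapping.keys p" "b' \<in> Poly_Mapping.keys q" for a b'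
    using that assms keys_add[of a b'] unfolding polys_def by blast
  then show ?thesis using keys_mult[of p q] unfolding polys_def by blast
qed

lemma polys_const [simp]: "const c \<in> polys V"
  by (simp add: polys_def const_def)

lemma polys_zero [simp]: "0 \<in> polys V"
  by (simp add: polys_def)

lemma polys_one [simp]: "1 \<in> polys V"
  using polys_const[of 1] by (simp add: const_one)

lemma polys_var: "x \<in> V \<Longrightarrow> var x \<in> polys V"
  by (simp add: polys_def var_def)

lemma polys_sum: "(\<And>i. i \<in> A \<Longrightarrow> f i \<in> polys V) \<Longrightarrow> sum f A \<in> polys V"
  by (induction A rule: infinite_finite_induct) (auto intro: polys_add)

lemma polys_power: "p \<in> polys V \<Longrightarrow> p ^ k \<in> polys V"
  by (induction k) (auto intro: polys_mult)

lemma polys_prod: "(\<And>i. i \<in> A \<Longrightarrow> f i \<in> polys V) \<Longrightarrow> prod f A \<in> polys V"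
  by (induction A rule: infinite_finite_induct) (auto intro: polys_mult)

lemma eval_poly_in_polys:
  assumes "p \<in> polys V" "\<And>x. x \<in> V \<Longrightarrow> g x \<in> polys U"
  shows "eval_poly const g p \<in> polys U"
  unfolding eval_poly_mon mon_eval_def
proof (intro polys_sum polys_mult polys_const polys_prod polys_power assms(2))
  fix \<alpha> x assume "\<alpha> \<in> Poly_Mapping.keys p" "x \<in> Poly_Mapping.keys \<alpha>"
  then show "x \<in> V" using assms(1) by (auto simp: polys_def)
qed

lemma polys_restr: "p \<in> polys V \<Longrightarrow> restr S p \<in> polys V"
  by (auto simp: polys_def)

section \<open>Changing one weight\<close>

text \<open>
  The setting for one row and one degree, where the argument is linear algebra: \<open>J\<close> is a space of
  linear combinations of monomials from \<open>M\<close>, and the relations \<open>h l\<close> carry formal weights \<open>N l\<close> and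
  \<open>N' l\<close>, which are lower bounds for the weights of their monomials and need not be attained. The
  assumption \<open>tie\<close> is all that relates \<open>w\<close> to \<open>w'\<close>.
\<close>

locale weight_change =
  fixes M :: "('x \<Rightarrow>\<^sub>0 nat) set" and J :: "('x, 'k::field) mpoly set"
    and h :: "'l \<Rightarrow> ('x, 'k) mpoly" and \<Lambda> :: "'l set"
    and w w' :: "('x \<Rightarrow>\<^sub>0 nat) \<Rightarrow> int" and N N' :: "'l \<Rightarrow> int" and C :: int
  assumes J_subspace: "mp.subspace J"
    and J_keys: "p \<in> J \<Longrightarrow> Poly_Mapping.keys p \<subseteq> M"
    and h_in_J: "l \<in> \<Lambda> \<Longrightarrow> h l \<in> J"
    and N_le: "l \<in> \<Lambda> \<Longrightarrow> \<beta> \<in> Poly_Mapping.keys (h l) \<Longrightarrow> N l \<le> w \<beta>"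
    and N'_le: "l \<in> \<Lambda> \<Longrightarrow> \<beta> \<in> Poly_Mapping.keys (h l) \<Longrightarrow> N' l \<le> w' \<beta>"
    and tie: "l \<in> \<Lambda> \<Longrightarrow> \<beta> \<in> Poly_Mapping.keys (h l) \<Longrightarrow> w \<beta> = N l \<longleftrightarrow> w' \<beta> = N' l"
    and gen: "p \<in> J \<Longrightarrow> Poly_Mapping.keys p \<subseteq> {\<beta>. \<nu> \<le> w \<beta>} \<Longrightarrow>
        p \<in> mp.span (h ` {l \<in> \<Lambda>. \<nu> \<le> N l})"
    and w'_bound: "\<beta> \<in> M \<Longrightarrow> w' \<beta> \<le> C"
begin

definition lead :: "'l \<Rightarrow> ('x, 'k) mpoly" where
  "lead l = restr {\<beta>. w \<beta> = N l} (h l)"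

lemma lead_alt:
  assumes "l \<in> \<Lambda>"
  shows "lead l = restr {\<beta>. w' \<beta> = N' l} (h l)"
proof (rule poly_mapping_eqI)
  fix \<beta>
  show "Poly_Mapping.lookup (lead l) \<beta> = Poly_Mapping.lookup (restr {\<beta>. w' \<beta> = N' l} (h l)) \<beta>"
    using tie[OF assms, of \<beta>] by (cases "\<beta> \<in> Poly_Mapping.keys (h l)") (auto simp: lead_def in_keys_iff)
qed

lemma keys_lead:
  assumes "l \<in> \<Lambda>"
  shows "Poly_Mapping.keys (lead l) \<subseteq> Poly_Mapping.keys (h l) \<inter> {\<beta>. w \<beta> = N l} \<inter> {\<beta>. w' \<beta> = N' l}"
  using tie[OF assms] by (auto simp: lead_def)

lemma restr_h:
  assumes "l \<in> \<Lambda>" "\<nu> \<le> N l"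
  shows "restr {\<beta>. w \<beta> = \<nu>} (h l) = (if N l = \<nu> then lead l else 0)"
  using N_le[OF assms(1)] assms(2) by (force simp: lead_def intro: restr_eq_zero)

lemma restr_h':
  assumes "l \<in> \<Lambda>" "\<nu> \<le> N' l"
  shows "restr {\<beta>. w' \<beta> = \<nu>} (h l) = (if N' l = \<nu> then lead l else 0)"
  using N'_le[OF assms(1)] assms(2) by (force simp: lead_alt[OF assms(1)] intro: restr_eq_zero)

lemma restr_lead:
  assumes "l \<in> \<Lambda>"
  shows "restr {\<beta>. w \<beta> = \<nu>} (lead l) = (if N l = \<nu> then lead l else 0)"
    and "restr {\<beta>. w' \<beta> = \<nu>} (lead l) = (if N' l = \<nu> then lead l else 0)"
  using keys_lead[OF assms] by (force intro: restr_eq_zero restr_eq_self)+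

lemma restr_span:
  fixes f :: "'l \<Rightarrow> ('x, 'k) mpoly"
  assumes "p \<in> mp.span (f ` L)"
    and "\<And>l. l \<in> L \<Longrightarrow> restr S (f l) \<in> mp.span B"
  shows "restr S p \<in> mp.span B"
  using assms(1)
proof (induction rule: mp.span_induct_alt)
  case base
  then show ?case using mp.span_zero by simp
next
  case (step c x y)
  then show ?case using assms(2)
    by (auto simp: restr_add restr_const_mult intro!: mp.span_add mp.span_scale)
qed

lemma restr_w_span_h:
  assumes "p \<in> mp.span (h ` L)" "L \<subseteq> {l \<in> \<Lambda>. \<nu> \<le> N l}"
  shows "restr {\<beta>. w \<beta> = \<nu>} p \<in> mp.span (lead ` {l \<in> L. N l = \<nu>})"
  by (rule restr_span[OF assms(1)])
    (use assms(2) in \<open>auto simp: subset_iff restr_h mp.span_zero intro!: mp.span_base imageI\<close>)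

text \<open>The span of the leading parts is homogeneous for both weights, because each of them is.\<close>

lemma restr_w_span_lead:
  assumes "p \<in> mp.span (lead ` L)" "L \<subseteq> \<Lambda>"
  shows "restr {\<beta>. w \<beta> = \<nu>} p \<in> mp.span (lead ` {l \<in> L. N l = \<nu>})"
  by (rule restr_span[OF assms(1)])
    (use assms(2) in \<open>auto simp: subset_iff restr_lead mp.span_zero intro!: mp.span_base imageI\<close>)

lemma restr_w'_span_lead:
  assumes "p \<in> mp.span (lead ` L)" "L \<subseteq> \<Lambda>"
  shows "restr {\<beta>. w' \<beta> = \<nu>} p \<in> mp.span (lead ` {l \<in> L. N' l = \<nu>})"
  by (rule restr_span[OF assms(1)])
    (use assms(2) in \<open>auto simp: subset_iff restr_lead mp.span_zero intro!: mp.span_base imageI\<close>)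

text \<open>A combination of leading parts of equal formal weight is the lowest part of an element of \<open>J\<close>,
  the same combination of the \<open>h l\<close>.\<close>

lemma lift_lead:
  assumes "q \<in> mp.span (lead ` L)" "L \<subseteq> {l \<in> \<Lambda>. N l = \<nu>}"
  obtains g where "g \<in> J" "Poly_Mapping.keys g \<subseteq> {\<beta>. \<nu> \<le> w \<beta>}" "restr {\<beta>. w \<beta> = \<nu>} g = q"
proof -
  obtain A c where A: "finite A" "A \<subseteq> L" "q = (\<Sum>l\<in>A. const (c l) * lead l)"
    using in_span_imageE[OF assms(1)] .
  have AL: "l \<in> \<Lambda>" "N l = \<nu>" if "l \<in> A" for l using that A(2) assms(2) by auto
  show thesis
  proof (rule that[of "\<Sum>l\<in>A. const (c l) * h l"])
    show "(\<Sum>l\<in>A. const (c l) * h l) \<in> J"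
      by (intro mp.subspace_sum[OF J_subspace] mp.subspace_scale[OF J_subspace] h_in_J AL)
    show "Poly_Mapping.keys (\<Sum>l\<in>A. const (c l) * h l) \<subseteq> {\<beta>. \<nu> \<le> w \<beta>}"
      using N_le AL keys_const_mult by (intro keys_sum_subset) fastforce
    show "restr {\<beta>. w \<beta> = \<nu>} (\<Sum>l\<in>A. const (c l) * h l) = q"
      using AL by (simp add: A(3) restr_sum restr_const_mult restr_h)
  qed
qed

lemma lift_lead':
  assumes "q \<in> mp.span (lead ` L)" "L \<subseteq> {l \<in> \<Lambda>. N' l = \<nu>}"
    and "\<And>l. l \<in> L \<Longrightarrow> Poly_Mapping.keys (h l) \<subseteq> S"
  obtains g where "g \<in> J" "Poly_Mapping.keys g \<subseteq> {\<beta>. \<nu> \<le> w' \<beta>}" "restr {\<beta>. w' \<beta> = \<nu>} g = q"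
    "g \<in> mp.span (h ` L)" "Poly_Mapping.keys g \<subseteq> S"
proof -
  obtain A c where A: "finite A" "A \<subseteq> L" "q = (\<Sum>l\<in>A. const (c l) * lead l)"
    using in_span_imageE[OF assms(1)] .
  have AL: "l \<in> \<Lambda>" "N' l = \<nu>" if "l \<in> A" for l using that A(2) assms(2) by auto
  show thesis
  proof (rule that[of "\<Sum>l\<in>A. const (c l) * h l"])
    show "(\<Sum>l\<in>A. const (c l) * h l) \<in> J"
      by (intro mp.subspace_sum[OF J_subspace] mp.subspace_scale[OF J_subspace] h_in_J AL)
    show "Poly_Mapping.keys (\<Sum>l\<in>A. const (c l) * h l) \<subseteq> {\<beta>. \<nu> \<le> w' \<beta>}"
      using N'_le AL keys_const_mult by (intro keys_sum_subset) fastforce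
    show "restr {\<beta>. w' \<beta> = \<nu>} (\<Sum>l\<in>A. const (c l) * h l) = q"
      using AL by (simp add: A(3) restr_sum restr_const_mult restr_h')
    show "(\<Sum>l\<in>A. const (c l) * h l) \<in> mp.span (h ` L)"
      using A(2) by (intro mp.span_sum mp.span_scale mp.span_base) auto
    show "Poly_Mapping.keys (\<Sum>l\<in>A. const (c l) * h l) \<subseteq> S"
      using assms(3) A(2) keys_const_mult by (intro keys_sum_subset) fastforce
  qed
qed

text \<open>For integral weights, cancelling the part of weight \<open>\<nu>\<close> raises the minimal weight by one
  or more.\<close>

lemma raise_weight:
  fixes p g :: "('x, 'k) mpoly" and v :: "('x \<Rightarrow>\<^sub>0 nat) \<Rightarrow> int"
  assumes "Poly_Mapping.keys p \<subseteq> {\<beta>. \<nu> \<le> v \<beta>}" "Poly_Mapping.keys g \<subseteq> {\<beta>. \<nu> \<le> v \<beta>}"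
    "restr {\<beta>. v \<beta> = \<nu>} p = restr {\<beta>. v \<beta> = \<nu>} g"
  shows "Poly_Mapping.keys (p - g) \<subseteq> {\<beta>. \<nu> + 1 \<le> v \<beta>}"
proof
  fix \<beta> assume \<beta>: "\<beta> \<in> Poly_Mapping.keys (p - g)"
  have "Poly_Mapping.keys (p - g) \<subseteq> {\<beta>. \<nu> \<le> v \<beta>}" by (rule keys_diff_subset[OF assms(1,2)])
  moreover have "v \<beta> \<noteq> \<nu>"
  proof
    assume "v \<beta> = \<nu>"
    then have "Poly_Mapping.lookup p \<beta> = Poly_Mapping.lookup g \<beta>"
      using arg_cong[OF assms(3), of "\<lambda>q. Poly_Mapping.lookup q \<beta>"] by simp
    then show False using \<beta> by (simp add: in_keys_iff lookup_minus)
  qed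
  ultimately show "\<beta> \<in> {\<beta>. \<nu> + 1 \<le> v \<beta>}" using \<beta> by force
qed

lemma J_diff: "p \<in> J \<Longrightarrow> q \<in> J \<Longrightarrow> p - q \<in> J"
  using mp.subspace_diff[OF J_subspace] .

lemma J_add: "p \<in> J \<Longrightarrow> q \<in> J \<Longrightarrow> p + q \<in> J"
  using mp.subspace_add[OF J_subspace] .

text \<open>A basis of the span of the leading parts is completed by monomials to a basis of the space of
  all combinations of \<open>M\<close>; the added monomials are the standard monomials \<open>T\<close>.\<close>

lemma standard_monomials_exist:
  obtains T where "T \<subseteq> M"
    and "\<And>p. Poly_Mapping.keys p \<subseteq> M \<Longrightarrow>
          \<exists>u\<in>mp.span (lead ` \<Lambda>). \<exists>t. Poly_Mapping.keys t \<subseteq> T \<and> p = u + t"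
    and "\<And>t. Poly_Mapping.keys t \<subseteq> T \<Longrightarrow> t \<in> mp.span (lead ` \<Lambda>) \<Longrightarrow> t = 0"
proof -
  let ?m = "\<lambda>\<beta>. Poly_Mapping.single \<beta> (1::'k) :: ('x, 'k) mpoly"
  obtain U where U: "U \<subseteq> lead ` \<Lambda>" "mp.independent U" "lead ` \<Lambda> \<subseteq> mp.span U"
    using mp.maximal_independent_subset by blast
  obtain B where B: "U \<subseteq> B" "B \<subseteq> U \<union> ?m ` M" "mp.independent B" "U \<union> ?m ` M \<subseteq> mp.span B"
    using mp.maximal_independent_subset_extend[OF _ U(2), of "U \<union> ?m ` M"] by blast
  define T where "T = {\<beta> \<in> M. ?m \<beta> \<in> B - U}"
  have span_U: "mp.span U = mp.span (lead ` \<Lambda>)"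
    using U by (metis mp.span_mono mp.span_span subset_antisym)
  have BT: "B - U = ?m ` T" using B(2) by (auto simp: T_def)
  have keys_T: "Poly_Mapping.keys t \<subseteq> T" if "t \<in> mp.span (?m ` T)" for t
  proof -
    have "mp.subspace {t. Poly_Mapping.keys t \<subseteq> T}"
      unfolding mp.subspace_def mem_Collect_eq
      by (intro conjI allI impI ballI keys_add_subset order_trans[OF keys_const_mult]) auto
    moreover have "?m ` T \<subseteq> {t. Poly_Mapping.keys t \<subseteq> T}" by auto
    ultimately show ?thesis using mp.span_minimal that by blast
  qed
  have span_T: "t \<in> mp.span (?m ` S)" if "Poly_Mapping.keys t \<subseteq> S" for t S
  proof -
    have "(\<Sum>\<alpha>\<in>Poly_Mapping.keys t. const (Poly_Mapping.lookup t \<alpha>) * ?m \<alpha>) \<in> mp.span (?m ` S)"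
      using that by (intro mp.span_sum mp.span_scale mp.span_base) auto
    then show ?thesis by (simp add: const_mult_single poly_mapping_sum_singles)
  qed
  show thesis
  proof (rule that[of T])
    show "T \<subseteq> M" by (auto simp: T_def)
  next
    fix p :: "('x, 'k) mpoly" assume "Poly_Mapping.keys p \<subseteq> M"
    then have "p \<in> mp.span (?m ` M)" by (rule span_T)
    also have "\<dots> \<subseteq> mp.span B"
      using B(4) by (metis Un_subset_iff mp.span_mono mp.span_span)
    also have "B = U \<union> ?m ` T" using B(1) BT by auto
    finally obtain u t where "p = u + t" "u \<in> mp.span U" "t \<in> mp.span (?m ` T)"
      by (auto simp: mp.span_Un)
    then show "\<exists>u\<in>mp.span (lead ` \<Lambda>). \<exists>t. Poly_Mapping.keys t \<subseteq> T \<and> p = u + t"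
      using keys_T span_U by blast
  next
    fix t :: "('x, 'k) mpoly" assume t: "Poly_Mapping.keys t \<subseteq> T" "t \<in> mp.span (lead ` \<Lambda>)"
    have "mp.span U \<inter> mp.span (?m ` T) = {0}"
    proof (intro equalityI subsetI)
      fix v assume v: "v \<in> mp.span U \<inter> mp.span (?m ` T)"
      have "mp.representation B v = mp.representation U v"
        by (rule mp.representation_extend) (use B v in auto)
      moreover have "mp.representation B v = mp.representation (?m ` T) v"
        by (rule mp.representation_extend) (use B BT v in auto)
      ultimately have "mp.representation B v x = 0" for x
        using mp.representation_ne_zero[of U v x] mp.representation_ne_zero[of "?m ` T" v x] BT by auto
      moreover have "v \<in> mp.span B" using v mp.span_mono[OF B(1)] by auto
      ultimately show "v \<in> {0}"
        using mp.sum_nonzero_representation_eq[OF B(3), of v] by simp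
    qed (auto simp: mp.span_zero)
    then show "t = 0" using span_T[OF t(1)] t(2) span_U by blast
  qed
qed

text \<open>
  The initial space of \<open>J\<close> for \<open>w'\<close> is no larger than the span of the leading parts. Standard
  monomials are independent modulo \<open>J\<close>, since the \<open>w\<close>-initial part of a relation among them would be
  a combination of leading parts. Lowest parts can be rewritten, modulo \<open>J\<close>, in standard monomials
  without lowering \<open>w'\<close>; so a \<open>w'\<close>-initial part outside the span would lead to a relation among
  standard monomials.
\<close>

lemma initial_in_span_lead:
  assumes "p \<in> J" "Poly_Mapping.keys p \<subseteq> {\<beta>. \<nu> \<le> w' \<beta>}"
  shows "restr {\<beta>. w' \<beta> = \<nu>} p \<in> mp.span (lead ` \<Lambda>)"
proof -
  obtain T where T: "T \<subseteq> M"
    and spans: "\<And>p. Poly_Mapping.keys p \<subseteq> M \<Longrightarrow>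
          \<exists>u\<in>mp.span (lead ` \<Lambda>). \<exists>t. Poly_Mapping.keys t \<subseteq> T \<and> p = u + t"
    and indep: "\<And>t. Poly_Mapping.keys t \<subseteq> T \<Longrightarrow> t \<in> mp.span (lead ` \<Lambda>) \<Longrightarrow> t = 0"
    using standard_monomials_exist by blast
  \<comment> \<open>The part of lowest \<open>w\<close>-weight of a relation lies in the span of the leading parts.\<close>
  have indep_J: "t = 0" if t: "Poly_Mapping.keys t \<subseteq> T" "t \<in> J" for t
  proof (rule ccontr)
    assume "t \<noteq> 0"
    then have ne: "Poly_Mapping.keys t \<noteq> {}" by simp
    define \<mu> where "\<mu> = Min (w ` Poly_Mapping.keys t)"
    have \<mu>: "Poly_Mapping.keys t \<subseteq> {\<beta>. \<mu> \<le> w \<beta>}" by (auto simp: \<mu>_def)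
    have "\<mu> \<in> w ` Poly_Mapping.keys t" unfolding \<mu>_def using ne by (intro Min_in) auto
    then obtain \<beta> where \<beta>: "\<beta> \<in> Poly_Mapping.keys t" "w \<beta> = \<mu>" by auto
    have "restr {\<beta>. w \<beta> = \<mu>} t \<in> mp.span (lead ` {l \<in> {l \<in> \<Lambda>. \<mu> \<le> N l}. N l = \<mu>})"
      by (rule restr_w_span_h[OF gen[OF t(2) \<mu>]]) simp
    then have "restr {\<beta>. w \<beta> = \<mu>} t \<in> mp.span (lead ` \<Lambda>)"
      by (rule rev_subsetD[OF _ mp.span_mono]) auto
    then have "restr {\<beta>. w \<beta> = \<mu>} t = 0" using t(1) by (intro indep) auto
    then have "Poly_Mapping.lookup (restr {\<beta>. w \<beta> = \<mu>} t) \<beta> = 0" by simp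
    then show False using \<beta> by (simp add: in_keys_iff)
  qed
  have split: "\<exists>u\<in>mp.span (lead ` {l \<in> \<Lambda>. N' l = \<nu>}).
      \<exists>t. Poly_Mapping.keys t \<subseteq> T \<inter> {\<beta>. w' \<beta> = \<nu>} \<and> restr {\<beta>. w' \<beta> = \<nu>} p = u + t"
    if p: "Poly_Mapping.keys p \<subseteq> M" for p \<nu>
  proof -
    obtain u t where ut: "u \<in> mp.span (lead ` \<Lambda>)" "Poly_Mapping.keys t \<subseteq> T" "p = u + t"
      using spans[OF p] by blast
    have "restr {\<beta>. w' \<beta> = \<nu>} p = restr {\<beta>. w' \<beta> = \<nu>} u + restr {\<beta>. w' \<beta> = \<nu>} t"
      by (simp add: ut(3) restr_add)
    moreover have "restr {\<beta>. w' \<beta> = \<nu>} u \<in> mp.span (lead ` {l \<in> \<Lambda>. N' l = \<nu>})"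
      by (rule restr_w'_span_lead[OF ut(1)]) simp
    moreover have "Poly_Mapping.keys (restr {\<beta>. w' \<beta> = \<nu>} t) \<subseteq> T \<inter> {\<beta>. w' \<beta> = \<nu>}"
      using ut(2) by auto
    ultimately show ?thesis by blast
  qed
  \<comment> \<open>Induction on the distance of \<open>\<nu>\<close> from the upper bound \<open>C\<close>; beyond \<open>C\<close> there are no monomials.\<close>
  have reduce: "\<exists>t. Poly_Mapping.keys t \<subseteq> T \<inter> {\<beta>. \<nu> \<le> w' \<beta>} \<and> p - t \<in> J"
    if "Poly_Mapping.keys p \<subseteq> M \<inter> {\<beta>. \<nu> \<le> w' \<beta>}" for p \<nu>
    using that
  proof (induction "nat (C + 1 - \<nu>)" arbitrary: p \<nu>)
    case 0
    then have "Poly_Mapping.keys p = {}" using w'_bound by fastforce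
    then show ?case by (intro exI[of _ 0]) (simp add: mp.subspace_0[OF J_subspace])
  next
    case (Suc k)
    have k: "k = nat (C + 1 - (\<nu> + 1))" using Suc.hyps(2) by linarith
    obtain u t where ut: "u \<in> mp.span (lead ` {l \<in> \<Lambda>. N' l = \<nu>})"
      "Poly_Mapping.keys t \<subseteq> T \<inter> {\<beta>. w' \<beta> = \<nu>}" "restr {\<beta>. w' \<beta> = \<nu>} p = u + t"
      using split[of p \<nu>] Suc.prems by blast
    obtain g where g: "g \<in> J" "Poly_Mapping.keys g \<subseteq> {\<beta>. \<nu> \<le> w' \<beta>}" "restr {\<beta>. w' \<beta> = \<nu>} g = u"
      using lift_lead'[OF ut(1) order_refl, of UNIV] by auto
    have "Poly_Mapping.keys (p - (g + t)) \<subseteq> {\<beta>. \<nu> + 1 \<le> w' \<beta>}"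
    proof (rule raise_weight)
      show "Poly_Mapping.keys (g + t) \<subseteq> {\<beta>. \<nu> \<le> w' \<beta>}" using g(2) ut(2) by (intro keys_add_subset) auto
      have "restr {\<beta>. w' \<beta> = \<nu>} t = t" using ut(2) by (intro restr_eq_self) auto
      then show "restr {\<beta>. w' \<beta> = \<nu>} p = restr {\<beta>. w' \<beta> = \<nu>} (g + t)"
        by (simp add: restr_add g ut)
    qed (use Suc.prems in auto)
    moreover have "Poly_Mapping.keys (p - (g + t)) \<subseteq> M"
      using Suc.prems J_keys[OF g(1)] ut(2) T by (intro keys_diff_subset keys_add_subset) auto
    ultimately obtain t' where t': "Poly_Mapping.keys t' \<subseteq> T \<inter> {\<beta>. \<nu> + 1 \<le> w' \<beta>}" "p - (g + t) - t' \<in> J"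
      using Suc.hyps(1)[OF k, of "p - (g + t)"] by (auto simp del: Int_subset_iff)
    have "p - (t + t') = (p - (g + t) - t') + g" by simp
    then have "p - (t + t') \<in> J" using J_add[OF t'(2) g(1)] by (simp only:)
    moreover have "Poly_Mapping.keys (t + t') \<subseteq> T \<inter> {\<beta>. \<nu> \<le> w' \<beta>}"
      using ut(2) t'(1) by (intro keys_add_subset) force+
    ultimately show ?case by blast
  qed
  obtain u t where ut: "u \<in> mp.span (lead ` {l \<in> \<Lambda>. N' l = \<nu>})"
    "Poly_Mapping.keys t \<subseteq> T \<inter> {\<beta>. w' \<beta> = \<nu>}" "restr {\<beta>. w' \<beta> = \<nu>} p = u + t"
    using split[OF J_keys[OF assms(1)]] by blast
  obtain g where g: "g \<in> J" "Poly_Mapping.keys g \<subseteq> {\<beta>. \<nu> \<le> w' \<beta>}" "restr {\<beta>. w' \<beta> = \<nu>} g = u"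
    using lift_lead'[OF ut(1) order_refl, of UNIV] by auto
  have t_self: "restr {\<beta>. w' \<beta> = \<nu>} t = t" using ut(2) by (intro restr_eq_self) auto
  have "Poly_Mapping.keys (p - (g + t)) \<subseteq> {\<beta>. \<nu> + 1 \<le> w' \<beta>}"
  proof (rule raise_weight)
    show "Poly_Mapping.keys (g + t) \<subseteq> {\<beta>. \<nu> \<le> w' \<beta>}" using g(2) ut(2) by (intro keys_add_subset) auto
    show "restr {\<beta>. w' \<beta> = \<nu>} p = restr {\<beta>. w' \<beta> = \<nu>} (g + t)"
      by (simp add: restr_add g ut t_self)
  qed (use assms(2) in auto)
  moreover have "Poly_Mapping.keys (p - (g + t)) \<subseteq> M"
    using J_keys[OF assms(1)] J_keys[OF g(1)] ut(2) T by (intro keys_diff_subset keys_add_subset) auto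
  ultimately obtain t' where t': "Poly_Mapping.keys t' \<subseteq> T \<inter> {\<beta>. \<nu> + 1 \<le> w' \<beta>}" "p - (g + t) - t' \<in> J"
    using reduce[of "p - (g + t)" "\<nu> + 1"] by blast
  have "t + t' = p - g - (p - (g + t) - t')" by simp
  then have "t + t' \<in> J" using J_diff[OF J_diff[OF assms(1) g(1)] t'(2)] by simp
  moreover have "Poly_Mapping.keys (t + t') \<subseteq> T" using ut(2) t'(1) by (intro keys_add_subset) auto
  ultimately have "t + t' = 0" using indep_J by blast
  moreover have "restr {\<beta>. w' \<beta> = \<nu>} t' = 0" using t'(1) by (intro restr_eq_zero) force
  ultimately have "t = 0" using t_self by (metis add.right_neutral restr_add restr_zero)
  then show ?thesis using ut(1,3) mp.span_mono[of "lead ` {l \<in> \<Lambda>. N' l = \<nu>}" "lead ` \<Lambda>"] by auto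
qed

text \<open>
  \<open>Q\<close> is the set of monomials that satisfy fixed bounds for all other rows, and \<open>\<Lambda>Q\<close> the set of
  generators whose formal weights satisfy these bounds. The assumptions \<open>reduce_Q\<close> and
  \<open>generate_Q\<close> are the two properties of the old row in the presence of these bounds; the lemmas
  \<open>reduce_Q'\<close> and \<open>generate_Q'\<close> prove them for the new row.
\<close>

context
  fixes Q :: "('x \<Rightarrow>\<^sub>0 nat) set" and \<Lambda>Q :: "'l set"
  assumes \<Lambda>Q: "\<Lambda>Q \<subseteq> \<Lambda>" and h_Q: "l \<in> \<Lambda>Q \<Longrightarrow> Poly_Mapping.keys (h l) \<subseteq> Q"
    and Q_M: "Q \<subseteq> M"
    and reduce_Q: "\<And>p \<nu> g. Poly_Mapping.keys p \<subseteq> Q \<Longrightarrow> g \<in> J \<Longrightarrow>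
        Poly_Mapping.keys (p - g) \<subseteq> {\<beta>. \<nu> \<le> w \<beta>} \<Longrightarrow>
        \<exists>g\<in>J. Poly_Mapping.keys (p - g) \<subseteq> Q \<inter> {\<beta>. \<nu> \<le> w \<beta>}"
    and generate_Q: "\<And>p \<nu>. p \<in> J \<Longrightarrow> Poly_Mapping.keys p \<subseteq> Q \<inter> {\<beta>. \<nu> \<le> w \<beta>} \<Longrightarrow>
        p \<in> mp.span (h ` {l \<in> \<Lambda>Q. \<nu> \<le> N l})"
begin

text \<open>
  An element of the span of leading parts that respects the other rows is a combination of leading
  parts of generators that respect them. A \<open>w\<close>-homogeneous part of \<open>q\<close> is the lowest part of some
  element of \<open>J\<close>, so modulo \<open>J\<close> it can be moved to higher \<open>w\<close>-weight; by \<open>reduce_Q\<close> this is possible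
  within \<open>Q\<close>, and \<open>generate_Q\<close> applies to the relation that does it.
\<close>

lemma span_lead_Q:
  assumes q: "q \<in> mp.span (lead ` \<Lambda>)" "Poly_Mapping.keys q \<subseteq> Q \<inter> {\<beta>. w' \<beta> = \<nu>'}"
  shows "q \<in> mp.span (lead ` {l \<in> \<Lambda>Q. N' l = \<nu>'})"
proof -
  have part: "restr {\<beta>. w \<beta> = \<nu>} q \<in> mp.span (lead ` \<Lambda>Q)" for \<nu>
  proof -
    let ?q = "restr {\<beta>. w \<beta> = \<nu>} q"
    have "?q \<in> mp.span (lead ` {l \<in> \<Lambda>. N l = \<nu>})"
      by (rule restr_w_span_lead[OF q(1)]) simp
    then obtain g where g: "g \<in> J" "Poly_Mapping.keys g \<subseteq> {\<beta>. \<nu> \<le> w \<beta>}" "restr {\<beta>. w \<beta> = \<nu>} g = ?q"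
      using lift_lead[OF _ order_refl] by blast
    have "Poly_Mapping.keys (?q - g) \<subseteq> {\<beta>. \<nu> + 1 \<le> w \<beta>}"
      by (rule raise_weight) (use g in \<open>auto simp: restr_restr\<close>)
    moreover have qQ: "Poly_Mapping.keys ?q \<subseteq> Q" using q(2) by auto
    ultimately obtain g' where g': "g' \<in> J" "Poly_Mapping.keys (?q - g') \<subseteq> Q \<inter> {\<beta>. \<nu> + 1 \<le> w \<beta>}"
      using reduce_Q g(1) by blast
    have "g' = ?q - (?q - g')" by simp
    moreover have "Poly_Mapping.keys (?q - (?q - g')) \<subseteq> Q \<inter> {\<beta>. \<nu> \<le> w \<beta>}"
      by (rule keys_diff_subset) (use qQ g'(2) in force)+
    ultimately have "Poly_Mapping.keys g' \<subseteq> Q \<inter> {\<beta>. \<nu> \<le> w \<beta>}" by simp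
    from generate_Q[OF g'(1) this]
    have "restr {\<beta>. w \<beta> = \<nu>} g' \<in> mp.span (lead ` {l \<in> {l \<in> \<Lambda>Q. \<nu> \<le> N l}. N l = \<nu>})"
      by (rule restr_w_span_h) (use \<Lambda>Q in auto)
    moreover have "restr {\<beta>. w \<beta> = \<nu>} g' = ?q"
    proof -
      have "restr {\<beta>. w \<beta> = \<nu>} (?q - g') = 0"
        using g'(2) by (intro restr_eq_zero) force
      then show ?thesis by (simp add: restr_diff restr_restr)
    qed
    ultimately show ?thesis
      using mp.span_mono[of "lead ` {l \<in> {l \<in> \<Lambda>Q. \<nu> \<le> N l}. N l = \<nu>}" "lead ` \<Lambda>Q"] by auto
  qed
  have "q = (\<Sum>\<nu>\<in>w ` Poly_Mapping.keys q. restr {\<beta>. w \<beta> = \<nu>} q)"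
    by (rule sum_restr_fibres[symmetric]) auto
  also have "\<dots> \<in> mp.span (lead ` \<Lambda>Q)" by (intro mp.span_sum part)
  finally have "restr {\<beta>. w' \<beta> = \<nu>'} q \<in> mp.span (lead ` {l \<in> \<Lambda>Q. N' l = \<nu>'})"
    by (rule restr_w'_span_lead) (rule \<Lambda>Q)
  moreover have "restr {\<beta>. w' \<beta> = \<nu>'} q = q" using q(2) by (intro restr_eq_self) auto
  ultimately show ?thesis by simp
qed

text \<open>If \<open>p\<close> can be moved modulo \<open>J\<close> to weight above \<open>\<nu>\<close> at all, then this can be done within \<open>Q\<close>, and
  by generators that belong to \<open>\<Lambda>Q\<close>.\<close>

lemma cancel_lowest_part:
  assumes p: "Poly_Mapping.keys p \<subseteq> Q \<inter> {\<beta>. \<nu> \<le> w' \<beta>}"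
    and f: "f \<in> J" "Poly_Mapping.keys (p - f) \<subseteq> {\<beta>. \<nu> + 1 \<le> w' \<beta>}"
  obtains g where "g \<in> J" "g \<in> mp.span (h ` {l \<in> \<Lambda>Q. N' l = \<nu>})"
    "Poly_Mapping.keys (p - g) \<subseteq> Q \<inter> {\<beta>. \<nu> + 1 \<le> w' \<beta>}"
proof -
  have "f = p - (p - f)" by simp
  moreover have "Poly_Mapping.keys (p - (p - f)) \<subseteq> {\<beta>. \<nu> \<le> w' \<beta>}"
    by (rule keys_diff_subset) (use p f(2) in force)+
  ultimately have "Poly_Mapping.keys f \<subseteq> {\<beta>. \<nu> \<le> w' \<beta>}" by simp
  from initial_in_span_lead[OF f(1) this]
  have "restr {\<beta>. w' \<beta> = \<nu>} f \<in> mp.span (lead ` \<Lambda>)" .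
  moreover have "restr {\<beta>. w' \<beta> = \<nu>} (p - f) = 0"
    using f(2) by (intro restr_eq_zero) force
  ultimately have "restr {\<beta>. w' \<beta> = \<nu>} p \<in> mp.span (lead ` \<Lambda>)" by (simp add: restr_diff)
  then have "restr {\<beta>. w' \<beta> = \<nu>} p \<in> mp.span (lead ` {l \<in> \<Lambda>Q. N' l = \<nu>})"
    by (rule span_lead_Q) (use p in auto)
  then obtain g where g: "g \<in> J" "Poly_Mapping.keys g \<subseteq> {\<beta>. \<nu> \<le> w' \<beta>}"
    "restr {\<beta>. w' \<beta> = \<nu>} g = restr {\<beta>. w' \<beta> = \<nu>} p"
    "g \<in> mp.span (h ` {l \<in> \<Lambda>Q. N' l = \<nu>})" "Poly_Mapping.keys g \<subseteq> Q"
    by (rule lift_lead'[where \<nu> = \<nu> and S = Q]) (use \<Lambda>Q h_Q in auto)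
  have "Poly_Mapping.keys (p - g) \<subseteq> {\<beta>. \<nu> + 1 \<le> w' \<beta>}"
    by (rule raise_weight) (use p g in auto)
  moreover have "Poly_Mapping.keys (p - g) \<subseteq> Q"
    by (rule keys_diff_subset) (use p g in auto)
  ultimately show thesis using that g by blast
qed

lemma reduce_Q':
  assumes "Poly_Mapping.keys p \<subseteq> Q" "f \<in> J" "Poly_Mapping.keys (p - f) \<subseteq> {\<beta>. \<nu> \<le> w' \<beta>}"
  shows "\<exists>g\<in>J. Poly_Mapping.keys (p - g) \<subseteq> Q \<inter> {\<beta>. \<nu> \<le> w' \<beta>}"
proof -
  have "\<exists>g\<in>J. Poly_Mapping.keys (p - g) \<subseteq> Q \<inter> {\<beta>. \<nu> \<le> w' \<beta>}"
    if "Poly_Mapping.keys p \<subseteq> Q \<inter> {\<beta>. \<mu> \<le> w' \<beta>}" "f \<in> J" "Poly_Mapping.keys (p - f) \<subseteq> {\<beta>. \<nu> \<le> w' \<beta>}"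
    for p \<mu> f
    using that
  proof (induction "nat (\<nu> - \<mu>)" arbitrary: p \<mu> f)
    case 0
    then show ?case
      by (intro bexI[of _ 0]) (force simp: mp.subspace_0[OF J_subspace])+
  next
    case (Suc k)
    have k: "k = nat (\<nu> - (\<mu> + 1))" and "\<mu> < \<nu>" using Suc.hyps(2) by linarith+
    then have "Poly_Mapping.keys (p - f) \<subseteq> {\<beta>. \<mu> + 1 \<le> w' \<beta>}" using Suc.prems(3) by force
    then obtain g where g: "g \<in> J" "Poly_Mapping.keys (p - g) \<subseteq> Q \<inter> {\<beta>. \<mu> + 1 \<le> w' \<beta>}"
      using cancel_lowest_part[OF Suc.prems(1,2)] by blast
    obtain g' where g': "g' \<in> J" "Poly_Mapping.keys (p - g - g') \<subseteq> Q \<inter> {\<beta>. \<nu> \<le> w' \<beta>}"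
      using Suc.hyps(1)[OF k g(2) J_diff[OF Suc.prems(2) g(1)]] Suc.prems(3) by auto
    then show ?case using J_add[OF g(1) g'(1)] by (intro bexI[of _ "g + g'"]) (simp_all add: diff_diff_eq)
  qed
  moreover have "Poly_Mapping.keys p \<subseteq> Q \<inter> {\<beta>. Min (w' ` Poly_Mapping.keys p) \<le> w' \<beta>}"
    using assms(1) by auto
  ultimately show ?thesis using assms by blast
qed

lemma generate_Q':
  assumes "p \<in> J" "Poly_Mapping.keys p \<subseteq> Q \<inter> {\<beta>. \<nu> \<le> w' \<beta>}"
  shows "p \<in> mp.span (h ` {l \<in> \<Lambda>Q. \<nu> \<le> N' l})"
  using assms
proof (induction "nat (C + 1 - \<nu>)" arbitrary: p \<nu>)
  case 0
  then have "Poly_Mapping.keys p = {}" using w'_bound Q_M by fastforce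
  then show ?case by (simp add: mp.span_zero)
next
  case (Suc k)
  obtain g where g: "g \<in> J" "g \<in> mp.span (h ` {l \<in> \<Lambda>Q. N' l = \<nu>})"
    "Poly_Mapping.keys (p - g) \<subseteq> Q \<inter> {\<beta>. \<nu> + 1 \<le> w' \<beta>}"
    using cancel_lowest_part[OF Suc.prems(2,1)] by (auto simp del: Int_subset_iff)
  have k: "k = nat (C + 1 - (\<nu> + 1))" using Suc.hyps(2) by linarith
  have "p - g \<in> mp.span (h ` {l \<in> \<Lambda>Q. \<nu> + 1 \<le> N' l})"
    by (rule Suc.hyps(1)[OF k J_diff[OF Suc.prems(1) g(1)] g(3)])
  then have "p - g \<in> mp.span (h ` {l \<in> \<Lambda>Q. \<nu> \<le> N' l})"
    by (rule rev_subsetD[OF _ mp.span_mono]) auto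
  moreover have "g \<in> mp.span (h ` {l \<in> \<Lambda>Q. \<nu> \<le> N' l})"
    by (rule rev_subsetD[OF g(2) mp.span_mono]) auto
  ultimately have "(p - g) + g \<in> mp.span (h ` {l \<in> \<Lambda>Q. \<nu> \<le> N' l})" by (rule mp.span_add)
  then show ?case by simp
qed

end

end

section \<open>Changing all weights\<close>

text \<open>With \<open>F i\<close> the combinations of monomials of \<open>i\<close>-th weight at least \<open>\<mu> i\<close>, this is the inclusion
  \<open>(\<Inter>i. J + F i) \<subseteq> J + (\<Inter>i. F i)\<close>, whose converse is trivial. Distributivity of this kind fails for
  filtrations in general position.\<close>

definition jointly_reducible ::
  "nat \<Rightarrow> ('x \<Rightarrow>\<^sub>0 nat) set \<Rightarrow> ('x, 'k::field) mpoly set \<Rightarrow> (nat \<Rightarrow> ('x \<Rightarrow>\<^sub>0 nat) \<Rightarrow> int) \<Rightarrow> bool" where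
  "jointly_reducible n M J w \<longleftrightarrow> (\<forall>p \<mu>. Poly_Mapping.keys p \<subseteq> M \<longrightarrow>
     (\<forall>i<n. \<exists>g\<in>J. Poly_Mapping.keys (p - g) \<subseteq> {\<beta>. \<mu> i \<le> w i \<beta>}) \<longrightarrow>
     (\<exists>g\<in>J. Poly_Mapping.keys (p - g) \<subseteq> {\<beta>. \<forall>i<n. \<mu> i \<le> w i \<beta>}))"

text \<open>The \<open>h l\<close> with their formal weights \<open>N i l\<close> generate \<open>J\<close> together with its \<open>n\<close> filtrations, as the
  homogeneous generators of a Rees algebra with \<open>n\<close> parameters would.\<close>

definition filtered_generators ::
  "nat \<Rightarrow> ('x, 'k::field) mpoly set \<Rightarrow> ('l \<Rightarrow> ('x, 'k) mpoly) \<Rightarrow> 'l set \<Rightarrow>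
   (nat \<Rightarrow> ('x \<Rightarrow>\<^sub>0 nat) \<Rightarrow> int) \<Rightarrow> (nat \<Rightarrow> 'l \<Rightarrow> int) \<Rightarrow> bool" where
  "filtered_generators n J h \<Lambda> w N \<longleftrightarrow>
     (\<forall>i<n. \<forall>l\<in>\<Lambda>. \<forall>\<beta>\<in>Poly_Mapping.keys (h l). N i l \<le> w i \<beta>) \<and>
     (\<forall>p\<in>J. \<forall>\<mu>. Poly_Mapping.keys p \<subseteq> {\<beta>. \<forall>i<n. \<mu> i \<le> w i \<beta>} \<longrightarrow>
        p \<in> mp.span (h ` {l \<in> \<Lambda>. \<forall>i<n. \<mu> i \<le> N i l}))"

lemma jointly_reducibleD:
  assumes "jointly_reducible n M J w" "Poly_Mapping.keys p \<subseteq> M"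
    and "\<And>i. i < n \<Longrightarrow> \<exists>g\<in>J. Poly_Mapping.keys (p - g) \<subseteq> {\<beta>. \<mu> i \<le> w i \<beta>}"
  obtains g where "g \<in> J" "Poly_Mapping.keys (p - g) \<subseteq> {\<beta>. \<forall>i<n. \<mu> i \<le> w i \<beta>}"
  using assms unfolding jointly_reducible_def by blast

lemma filtered_generatorsD:
  assumes "filtered_generators n J h \<Lambda> w N"
  shows "i < n \<Longrightarrow> l \<in> \<Lambda> \<Longrightarrow> \<beta> \<in> Poly_Mapping.keys (h l) \<Longrightarrow> N i l \<le> w i \<beta>"
    and "p \<in> J \<Longrightarrow> Poly_Mapping.keys p \<subseteq> {\<beta>. \<forall>i<n. \<mu> i \<le> w i \<beta>} \<Longrightarrow>
        p \<in> mp.span (h ` {l \<in> \<Lambda>. \<forall>i<n. \<mu> i \<le> N i l})"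
  using assms unfolding filtered_generators_def by blast+

text \<open>Both properties for the old rows feed \<open>weight_change\<close>: \<open>\<mu>\<close> without its \<open>k\<close>-th entry determines
  \<open>Q\<close> and \<open>\<Lambda>Q\<close>, and the \<open>k\<close>-th entry stays free.\<close>

lemma change_one_row:
  fixes h :: "'l \<Rightarrow> ('x, 'k::field) mpoly" and w w' :: "nat \<Rightarrow> ('x \<Rightarrow>\<^sub>0 nat) \<Rightarrow> int"
  assumes J: "mp.subspace J" and J_keys: "\<And>p. p \<in> J \<Longrightarrow> Poly_Mapping.keys p \<subseteq> M"
    and h_in_J: "\<And>l. l \<in> \<Lambda> \<Longrightarrow> h l \<in> J"
    and red: "jointly_reducible n M J w" and fgen: "filtered_generators n J h \<Lambda> w N"
    and k: "k < n" and others: "\<And>i. i \<noteq> k \<Longrightarrow> w' i = w i" "\<And>i. i \<noteq> k \<Longrightarrow> N' i = N i"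
    and N'_le: "\<And>l \<beta>. l \<in> \<Lambda> \<Longrightarrow> \<beta> \<in> Poly_Mapping.keys (h l) \<Longrightarrow> N' k l \<le> w' k \<beta>"
    and tie: "\<And>l \<beta>. l \<in> \<Lambda> \<Longrightarrow> \<beta> \<in> Poly_Mapping.keys (h l) \<Longrightarrow> w k \<beta> = N k l \<longleftrightarrow> w' k \<beta> = N' k l"
    and bound: "\<And>\<beta>. \<beta> \<in> M \<Longrightarrow> w' k \<beta> \<le> C"
  shows "jointly_reducible n M J w'" and "filtered_generators n J h \<Lambda> w' N'"
proof -
  note [simp] = others
  interpret weight_change M J h \<Lambda> "w k" "w' k" "N k" "N' k" C
  proof
    fix p \<nu> assume p: "p \<in> J" "Poly_Mapping.keys p \<subseteq> {\<beta>. \<nu> \<le> w k \<beta>}"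
    \<comment> \<open>For the other rows a bound that \<open>p\<close> satisfies anyway.\<close>
    let ?\<mu> = "\<lambda>i. if i = k then \<nu> else Min (w i ` Poly_Mapping.keys p)"
    have "p \<in> mp.span (h ` {l \<in> \<Lambda>. \<forall>i<n. ?\<mu> i \<le> N i l})"
      by (rule filtered_generatorsD(2)[OF fgen p(1)]) (use p(2) in auto)
    then show "p \<in> mp.span (h ` {l \<in> \<Lambda>. \<nu> \<le> N k l})"
      by (rule rev_subsetD[OF _ mp.span_mono]) (use k in auto)
  qed (use J J_keys h_in_J filtered_generatorsD(1)[OF fgen k] N'_le tie bound in auto)
  have zero_J: "0 \<in> J" by (rule mp.subspace_0[OF J])
  define Q where "Q \<mu> = {\<beta> \<in> M. \<forall>i<n. i \<noteq> k \<longrightarrow> \<mu> i \<le> w i \<beta>}" for \<mu>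
  define \<Lambda>Q where "\<Lambda>Q \<mu> = {l \<in> \<Lambda>. \<forall>i<n. i \<noteq> k \<longrightarrow> \<mu> i \<le> N i l}" for \<mu>
  have 1: "\<Lambda>Q \<mu> \<subseteq> \<Lambda>" "Q \<mu> \<subseteq> M" for \<mu> by (auto simp: \<Lambda>Q_def Q_def)
  have 2: "Poly_Mapping.keys (h l) \<subseteq> Q \<mu>" if l: "l \<in> \<Lambda>Q \<mu>" for l \<mu>
  proof
    fix \<beta> assume \<beta>: "\<beta> \<in> Poly_Mapping.keys (h l)"
    have "\<mu> i \<le> w i \<beta>" if "i < n" "i \<noteq> k" for i
      using l that filtered_generatorsD(1)[OF fgen that(1) _ \<beta>] by (fastforce simp: \<Lambda>Q_def)
    moreover have "\<beta> \<in> M" using J_keys[OF h_in_J[of l]] l \<beta> by (auto simp: \<Lambda>Q_def)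
    ultimately show "\<beta> \<in> Q \<mu>" by (auto simp: Q_def)
  qed
  have split_row: "{\<beta> \<in> M. \<forall>i<n. (\<mu>(k := \<nu>)) i \<le> w i \<beta>} = Q \<mu> \<inter> {\<beta>. \<nu> \<le> w k \<beta>}" for \<mu> \<nu>
    using k by (auto simp: Q_def)
  have split_row': "{\<beta> \<in> M. \<forall>i<n. \<mu> i \<le> w' i \<beta>} = Q \<mu> \<inter> {\<beta>. \<mu> k \<le> w' k \<beta>}" for \<mu>
    using k by (auto simp: Q_def) (metis others(1))+
  have split_gen: "{l \<in> \<Lambda>. \<forall>i<n. (\<mu>(k := \<nu>)) i \<le> N i l} = {l \<in> \<Lambda>Q \<mu>. \<nu> \<le> N k l}" for \<mu> \<nu>
    using k by (auto simp: \<Lambda>Q_def)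
  have split_gen': "{l \<in> \<Lambda>. \<forall>i<n. \<mu> i \<le> N' i l} = {l \<in> \<Lambda>Q \<mu>. \<mu> k \<le> N' k l}" for \<mu>
    using k by (auto simp: \<Lambda>Q_def) (metis others(2))+
  have in_M: "Poly_Mapping.keys (p - g) \<subseteq> M" if "Poly_Mapping.keys p \<subseteq> M" "g \<in> J" for p g
    using keys_diff_subset[OF that(1) J_keys[OF that(2)]] .
  have 3: "\<exists>g\<in>J. Poly_Mapping.keys (p - g) \<subseteq> Q \<mu> \<inter> {\<beta>. \<nu> \<le> w k \<beta>}"
    if p: "Poly_Mapping.keys p \<subseteq> Q \<mu>" and g: "g \<in> J" "Poly_Mapping.keys (p - g) \<subseteq> {\<beta>. \<nu> \<le> w k \<beta>}"
    for p \<mu> \<nu> g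
  proof -
    have pM: "Poly_Mapping.keys p \<subseteq> M" using p 1(2) by blast
    have "\<exists>g\<in>J. Poly_Mapping.keys (p - g) \<subseteq> {\<beta>. (\<mu>(k := \<nu>)) i \<le> w i \<beta>}" if "i < n" for i
    proof (cases "i = k")
      case True
      then show ?thesis using g by auto
    next
      case False
      then show ?thesis using p that zero_J by (intro bexI[of _ 0]) (auto simp: Q_def)
    qed
    then obtain g' where g': "g' \<in> J" "Poly_Mapping.keys (p - g') \<subseteq> {\<beta>. \<forall>i<n. (\<mu>(k := \<nu>)) i \<le> w i \<beta>}"
      using jointly_reducibleD[OF red pM, of "\<mu>(k := \<nu>)"] by blast
    have "Poly_Mapping.keys (p - g') \<subseteq> {\<beta> \<in> M. \<forall>i<n. (\<mu>(k := \<nu>)) i \<le> w i \<beta>}"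
      using g'(2) in_M[OF pM g'(1)] by blast
    then show ?thesis using g'(1) unfolding split_row by blast
  qed
  have 4: "p \<in> mp.span (h ` {l \<in> \<Lambda>Q \<mu>. \<nu> \<le> N k l})"
    if "p \<in> J" "Poly_Mapping.keys p \<subseteq> Q \<mu> \<inter> {\<beta>. \<nu> \<le> w k \<beta>}" for p \<mu> \<nu>
  proof -
    have "Poly_Mapping.keys p \<subseteq> {\<beta>. \<forall>i<n. (\<mu>(k := \<nu>)) i \<le> w i \<beta>}"
      using that(2) unfolding split_row[symmetric] by blast
    from filtered_generatorsD(2)[OF fgen that(1) this] show ?thesis unfolding split_gen .
  qed
  show "filtered_generators n J h \<Lambda> w' N'"
    unfolding filtered_generators_def
  proof (intro conjI allI impI ballI)
    fix i l \<beta> assume "i < n" "l \<in> \<Lambda>" "\<beta> \<in> Poly_Mapping.keys (h l)"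
    then show "N' i l \<le> w' i \<beta>"
      using filtered_generatorsD(1)[OF fgen] N'_le by (cases "i = k") auto
  next
    fix p \<mu> assume p: "p \<in> J" "Poly_Mapping.keys p \<subseteq> {\<beta>. \<forall>i<n. \<mu> i \<le> w' i \<beta>}"
    then have p': "Poly_Mapping.keys p \<subseteq> Q \<mu> \<inter> {\<beta>. \<mu> k \<le> w' k \<beta>}"
      unfolding split_row'[symmetric] using J_keys by blast
    show "p \<in> mp.span (h ` {l \<in> \<Lambda>. \<forall>i<n. \<mu> i \<le> N' i l})"
      unfolding split_gen'
      by (rule generate_Q'[where \<Lambda>Q = "\<Lambda>Q \<mu>" and Q = "Q \<mu>"]) (fact 1 2 3 4 p(1) p')+
  qed
  show "jointly_reducible n M J w'"
    unfolding jointly_reducible_def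
  proof (intro allI impI)
    fix p \<mu>
    assume pM: "Poly_Mapping.keys p \<subseteq> M"
      and each: "\<forall>i<n. \<exists>g\<in>J. Poly_Mapping.keys (p - g) \<subseteq> {\<beta>. \<mu> i \<le> w' i \<beta>}"
    \<comment> \<open>First merge the other rows, with a vacuous bound for row \<open>k\<close>; then correct row \<open>k\<close> alone.\<close>
    have "\<exists>g\<in>J. Poly_Mapping.keys (p - g) \<subseteq> {\<beta>. (\<mu>(k := Min (w k ` Poly_Mapping.keys p))) i \<le> w i \<beta>}"
      if "i < n" for i
    proof (cases "i = k")
      case True
      then show ?thesis using zero_J by (intro bexI[of _ 0]) auto
    next
      case False
      then show ?thesis using each[rule_format, OF that] by simp
    qed
    then obtain g0 where g0: "g0 \<in> J"
      "Poly_Mapping.keys (p - g0) \<subseteq> {\<beta>. \<forall>i<n. (\<mu>(k := Min (w k ` Poly_Mapping.keys p))) i \<le> w i \<beta>}"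
      using jointly_reducibleD[OF red pM, of "\<mu>(k := Min (w k ` Poly_Mapping.keys p))"] by blast
    have Q0: "Poly_Mapping.keys (p - g0) \<subseteq> Q \<mu>"
      using g0(2) in_M[OF pM g0(1)] by (fastforce simp: Q_def subset_iff split: if_splits)
    obtain gk where gk: "gk \<in> J" "Poly_Mapping.keys (p - gk) \<subseteq> {\<beta>. \<mu> k \<le> w' k \<beta>}"
      using each k by blast
    have gk': "Poly_Mapping.keys (p - g0 - (gk - g0)) \<subseteq> {\<beta>. \<mu> k \<le> w' k \<beta>}" using gk(2) by simp
    have "\<exists>g\<in>J. Poly_Mapping.keys (p - g0 - g) \<subseteq> Q \<mu> \<inter> {\<beta>. \<mu> k \<le> w' k \<beta>}"
      by (rule reduce_Q'[where \<Lambda>Q = "\<Lambda>Q \<mu>" and Q = "Q \<mu>"])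
        (fact 1 2 3 4 Q0 J_diff[OF gk(1) g0(1)] gk')+
    then obtain g1 where g1: "g1 \<in> J" "Poly_Mapping.keys (p - g0 - g1) \<subseteq> Q \<mu> \<inter> {\<beta>. \<mu> k \<le> w' k \<beta>}"
      by blast
    have "Poly_Mapping.keys (p - (g0 + g1)) \<subseteq> {\<beta>. \<forall>i<n. \<mu> i \<le> w' i \<beta>}"
      using g1(2) unfolding split_row'[symmetric] by (auto simp: diff_diff_eq)
    then show "\<exists>g\<in>J. Poly_Mapping.keys (p - g) \<subseteq> {\<beta>. \<forall>i<n. \<mu> i \<le> w' i \<beta>}"
      using J_add[OF g0(1) g1(1)] by blast
  qed
qed

text \<open>Rows are replaced in order; \<open>filtered_generators\<close> is carried along because the
  change of the next row needs it for the rows already replaced.\<close>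

theorem change_all_rows:
  fixes h :: "'l \<Rightarrow> ('x, 'k::field) mpoly" and w w' :: "nat \<Rightarrow> ('x \<Rightarrow>\<^sub>0 nat) \<Rightarrow> int"
  assumes J: "mp.subspace J" and J_keys: "\<And>p. p \<in> J \<Longrightarrow> Poly_Mapping.keys p \<subseteq> M"
    and h_in_J: "\<And>l. l \<in> \<Lambda> \<Longrightarrow> h l \<in> J"
    and red: "jointly_reducible n M J w" and gen: "filtered_generators n J h \<Lambda> w N"
    and N'_le: "\<And>i l \<beta>. i < n \<Longrightarrow> l \<in> \<Lambda> \<Longrightarrow> \<beta> \<in> Poly_Mapping.keys (h l) \<Longrightarrow> N' i l \<le> w' i \<beta>"
    and tie: "\<And>i l \<beta>. i < n \<Longrightarrow> l \<in> \<Lambda> \<Longrightarrow> \<beta> \<in> Poly_Mapping.keys (h l) \<Longrightarrow>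
        w i \<beta> = N i l \<longleftrightarrow> w' i \<beta> = N' i l"
    and bound: "\<And>i \<beta>. i < n \<Longrightarrow> \<beta> \<in> M \<Longrightarrow> w' i \<beta> \<le> C i"
  shows "jointly_reducible n M J w'"
proof -
  have "jointly_reducible n M J (\<lambda>i. if i < k then w' i else w i) \<and>
      filtered_generators n J h \<Lambda> (\<lambda>i. if i < k then w' i else w i) (\<lambda>i. if i < k then N' i else N i)"
    if "k \<le> n" for k
    using that
  proof (induction k)
    case 0
    show ?case using red gen by simp
  next
    case (Suc k)
    then have k: "k < n" by simp
    have IH: "jointly_reducible n M J (\<lambda>i. if i < k then w' i else w i)"
      "filtered_generators n J h \<Lambda> (\<lambda>i. if i < k then w' i else w i) (\<lambda>i. if i < k then N' i else N i)"
      using Suc by auto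
    show ?case
      by (intro conjI; rule change_one_row[OF J J_keys h_in_J IH k, where C = "C k"
            and w' = "\<lambda>i. if i < Suc k then w' i else w i" and N' = "\<lambda>i. if i < Suc k then N' i else N i"])
        (use N'_le[OF k] tie[OF k] bound[OF k] in auto)
  qed
  from this[of n] have "jointly_reducible n M J (\<lambda>i. if i < n then w' i else w i)" by simp
  then show ?thesis by (simp add: jointly_reducible_def)
qed

section \<open>Weights of monomials\<close>

definition wt :: "('x \<Rightarrow> 'a::comm_ring_1) \<Rightarrow> ('x \<Rightarrow>\<^sub>0 nat) \<Rightarrow> 'a" where
  "wt v \<alpha> = (\<Sum>x\<in>Poly_Mapping.keys \<alpha>. v x * of_nat (Poly_Mapping.lookup \<alpha> x))"

lemma wt_superset:
  assumes "finite A" "Poly_Mapping.keys \<alpha> \<subseteq> A"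
  shows "wt v \<alpha> = (\<Sum>x\<in>A. v x * of_nat (Poly_Mapping.lookup \<alpha> x))"
  unfolding wt_def by (rule sum.mono_neutral_left) (use assms in \<open>auto simp: in_keys_iff\<close>)

lemma wt_zero [simp]: "wt v 0 = 0"
  by (simp add: wt_def)

lemma wt_add: "wt v (\<alpha> + \<beta>) = wt v \<alpha> + wt v \<beta>"
proof -
  let ?A = "Poly_Mapping.keys \<alpha> \<union> Poly_Mapping.keys \<beta>"
  have "Poly_Mapping.keys (\<alpha> + \<beta>) \<subseteq> ?A" by (rule keys_add)
  then show ?thesis
    by (simp add: wt_superset[of ?A] lookup_add distrib_left sum.distrib)
qed

lemma wt_single [simp]: "wt v (Poly_Mapping.single x k) = v x * of_nat k"
  by (simp add: wt_def)

lemma pairing_eq_wt: "pairing = wt"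
  by (intro ext) (simp add: pairing_def wt_def)

lemma wt_cong: "(\<And>x. x \<in> Poly_Mapping.keys \<alpha> \<Longrightarrow> v x = v' x) \<Longrightarrow> wt v \<alpha> = wt v' \<alpha>"
  by (simp add: wt_def)

lemma wt_of_int: "wt (\<lambda>x. of_int (v x)) \<alpha> = of_int (wt v \<alpha>)"
  by (simp add: wt_def)

lemma keys_mult_le:
  fixes p q :: "('x, 'k::comm_ring_1) mpoly" and v :: "'x \<Rightarrow> 'a::linordered_idom"
  assumes "Poly_Mapping.keys p \<subseteq> {\<alpha>. c \<le> wt v \<alpha>}" "Poly_Mapping.keys q \<subseteq> {\<alpha>. d \<le> wt v \<alpha>}"
  shows "Poly_Mapping.keys (p * q) \<subseteq> {\<alpha>. c + d \<le> wt v \<alpha>}"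
  using keys_mult[of p q] assms by (fastforce simp: wt_add intro: add_mono)

lemma keys_mult_eq:
  fixes p q :: "('x, 'k::comm_ring_1) mpoly"
  assumes "Poly_Mapping.keys p \<subseteq> {\<alpha>. wt v \<alpha> = c}" "Poly_Mapping.keys q \<subseteq> {\<alpha>. wt v \<alpha> = d}"
  shows "Poly_Mapping.keys (p * q) \<subseteq> {\<alpha>. wt v \<alpha> = c + d}"
  using keys_mult[of p q] assms by (fastforce simp: wt_add)

lemma keys_power_le:
  fixes p :: "('x, 'k::comm_ring_1) mpoly" and v :: "'x \<Rightarrow> 'a::linordered_idom"
  assumes "Poly_Mapping.keys p \<subseteq> {\<alpha>. c \<le> wt v \<alpha>}"
  shows "Poly_Mapping.keys (p ^ k) \<subseteq> {\<alpha>. c * of_nat k \<le> wt v \<alpha>}"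
proof (induction k)
  case 0
  then show ?case by (auto simp: keys_one)
next
  case (Suc k)
  from keys_mult_le[OF assms Suc] show ?case by (simp add: algebra_simps)
qed

lemma keys_power_eq:
  fixes p :: "('x, 'k::comm_ring_1) mpoly"
  assumes "Poly_Mapping.keys p \<subseteq> {\<alpha>. wt v \<alpha> = c}"
  shows "Poly_Mapping.keys (p ^ k) \<subseteq> {\<alpha>. wt v \<alpha> = c * of_nat k}"
proof (induction k)
  case 0
  then show ?case by (auto simp: keys_one)
next
  case (Suc k)
  from keys_mult_eq[OF assms Suc] show ?case by (simp add: algebra_simps)
qed

lemma keys_prod_le:
  fixes f :: "'i \<Rightarrow> ('x, 'k::comm_ring_1) mpoly" and v :: "'x \<Rightarrow> 'a::linordered_idom"
  assumes "\<And>i. i \<in> A \<Longrightarrow> Poly_Mapping.keys (f i) \<subseteq> {\<alpha>. c i \<le> wt v \<alpha>}"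
  shows "Poly_Mapping.keys (\<Prod>i\<in>A. f i) \<subseteq> {\<alpha>. (\<Sum>i\<in>A. c i) \<le> wt v \<alpha>}"
  using assms
proof (induction A rule: infinite_finite_induct)
  case (insert x F)
  have "Poly_Mapping.keys (f x * prod f F) \<subseteq> {\<alpha>. c x + sum c F \<le> wt v \<alpha>}"
    by (rule keys_mult_le) (use insert in auto)
  then show ?case using insert by simp
qed auto

lemma keys_prod_eq:
  fixes f :: "'i \<Rightarrow> ('x, 'k::comm_ring_1) mpoly"
  assumes "\<And>i. i \<in> A \<Longrightarrow> Poly_Mapping.keys (f i) \<subseteq> {\<alpha>. wt v \<alpha> = c i}"
  shows "Poly_Mapping.keys (\<Prod>i\<in>A. f i) \<subseteq> {\<alpha>. wt v \<alpha> = (\<Sum>i\<in>A. c i)}"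
  using assms
proof (induction A rule: infinite_finite_induct)
  case (insert x F)
  have "Poly_Mapping.keys (f x * prod f F) \<subseteq> {\<alpha>. wt v \<alpha> = c x + sum c F}"
    by (rule keys_mult_eq) (use insert in auto)
  then show ?case using insert by simp
qed auto

lemma keys_mon_eval_le:
  fixes g :: "'y \<Rightarrow> ('x, 'k::comm_ring_1) mpoly" and v :: "'x \<Rightarrow> 'a::linordered_idom"
  assumes "\<And>y. y \<in> Poly_Mapping.keys \<alpha> \<Longrightarrow> Poly_Mapping.keys (g y) \<subseteq> {\<gamma>. c y \<le> wt v \<gamma>}"
  shows "Poly_Mapping.keys (mon_eval g \<alpha>) \<subseteq> {\<gamma>. wt c \<alpha> \<le> wt v \<gamma>}"
  unfolding mon_eval_def wt_def[of c] by (intro keys_prod_le keys_power_le assms)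

lemma keys_mon_eval_eq:
  fixes g :: "'y \<Rightarrow> ('x, 'k::comm_ring_1) mpoly"
  assumes "\<And>y. y \<in> Poly_Mapping.keys \<alpha> \<Longrightarrow> Poly_Mapping.keys (g y) \<subseteq> {\<gamma>. wt v \<gamma> = c y}"
  shows "Poly_Mapping.keys (mon_eval g \<alpha>) \<subseteq> {\<gamma>. wt v \<gamma> = wt c \<alpha>}"
  unfolding mon_eval_def wt_def[of c] by (intro keys_prod_eq keys_power_eq assms)

lemma homogeneous_iff: "homogeneous d f \<longleftrightarrow> Poly_Mapping.keys f \<subseteq> {\<gamma>. wt (\<lambda>_. 1 :: int) \<gamma> = int d}"
proof -
  have "wt (\<lambda>_. 1 :: int) \<gamma> = int (\<Sum>x\<in>Poly_Mapping.keys \<gamma>. Poly_Mapping.lookup \<gamma> x)" for \<gamma> :: "nat \<Rightarrow>\<^sub>0 nat"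
    by (simp add: wt_def)
  then show ?thesis by (simp only: homogeneous_def of_nat_eq_iff) blast
qed

lemma wt_one_eq_zero_iff: "wt (\<lambda>_. 1 :: int) \<alpha> = 0 \<longleftrightarrow> \<alpha> = 0"
proof
  assume "wt (\<lambda>_. 1 :: int) \<alpha> = 0"
  then have "(\<Sum>x\<in>Poly_Mapping.keys \<alpha>. Poly_Mapping.lookup \<alpha> x) = 0"
    by (simp add: wt_def flip: of_nat_sum)
  then have "\<forall>x\<in>Poly_Mapping.keys \<alpha>. Poly_Mapping.lookup \<alpha> x = 0" by simp
  then show "\<alpha> = 0" by (intro poly_mapping_eqI) (auto simp: in_keys_iff)
qed simp

section \<open>The quasivaluations\<close>

lemma wval_ge:
  assumes "p \<in> polys V" "eval_poly const b p = f" "Poly_Mapping.keys p \<subseteq> {\<alpha>. c \<le> wt w \<alpha>}"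
  shows "ereal (of_rat c) \<le> wval V b w f"
proof -
  have "ereal (of_rat c) \<le> (INF \<alpha> \<in> Poly_Mapping.keys p. ereal (of_rat (pairing w \<alpha>)))"
    using assms(3) by (intro INF_greatest) (auto simp: pairing_eq_wt of_rat_less_eq)
  also have "\<dots> \<le> wval V b w f"
    unfolding wval_def using assms(1,2) by (intro SUP_upper) auto
  finally show ?thesis .
qed

lemma wval_gtD:
  assumes "ereal (of_rat c) < wval V b w f"
  obtains p where "p \<in> polys V" "eval_poly const b p = f" "Poly_Mapping.keys p \<subseteq> {\<alpha>. c < wt w \<alpha>}"
proof -
  obtain p where p: "p \<in> polys V" "eval_poly const b p = f"
    "ereal (of_rat c) < (INF \<alpha> \<in> Poly_Mapping.keys p. ereal (of_rat (pairing w \<alpha>)))"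
    using assms unfolding wval_def less_SUP_iff by auto
  have "c < wt w \<alpha>" if "\<alpha> \<in> Poly_Mapping.keys p" for \<alpha>
  proof -
    have "ereal (of_rat c) < ereal (of_rat (pairing w \<alpha>))"
      using less_le_trans[OF p(3) INF_lower[OF that]] .
    then show ?thesis by (simp add: pairing_eq_wt of_rat_less)
  qed
  with p show thesis by (intro that) auto
qed

text \<open>For an integral weight the supremum is attained, since the weights of presentations are
  integers.\<close>

lemma wval_geD_int:
  assumes "ereal (of_int c) \<le> wval V b w f" and w: "\<And>x. x \<in> V \<Longrightarrow> w x = of_int (W x)"
  obtains p where "p \<in> polys V" "eval_poly const b p = f" "Poly_Mapping.keys p \<subseteq> {\<alpha>. c \<le> wt W \<alpha>}"
proof -
  have "ereal (of_rat (of_int (c - 1))) < ereal (of_int c)"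
    by (simp only: of_rat_of_int_eq less_ereal.simps of_int_less_iff)
  also note assms(1)
  finally obtain p where p: "p \<in> polys V" "eval_poly const b p = f"
    "Poly_Mapping.keys p \<subseteq> {\<alpha>. of_int (c - 1) < wt w \<alpha>}"
    by (rule wval_gtD)
  have "c \<le> wt W \<alpha>" if \<alpha>: "\<alpha> \<in> Poly_Mapping.keys p" for \<alpha>
  proof -
    have "wt w \<alpha> = wt (\<lambda>x. of_int (W x)) \<alpha>"
      using p(1) \<alpha> by (intro wt_cong w) (auto simp: polys_def)
    then have "(of_int (c - 1) :: rat) < of_int (wt W \<alpha>)"
      using p(3) \<alpha> by (auto simp: wt_of_int)
    then show ?thesis by (simp only: of_int_less_iff) 
  qed
  with p show thesis by (intro that) auto
qed

lemma weight_gap: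
  fixes w :: "'x \<Rightarrow> rat"
  assumes "finite A" "\<And>\<alpha>. \<alpha> \<in> A \<Longrightarrow> c < wt w \<alpha>"
  shows "\<exists>\<epsilon>>0. \<forall>\<alpha>\<in>A. c < wt w \<alpha> - \<epsilon> * wt (\<lambda>_. 1) \<alpha>"
  using assms
proof (induction A rule: finite_induct)
  case empty
  show ?case by (intro exI[of _ 1]) simp
next
  case (insert \<alpha> A)
  then obtain \<epsilon> where \<epsilon>: "\<epsilon> > 0" "\<forall>\<alpha>\<in>A. c < wt w \<alpha> - \<epsilon> * wt (\<lambda>_. 1) \<alpha>" by auto
  have nonneg: "0 \<le> wt (\<lambda>_. 1 :: rat) \<beta>" for \<beta> :: "'x \<Rightarrow>\<^sub>0 nat" by (simp add: wt_def sum_nonneg)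
  define \<delta> where "\<delta> = (wt w \<alpha> - c) / (wt (\<lambda>_. 1) \<alpha> + 1)"
  have pos: "wt (\<lambda>_. 1 :: rat) \<alpha> + 1 > 0" using nonneg[of \<alpha>] by linarith
  have \<delta>: "\<delta> > 0" using insert.prems[of \<alpha>] pos by (simp add: \<delta>_def)
  have "\<delta> * (wt (\<lambda>_. 1) \<alpha> + 1) = wt w \<alpha> - c" using pos by (simp add: \<delta>_def)
  then have \<delta>': "c < wt w \<alpha> - \<delta> * wt (\<lambda>_. 1) \<alpha>" using \<delta> by (simp add: algebra_simps)
  have mono: "min \<epsilon> \<delta> * wt (\<lambda>_. 1) \<beta> \<le> \<epsilon> * wt (\<lambda>_. 1) \<beta>" "min \<epsilon> \<delta> * wt (\<lambda>_. 1) \<beta> \<le> \<delta> * wt (\<lambda>_. 1) \<beta>"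
    for \<beta> :: "'x \<Rightarrow>\<^sub>0 nat" by (rule mult_right_mono; simp add: nonneg)+
  show ?case
  proof (intro exI[of _ "min \<epsilon> \<delta>"] conjI ballI)
    fix \<beta> assume "\<beta> \<in> insert \<alpha> A"
    then show "c < wt w \<beta> - min \<epsilon> \<delta> * wt (\<lambda>_. 1) \<beta>"
      using mono[of \<beta>] \<delta>' \<epsilon>(2) by fastforce
  qed (use \<epsilon> \<delta> in auto)
qed

text \<open>
  If \<open>u\<^sub>k = \<vv>\<^sub>w(b\<^sub>k)\<close> then \<open>\<vv>\<^sub>u(b\<^sub>j) = u\<^sub>j\<close>. A presentation of \<open>b\<^sub>j\<close> of \<open>u\<close>-weight above \<open>u\<^sub>j\<close> would give,
  after substituting for each \<open>b\<^sub>k\<close> a nearly optimal presentation in the linear part, a presentation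
  of \<open>b\<^sub>j\<close> in the linear part of \<open>w\<close>-weight above \<open>u\<^sub>j\<close>. Only nearly optimal ones are available
  directly, as \<open>\<vv>\<^sub>w\<close> is a supremum; hence the \<open>\<epsilon>\<close>.
\<close>

lemma Trop_star_wval:
  assumes b: "homogeneous_generators m r b" and u: "u \<in> Trop_star r b" and j: "j < r"
  shows "wval {..<r} b u (b j) = ereal (of_rat (u j))"
proof (rule antisym)
  obtain w where w: "\<And>k. k < r \<Longrightarrow> wval (lin_part r b) b w (b k) = ereal (of_rat (u k))"
    using u by (auto simp: Trop_star_def)
  show "ereal (of_rat (u j)) \<le> wval {..<r} b u (b j)"
    using j by (intro wval_ge[of "var j"] polys_var) (auto simp: eval_poly_var[OF ring_map_const], simp add: var_def)
  show "wval {..<r} b u (b j) \<le> ereal (of_rat (u j))"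
  proof (rule ccontr)
    assume "\<not> ?thesis"
    then obtain p where p: "p \<in> polys {..<r}" "eval_poly const b p = b j"
      "Poly_Mapping.keys p \<subseteq> {\<alpha>. u j < wt u \<alpha>}"
      using wval_gtD by (metis not_le)
    have "\<exists>\<epsilon>>0. \<forall>\<alpha>\<in>Poly_Mapping.keys p. u j < wt u \<alpha> - \<epsilon> * wt (\<lambda>_. 1) \<alpha>"
      by (rule weight_gap) (use p(3) in auto)
    then obtain \<epsilon> where \<epsilon>: "\<epsilon> > 0" "\<And>\<alpha>. \<alpha> \<in> Poly_Mapping.keys p \<Longrightarrow> u j < wt u \<alpha> - \<epsilon> * wt (\<lambda>_. 1) \<alpha>"
      by blast
    have "\<exists>q\<in>polys (lin_part r b). eval_poly const b q = b k \<and> Poly_Mapping.keys q \<subseteq> {\<alpha>. u k - \<epsilon> \<le> wt w \<alpha>}"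
      if "k < r" for k
    proof -
      have "ereal (of_rat (u k - \<epsilon>)) < wval (lin_part r b) b w (b k)"
        using \<epsilon>(1) by (simp add: w[OF that] of_rat_less)
      then show ?thesis by (rule wval_gtD) fastforce
    qed
    then obtain q where q: "\<And>k. k < r \<Longrightarrow> q k \<in> polys (lin_part r b)"
      "\<And>k. k < r \<Longrightarrow> eval_poly const b (q k) = b k"
      "\<And>k. k < r \<Longrightarrow> Poly_Mapping.keys (q k) \<subseteq> {\<alpha>. u k - \<epsilon> \<le> wt w \<alpha>}"
      by metis
    let ?P = "eval_poly const q p"
    have in_r: "k < r" if "\<alpha> \<in> Poly_Mapping.keys p" "k \<in> Poly_Mapping.keys \<alpha>" for \<alpha> k
      using that p(1) by (auto simp: polys_def)
    have P: "?P \<in> polys (lin_part r b)"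
      by (rule eval_poly_in_polys[OF p(1)]) (use q(1) in auto)
    have "eval_poly const b ?P = eval_poly const (\<lambda>k. eval_poly const b (q k)) p"
      by (rule poly_subst[OF ring_map_const])
    also have "\<dots> = eval_poly const b p"
      unfolding eval_poly_mon[where p = p] mon_eval_def
      by (intro sum.cong prod.cong refl arg_cong2[where f = "(*)"]) (simp add: q(2) in_r)
    finally have P_eval: "eval_poly const b ?P = b j" using p(2) by simp
    show False
    proof (cases "Poly_Mapping.keys p = {}")
      case True
      then have "b j = 0" using p(2) by (simp add: eval_poly_def)
      then show False using b j by (auto simp: homogeneous_generators_def)
    next
      case False
      define c where "c = Min ((\<lambda>\<alpha>. wt u \<alpha> - \<epsilon> * wt (\<lambda>_. 1) \<alpha>) ` Poly_Mapping.keys p)"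
      have c: "u j < c" unfolding c_def using False \<epsilon>(2) by (subst Min_gr_iff) auto
      have "Poly_Mapping.keys ?P \<subseteq> {\<gamma>. c \<le> wt w \<gamma>}"
        unfolding eval_poly_mon
      proof (intro keys_sum_subset order_trans[OF keys_const_mult])
        fix \<alpha> assume \<alpha>: "\<alpha> \<in> Poly_Mapping.keys p"
        have "c \<le> wt u \<alpha> - \<epsilon> * wt (\<lambda>_. 1) \<alpha>" unfolding c_def using \<alpha> by (intro Min_le) auto
        also have "\<dots> = wt (\<lambda>k. u k - \<epsilon>) \<alpha>"
          by (simp add: wt_def algebra_simps sum_subtractf sum_distrib_left)
        finally have "c \<le> wt (\<lambda>k. u k - \<epsilon>) \<alpha>" .
        moreover have "Poly_Mapping.keys (mon_eval q \<alpha>) \<subseteq> {\<gamma>. wt (\<lambda>k. u k - \<epsilon>) \<alpha> \<le> wt w \<gamma>}"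
          by (rule keys_mon_eval_le) (use q(3) in_r[OF \<alpha>] in blast)
        ultimately show "Poly_Mapping.keys (mon_eval q \<alpha>) \<subseteq> {\<gamma>. c \<le> wt w \<gamma>}" by auto
      qed
      from wval_ge[OF P P_eval this] have "c \<le> u j" by (simp add: w[OF j] of_rat_less_eq)
      then show False using c by simp
    qed
  qed
qed

text \<open>The linear part is homogeneous of degree one, so every presentation of a nonzero constant in
  it has a nonzero constant term, which has weight zero.\<close>

lemma Trop_star_degree_zero:
  assumes b: "homogeneous_generators m r b" and u: "u \<in> Trop_star r b" and j: "j < r"
    and hom: "homogeneous 0 (b j)"
  shows "u j = 0"
proof -
  obtain w where w: "wval (lin_part r b) b w (b j) = ereal (of_rat (u j))"
    using u j by (auto simp: Trop_star_def)
  have bj: "b j = const (Poly_Mapping.lookup (b j) 0)"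
  proof (rule poly_mapping_eqI)
    fix k show "Poly_Mapping.lookup (b j) k = Poly_Mapping.lookup (const (Poly_Mapping.lookup (b j) 0)) k"
      using hom by (cases "k = 0") (auto simp: homogeneous_iff wt_one_eq_zero_iff const_def lookup_single in_keys_iff subset_iff)
  qed
  have ne: "Poly_Mapping.lookup (b j) 0 \<noteq> 0"
    using bj b j by (auto simp: homogeneous_generators_def const_zero)
  have "0 \<le> u j"
  proof -
    have "eval_poly const b (b j) = b j"
      by (subst (1 2) bj) (rule eval_poly_const[OF ring_map_const])
    moreover have "b j \<in> polys (lin_part r b)" by (subst bj) simp
    moreover have "Poly_Mapping.keys (b j) \<subseteq> {\<alpha>. 0 \<le> wt w \<alpha>}"
      by (subst bj) (simp add: const_def)
    ultimately show ?thesis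
      using wval_ge[of "b j" "lin_part r b" b "b j" 0 w] by (simp add: w)
  qed
  moreover have "u j \<le> 0"
  proof (rule ccontr)
    assume "\<not> u j \<le> 0"
    then have "ereal (of_rat 0) < wval (lin_part r b) b w (b j)" by (simp add: w)
    then obtain p where p: "p \<in> polys (lin_part r b)" "eval_poly const b p = b j"
      "Poly_Mapping.keys p \<subseteq> {\<alpha>. 0 < wt w \<alpha>}" by (rule wval_gtD)
    have "Poly_Mapping.lookup (const (Poly_Mapping.lookup p \<alpha>) * mon_eval b \<alpha>) 0 = 0"
      if \<alpha>: "\<alpha> \<in> Poly_Mapping.keys p" for \<alpha>
    proof -
      have "Poly_Mapping.keys (mon_eval b \<alpha>) \<subseteq> {\<gamma>. wt (\<lambda>_. 1 :: int) \<gamma> = wt (\<lambda>_. 1) \<alpha>}"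
        by (rule keys_mon_eval_eq) (use p(1) \<alpha> in \<open>auto simp: polys_def lin_part_def homogeneous_iff\<close>)
      moreover have "\<alpha> \<noteq> 0" using p(3) \<alpha> by auto
      then have "wt (\<lambda>_. 1 :: int) \<alpha> \<noteq> 0" by (simp add: wt_one_eq_zero_iff)
      ultimately have "0 \<notin> Poly_Mapping.keys (mon_eval b \<alpha>)" by auto
      then show ?thesis by (simp add: in_keys_iff)
    qed
    then have "Poly_Mapping.lookup (eval_poly const b p) 0 = 0"
      by (simp add: eval_poly_mon lookup_sum)
    then show False using p(2) ne by simp
  qed
  ultimately show ?thesis by simp
qed

section \<open>The algebra generated by the lifts\<close>

lift_definition Xpart :: "(('a + 'b) \<Rightarrow>\<^sub>0 nat) \<Rightarrow> ('a \<Rightarrow>\<^sub>0 nat)" is "\<lambda>f i. f (Inl i)"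
proof -
  fix f :: "'a + 'b \<Rightarrow> nat" assume "finite {x. f x \<noteq> 0}"
  from finite_vimageI[OF this inj_Inl] show "finite {i. f (Inl i) \<noteq> 0}" by (simp add: vimage_def)
qed

lift_definition Ypart :: "(('a + 'b) \<Rightarrow>\<^sub>0 nat) \<Rightarrow> ('b \<Rightarrow>\<^sub>0 nat)" is "\<lambda>f j. f (Inr j)"
proof -
  fix f :: "'a + 'b \<Rightarrow> nat" assume "finite {x. f x \<noteq> 0}"
  from finite_vimageI[OF this inj_Inr] show "finite {j. f (Inr j) \<noteq> 0}" by (simp add: vimage_def)
qed

lemma lookup_Xpart [simp]: "Poly_Mapping.lookup (Xpart \<alpha>) i = Poly_Mapping.lookup \<alpha> (Inl i)"
  by transfer simp

lemma lookup_Ypart [simp]: "Poly_Mapping.lookup (Ypart \<alpha>) j = Poly_Mapping.lookup \<alpha> (Inr j)"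
  by transfer simp

lemma Ypart_add: "Ypart (\<alpha> + \<beta>) = Ypart \<alpha> + Ypart \<beta>"
  by (rule poly_mapping_eqI) (simp add: lookup_add)

lemma keys_parts:
  "Poly_Mapping.keys \<alpha> = Inl ` Poly_Mapping.keys (Xpart \<alpha>) \<union> Inr ` Poly_Mapping.keys (Ypart \<alpha>)"
proof (intro equalityI subsetI)
  fix x assume "x \<in> Poly_Mapping.keys \<alpha>"
  then show "x \<in> Inl ` Poly_Mapping.keys (Xpart \<alpha>) \<union> Inr ` Poly_Mapping.keys (Ypart \<alpha>)"
    by (cases x) (auto simp: in_keys_iff image_iff)
qed (auto simp: in_keys_iff)

lemma keys_parts_XY:
  "Poly_Mapping.keys \<alpha> \<subseteq> XY_vars n r \<longleftrightarrow>
    Poly_Mapping.keys (Xpart \<alpha>) \<subseteq> {..<n} \<and> Poly_Mapping.keys (Ypart \<alpha>) \<subseteq> {..<r}"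
  unfolding keys_parts XY_vars_def by (auto simp: subset_iff)

lemma wt_case_sum: "wt (case_sum u v) \<alpha> = wt u (Xpart \<alpha>) + wt v (Ypart \<alpha>)"
  unfolding wt_def keys_parts[of \<alpha>]
  by (subst sum.union_disjoint) (auto simp: sum.reindex)

lemma mon_eval_case_sum: "mon_eval (case_sum g h) \<alpha> = mon_eval g (Xpart \<alpha>) * mon_eval h (Ypart \<alpha>)"
  unfolding mon_eval_def keys_parts[of \<alpha>]
  by (subst prod.union_disjoint) (auto simp: prod.reindex)

lemma wt_delta: "wt (\<lambda>i'. if i' = i then c else 0) \<gamma> = c * of_nat (Poly_Mapping.lookup \<gamma> i)"
  by (subst wt_superset[of "insert i (Poly_Mapping.keys \<gamma>)"]) (auto simp: if_distrib if_distribR sum.delta cong: if_cong)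

text \<open>The exponents of \<open>t\<^sub>i\<close> in the images of the variables; \<open>\<I>\<^sub>\<B>\<close> is homogeneous for each of these
  weights.\<close>

definition t_weight :: "(nat \<Rightarrow> nat \<Rightarrow> int) \<Rightarrow> nat \<Rightarrow> nat + nat \<Rightarrow> int" where
  "t_weight W i = case_sum (\<lambda>i'. if i' = i then - 1 else 0) (W i)"

lemma wt_t_weight:
  "wt (t_weight W i) \<alpha> = wt (W i) (Ypart \<alpha>) - int (Poly_Mapping.lookup \<alpha> (Inl i))"
  by (simp add: t_weight_def wt_case_sum wt_delta)

lift_definition XY_mon :: "nat \<Rightarrow> (nat \<Rightarrow> nat) \<Rightarrow> (nat \<Rightarrow>\<^sub>0 nat) \<Rightarrow> (nat + nat \<Rightarrow>\<^sub>0 nat)"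
  is "\<lambda>n \<gamma> \<beta>. case_sum (\<lambda>i. if i < n then \<gamma> i else 0) \<beta>"
proof -
  fix n and \<gamma> \<beta> :: "nat \<Rightarrow> nat" assume fin: "finite {j. \<beta> j \<noteq> 0}"
  have "{x. case_sum (\<lambda>i. if i < n then \<gamma> i else 0) \<beta> x \<noteq> 0} \<subseteq> Inl ` {..<n} \<union> Inr ` {j. \<beta> j \<noteq> 0}"
  proof
    fix x assume "x \<in> {x. case_sum (\<lambda>i. if i < n then \<gamma> i else 0) \<beta> x \<noteq> 0}"
    then show "x \<in> Inl ` {..<n} \<union> Inr ` {j. \<beta> j \<noteq> 0}" by (cases x) (auto split: if_splits)
  qed
  then show "finite {x. case_sum (\<lambda>i. if i < n then \<gamma> i else 0) \<beta> x \<noteq> 0}"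
    by (rule finite_subset) (use fin in auto)
qed

lemma lookup_XY_mon [simp]:
  "Poly_Mapping.lookup (XY_mon n \<gamma> \<beta>) (Inl i) = (if i < n then \<gamma> i else 0)"
  "Poly_Mapping.lookup (XY_mon n \<gamma> \<beta>) (Inr j) = Poly_Mapping.lookup \<beta> j"
  by (transfer; simp)+

lemma Ypart_XY_mon [simp]: "Ypart (XY_mon n \<gamma> \<beta>) = \<beta>"
  by (rule poly_mapping_eqI) simp

lemma keys_XY_mon: "Poly_Mapping.keys \<beta> \<subseteq> {..<r} \<Longrightarrow> Poly_Mapping.keys (XY_mon n \<gamma> \<beta>) \<subseteq> XY_vars n r"
  unfolding keys_parts_XY by (auto simp: in_keys_iff split: if_splits)

subsection \<open>Exponents of \<open>t\<close>\<close>

definition t_exp :: "nat \<Rightarrow> (nat \<Rightarrow> int) \<Rightarrow> (nat \<Rightarrow>\<^sub>0 int)" where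
  "t_exp n f = (\<Sum>i<n. Poly_Mapping.single i (f i))"

lemma lookup_t_exp [simp]: "Poly_Mapping.lookup (t_exp n f) i = (if i < n then f i else 0)"
  by (simp add: t_exp_def lookup_sum lookup_single when_def)

lemma keys_t_exp: "Poly_Mapping.keys (t_exp n f) \<subseteq> {..<n}"
  by (auto simp: in_keys_iff split: if_splits)

lemma t_exp_eq_iff: "t_exp n f = t_exp n g \<longleftrightarrow> (\<forall>i<n. f i = g i)"
  by (metis lookup_t_exp poly_mapping_eqI)

lemma t_exp_lookup: "Poly_Mapping.keys a \<subseteq> {..<n} \<Longrightarrow> t_exp n (Poly_Mapping.lookup a) = a"
  by (rule poly_mapping_eqI) (auto simp: in_keys_iff)

lemma single_power:
  fixes f :: "'a::comm_semiring_1" and e :: "'e::comm_monoid_add"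
  shows "Poly_Mapping.single e f ^ k = Poly_Mapping.single (\<Sum>_<k. e) (f ^ k)"
proof (induction k)
  case (Suc k)
  then show ?case by (simp add: mult_single add.commute del: sum_constant)
qed simp

lemma single_prod:
  fixes f :: "'i \<Rightarrow> 'a::comm_semiring_1" and e :: "'i \<Rightarrow> 'e::comm_monoid_add"
  shows "(\<Prod>x\<in>A. Poly_Mapping.single (e x) (f x)) = Poly_Mapping.single (\<Sum>x\<in>A. e x) (\<Prod>x\<in>A. f x)"
  by (induction A rule: infinite_finite_induct) (simp_all add: mult_single)

lemma mon_eval_single_t_exp:
  assumes "\<And>x. x \<in> Poly_Mapping.keys \<alpha> \<Longrightarrow> g x = Poly_Mapping.single (t_exp n (\<lambda>i. v i x)) (f x)"
  shows "mon_eval g \<alpha> = Poly_Mapping.single (t_exp n (\<lambda>i. wt (v i) \<alpha>)) (mon_eval f \<alpha>)"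
proof -
  have "mon_eval g \<alpha> = (\<Prod>x\<in>Poly_Mapping.keys \<alpha>. Poly_Mapping.single
      (\<Sum>_<Poly_Mapping.lookup \<alpha> x. t_exp n (\<lambda>i. v i x)) (f x ^ Poly_Mapping.lookup \<alpha> x))"
    unfolding mon_eval_def by (intro prod.cong refl) (simp only: assms single_power)
  also have "\<dots> = Poly_Mapping.single
      (\<Sum>x\<in>Poly_Mapping.keys \<alpha>. \<Sum>_<Poly_Mapping.lookup \<alpha> x. t_exp n (\<lambda>i. v i x)) (mon_eval f \<alpha>)"
    by (simp only: single_prod mon_eval_def)
  also have "(\<Sum>x\<in>Poly_Mapping.keys \<alpha>. \<Sum>_<Poly_Mapping.lookup \<alpha> x. t_exp n (\<lambda>i. v i x)) = t_exp n (\<lambda>i. wt (v i) \<alpha>)"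
  proof (rule poly_mapping_eqI)
    fix i
    have "Poly_Mapping.lookup (\<Sum>x\<in>Poly_Mapping.keys \<alpha>. \<Sum>_<Poly_Mapping.lookup \<alpha> x. t_exp n (\<lambda>i. v i x)) i
      = (\<Sum>x\<in>Poly_Mapping.keys \<alpha>. \<Sum>_<Poly_Mapping.lookup \<alpha> x. if i < n then v i x else 0)"
      by (simp only: lookup_sum lookup_t_exp)
    also have "\<dots> = (if i < n then wt (v i) \<alpha> else 0)"
      by (simp add: wt_def mult.commute)
    finally show "Poly_Mapping.lookup (\<Sum>x\<in>Poly_Mapping.keys \<alpha>. \<Sum>_<Poly_Mapping.lookup \<alpha> x. t_exp n (\<lambda>i. v i x)) i
      = Poly_Mapping.lookup (t_exp n (\<lambda>i. wt (v i) \<alpha>)) i" by simp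
  qed
  finally show ?thesis .
qed

lemma t_inv_t_exp: "i < n \<Longrightarrow> t_inv i = Poly_Mapping.single (t_exp n (\<lambda>i'. if i = i' then - 1 else 0)) 1"
  unfolding t_inv_def
  by (rule arg_cong[where f = "\<lambda>a. Poly_Mapping.single a 1"], rule poly_mapping_eqI)
    (auto simp: lookup_single when_def)

lemma mon_eval_lifts:
  assumes lift: "\<And>j. j < r \<Longrightarrow> b_lift n r b D j = Poly_Mapping.single (t_exp n (\<lambda>i. W i j)) (b j)"
    and \<alpha>: "Poly_Mapping.keys \<alpha> \<subseteq> XY_vars n r"
  shows "mon_eval (case_sum t_inv (b_lift n r b D)) \<alpha> =
    Poly_Mapping.single (t_exp n (\<lambda>i. wt (t_weight W i) \<alpha>)) (mon_eval b (Ypart \<alpha>))"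
proof -
  have "mon_eval (case_sum t_inv (b_lift n r b D)) \<alpha> =
      Poly_Mapping.single (t_exp n (\<lambda>i. wt (t_weight W i) \<alpha>)) (mon_eval (case_sum (\<lambda>_. 1) b) \<alpha>)"
  proof (rule mon_eval_single_t_exp)
    fix x assume "x \<in> Poly_Mapping.keys \<alpha>"
    then have "x \<in> XY_vars n r" using \<alpha> by auto
    then show "case_sum t_inv (b_lift n r b D) x =
        Poly_Mapping.single (t_exp n (\<lambda>i. t_weight W i x)) (case_sum (\<lambda>_. 1) b x)"
      using lift by (auto simp: XY_vars_def t_weight_def t_inv_t_exp)
  qed
  also have "mon_eval (case_sum (\<lambda>_. 1) b) \<alpha> = mon_eval b (Ypart \<alpha>)"
    by (simp add: mon_eval_case_sum) (simp add: mon_eval_def)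
  finally show ?thesis .
qed

text \<open>An explicit description of the algebra generated by the \<open>t\<^sub>i\<inverse>\<close> and the lifts of the \<open>b\<^sub>j\<close>.
  It differs from the section ring in the order of quantifiers: the presentation \<open>p\<close> does not depend
  on the row.\<close>

definition monomial_sections ::
  "nat \<Rightarrow> nat \<Rightarrow> (nat \<Rightarrow> 'k::comm_ring_1 sym) \<Rightarrow> (nat \<Rightarrow> nat \<Rightarrow> int) \<Rightarrow> 'k laurent set" where
  "monomial_sections n r b W = {F. \<forall>a\<in>Poly_Mapping.keys F. Poly_Mapping.keys a \<subseteq> {..<n} \<and>
     (\<exists>p\<in>polys {..<r}. eval_poly const b p = Poly_Mapping.lookup F a \<and>
        Poly_Mapping.keys p \<subseteq> {\<beta>. \<forall>i<n. Poly_Mapping.lookup a i \<le> wt (W i) \<beta>})}"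

lemma single_in_monomial_sections:
  assumes "Poly_Mapping.keys a \<subseteq> {..<n}" "p \<in> polys {..<r}"
    "Poly_Mapping.keys p \<subseteq> {\<beta>. \<forall>i<n. Poly_Mapping.lookup a i \<le> wt (W i) \<beta>}"
  shows "Poly_Mapping.single a (eval_poly const b p) \<in> monomial_sections n r b W"
  using assms by (fastforce simp: monomial_sections_def)

lemma monomial_sections_add:
  assumes F: "F \<in> monomial_sections n r b W" and G: "G \<in> monomial_sections n r b W"
  shows "F + G \<in> monomial_sections n r b W"
proof -
  have coeff: "\<exists>p\<in>polys {..<r}. eval_poly const b p = Poly_Mapping.lookup H a \<and>
        Poly_Mapping.keys p \<subseteq> {\<beta>. \<forall>i<n. Poly_Mapping.lookup a i \<le> wt (W i) \<beta>}"
    if H: "H \<in> monomial_sections n r b W" for H a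
  proof (cases "a \<in> Poly_Mapping.keys H")
    case True
    then show ?thesis using H by (auto simp: monomial_sections_def)
  next
    case False
    then show ?thesis
      by (intro bexI[of _ 0]) (simp_all add: in_keys_iff eval_poly_zero[OF ring_map_const])
  qed
  show ?thesis
    unfolding monomial_sections_def
  proof (intro CollectI ballI conjI)
    fix a assume a: "a \<in> Poly_Mapping.keys (F + G)"
    have "a \<in> Poly_Mapping.keys F \<or> a \<in> Poly_Mapping.keys G" using keys_add[of F G] a by blast
    then show "Poly_Mapping.keys a \<subseteq> {..<n}" using F G by (auto simp: monomial_sections_def)
    obtain p q where "p \<in> polys {..<r}" "q \<in> polys {..<r}" "eval_poly const b p = Poly_Mapping.lookup F a"
      "eval_poly const b q = Poly_Mapping.lookup G a"
      "Poly_Mapping.keys p \<subseteq> {\<beta>. \<forall>i<n. Poly_Mapping.lookup a i \<le> wt (W i) \<beta>}"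
      "Poly_Mapping.keys q \<subseteq> {\<beta>. \<forall>i<n. Poly_Mapping.lookup a i \<le> wt (W i) \<beta>}"
      using coeff[OF F, of a] coeff[OF G, of a] by blast
    then show "\<exists>p\<in>polys {..<r}. eval_poly const b p = Poly_Mapping.lookup (F + G) a \<and>
        Poly_Mapping.keys p \<subseteq> {\<beta>. \<forall>i<n. Poly_Mapping.lookup a i \<le> wt (W i) \<beta>}"
      by (intro bexI[of _ "p + q"] conjI keys_add_subset polys_add)
        (simp_all add: eval_poly_add[OF ring_map_const] lookup_add)
  qed
qed

lemma monomial_sections_sum:
  "(\<And>x. x \<in> A \<Longrightarrow> F x \<in> monomial_sections n r b W) \<Longrightarrow> (\<Sum>x\<in>A. F x) \<in> monomial_sections n r b W"
proof (induction A rule: infinite_finite_induct)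
  case (insert x A)
  then show ?case by (simp add: monomial_sections_add)
qed (simp_all add: monomial_sections_def)

lemma monomial_sections_mult:
  assumes F: "F \<in> monomial_sections n r b W" and G: "G \<in> monomial_sections n r b W"
  shows "F * G \<in> monomial_sections n r b W"
proof -
  have "F * G = (\<Sum>a\<in>Poly_Mapping.keys F. Poly_Mapping.single a (Poly_Mapping.lookup F a)) *
      (\<Sum>c\<in>Poly_Mapping.keys G. Poly_Mapping.single c (Poly_Mapping.lookup G c))"
    by (simp only: poly_mapping_sum_singles)
  also have "\<dots> = (\<Sum>a\<in>Poly_Mapping.keys F. \<Sum>c\<in>Poly_Mapping.keys G.
      Poly_Mapping.single (a + c) (Poly_Mapping.lookup F a * Poly_Mapping.lookup G c))"
    by (simp only: sum_product mult_single)
  also have "\<dots> \<in> monomial_sections n r b W"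
  proof (intro monomial_sections_sum)
    fix a c assume a: "a \<in> Poly_Mapping.keys F" and c: "c \<in> Poly_Mapping.keys G"
    obtain p where p: "Poly_Mapping.keys a \<subseteq> {..<n}" "p \<in> polys {..<r}" "eval_poly const b p = Poly_Mapping.lookup F a"
      "Poly_Mapping.keys p \<subseteq> {\<beta>. \<forall>i<n. Poly_Mapping.lookup a i \<le> wt (W i) \<beta>}"
      using F a by (auto simp: monomial_sections_def)
    obtain q where q: "Poly_Mapping.keys c \<subseteq> {..<n}" "q \<in> polys {..<r}" "eval_poly const b q = Poly_Mapping.lookup G c"
      "Poly_Mapping.keys q \<subseteq> {\<beta>. \<forall>i<n. Poly_Mapping.lookup c i \<le> wt (W i) \<beta>}"
      using G c by (auto simp: monomial_sections_def)
    have "Poly_Mapping.keys (p * q) \<subseteq> {\<beta>. \<forall>i<n. Poly_Mapping.lookup (a + c) i \<le> wt (W i) \<beta>}"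
    proof
      fix \<beta> assume "\<beta> \<in> Poly_Mapping.keys (p * q)"
      then obtain \<beta>1 \<beta>2 where "\<beta> = \<beta>1 + \<beta>2" "\<beta>1 \<in> Poly_Mapping.keys p" "\<beta>2 \<in> Poly_Mapping.keys q"
        using keys_mult[of p q] by blast
      then show "\<beta> \<in> {\<beta>. \<forall>i<n. Poly_Mapping.lookup (a + c) i \<le> wt (W i) \<beta>}"
        using p(4) q(4) by (auto simp: subset_iff lookup_add wt_add intro!: add_mono)
    qed
    moreover have "Poly_Mapping.keys (a + c) \<subseteq> {..<n}" using p(1) q(1) by (rule keys_add_subset)
    moreover have "p * q \<in> polys {..<r}" using p(2) q(2) by (rule polys_mult)
    ultimately have "Poly_Mapping.single (a + c) (eval_poly const b (p * q)) \<in> monomial_sections n r b W"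
      by (intro single_in_monomial_sections)
    then show "Poly_Mapping.single (a + c) (Poly_Mapping.lookup F a * Poly_Mapping.lookup G c)
        \<in> monomial_sections n r b W"
      by (simp add: eval_poly_mult[OF ring_map_const] p(3) q(3))
  qed
  finally show ?thesis .
qed

lemma subalgebra_sum:
  assumes "is_subalgebra c A" "ring_map c" "\<And>x. x \<in> I \<Longrightarrow> f x \<in> A"
  shows "(\<Sum>x\<in>I. f x) \<in> A"
proof -
  have "0 \<in> A" using assms(1,2) unfolding is_subalgebra_def ring_map_def by (metis rangeI subsetD)
  then show ?thesis using assms(1,3)
    by (induction I rule: infinite_finite_induct) (auto simp: is_subalgebra_def)
qed

lemma subalgebra_mon_eval:
  fixes c :: "'k::comm_ring_1 \<Rightarrow> 'a::comm_ring_1" and g :: "'x \<Rightarrow> 'a"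
  assumes "is_subalgebra c A" "ring_map c" "\<And>x. x \<in> Poly_Mapping.keys \<alpha> \<Longrightarrow> g x \<in> A"
  shows "mon_eval g \<alpha> \<in> A"
proof -
  have one: "1 \<in> A" using assms(1,2) unfolding is_subalgebra_def ring_map_def by (metis rangeI subsetD)
  have mult: "x * y \<in> A" if "x \<in> A" "y \<in> A" for x y
    using assms(1) that by (simp add: is_subalgebra_def)
  have pow: "x ^ k \<in> A" if "x \<in> A" for x k
    using that by (induction k) (simp_all add: one mult)
  have "(\<Prod>x\<in>I. f x) \<in> A" if "\<And>x. x \<in> I \<Longrightarrow> f x \<in> A" for f :: "'x \<Rightarrow> 'a" and I
    using that by (induction I rule: infinite_finite_induct) (simp_all add: one mult)
  then show ?thesis unfolding mon_eval_def using assms(3) pow by simp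
qed

text \<open>A monomial \<open>b\<^sup>\<beta>\<close> occurs in the generated algebra with the exponent of \<open>t\<close> given by its weights, and
  multiplication by the \<open>t\<^sub>i\<inverse>\<close> gives all smaller exponents and no others.\<close>

theorem alg_gen_lifts:
  assumes lift: "\<And>j. j < r \<Longrightarrow> b_lift n r b D j = Poly_Mapping.single (t_exp n (\<lambda>i. W i j)) (b j)"
  shows "alg_gen lconst (t_inv ` {..<n} \<union> b_lift n r b D ` {..<r}) = monomial_sections n r b W"
proof (rule antisym)
  have "Poly_Mapping.single 0 (eval_poly const b (const c)) \<in> monomial_sections n r b W" for c
    by (rule single_in_monomial_sections) (simp_all add: const_def polys_def)
  then have "range lconst \<subseteq> monomial_sections n r b W"
    by (auto simp: lconst_def eval_poly_const[OF ring_map_const])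
  then have "is_subalgebra lconst (monomial_sections n r b W)"
    by (auto simp: is_subalgebra_def monomial_sections_add monomial_sections_mult)
  moreover have "t_inv i \<in> monomial_sections n r b W" if "i < n" for i
  proof -
    have "Poly_Mapping.single (Poly_Mapping.single i (- 1)) (eval_poly const b (const 1)) \<in> monomial_sections n r b W"
      by (rule single_in_monomial_sections) (use that in \<open>auto simp: const_def polys_def lookup_single when_def\<close>)
    then show ?thesis unfolding eval_poly_const[OF ring_map_const] by (simp add: t_inv_def const_one)
  qed
  moreover have "b_lift n r b D j \<in> monomial_sections n r b W" if "j < r" for j
  proof -
    have "Poly_Mapping.single (t_exp n (\<lambda>i. W i j)) (eval_poly const b (var j)) \<in> monomial_sections n r b W"
      by (rule single_in_monomial_sections[OF keys_t_exp polys_var]) (use that in \<open>auto simp: var_def\<close>)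
    then show ?thesis by (simp add: lift[OF that] eval_poly_var[OF ring_map_const])
  qed
  ultimately show "alg_gen lconst (t_inv ` {..<n} \<union> b_lift n r b D ` {..<r}) \<subseteq> monomial_sections n r b W"
    unfolding alg_gen_def by (intro hull_minimal) auto
next
  have "F \<in> A" if F: "F \<in> monomial_sections n r b W" and A: "is_subalgebra lconst A"
    and gens: "t_inv ` {..<n} \<union> b_lift n r b D ` {..<r} \<subseteq> A" for F A
  proof -
    have "Poly_Mapping.single a (Poly_Mapping.lookup F a) \<in> A" if a: "a \<in> Poly_Mapping.keys F" for a
    proof -
      obtain p where p: "Poly_Mapping.keys a \<subseteq> {..<n}" "p \<in> polys {..<r}" "eval_poly const b p = Poly_Mapping.lookup F a"
        "Poly_Mapping.keys p \<subseteq> {\<beta>. \<forall>i<n. Poly_Mapping.lookup a i \<le> wt (W i) \<beta>}"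
        using F a by (auto simp: monomial_sections_def)
      have "Poly_Mapping.single a (const (Poly_Mapping.lookup p \<beta>) * mon_eval b \<beta>) \<in> A"
        if \<beta>: "\<beta> \<in> Poly_Mapping.keys p" for \<beta>
      proof -
        \<comment> \<open>The powers of \<open>t\<^sub>i\<inverse>\<close> lower the exponent of the lift of \<open>b\<^sup>\<beta>\<close> to \<open>a\<close>.\<close>
        define \<alpha> where "\<alpha> = XY_mon n (\<lambda>i. nat (wt (W i) \<beta> - Poly_Mapping.lookup a i)) \<beta>"
        have \<alpha>: "Poly_Mapping.keys \<alpha> \<subseteq> XY_vars n r"
          unfolding \<alpha>_def using p(2) \<beta> by (intro keys_XY_mon) (auto simp: polys_def)
        have "wt (t_weight W i) \<alpha> = Poly_Mapping.lookup a i" if "i < n" for i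
          using p(4) \<beta> that by (auto simp: wt_t_weight \<alpha>_def)
        then have "t_exp n (\<lambda>i. wt (t_weight W i) \<alpha>) = a"
          using p(1) by (metis (no_types, lifting) t_exp_eq_iff t_exp_lookup)
        then have "mon_eval (case_sum t_inv (b_lift n r b D)) \<alpha> = Poly_Mapping.single a (mon_eval b \<beta>)"
          by (subst mon_eval_lifts[OF lift \<alpha>]) (simp_all add: \<alpha>_def)
        moreover have "mon_eval (case_sum t_inv (b_lift n r b D)) \<alpha> \<in> A"
          by (rule subalgebra_mon_eval[OF A ring_map_lconst])
            (use \<alpha> gens in \<open>auto simp: XY_vars_def subset_iff\<close>)
        moreover have "lconst (Poly_Mapping.lookup p \<beta>) \<in> A" using A by (auto simp: is_subalgebra_def)
        ultimately have "lconst (Poly_Mapping.lookup p \<beta>) * Poly_Mapping.single a (mon_eval b \<beta>) \<in> A"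
          using A by (auto simp: is_subalgebra_def)
        then show ?thesis by (simp add: lconst_def mult_single)
      qed
      then have "(\<Sum>\<beta>\<in>Poly_Mapping.keys p. Poly_Mapping.single a (const (Poly_Mapping.lookup p \<beta>) * mon_eval b \<beta>)) \<in> A"
        by (rule subalgebra_sum[OF A ring_map_lconst])
      also have "(\<Sum>\<beta>\<in>Poly_Mapping.keys p. Poly_Mapping.single a (const (Poly_Mapping.lookup p \<beta>) * mon_eval b \<beta>))
          = Poly_Mapping.single a (eval_poly const b p)"
        unfolding eval_poly_mon
        by (rule poly_mapping_eqI) (simp add: lookup_sum lookup_single when_def)
      finally show ?thesis by (simp add: p(3))
    qed
    then have "(\<Sum>a\<in>Poly_Mapping.keys F. Poly_Mapping.single a (Poly_Mapping.lookup F a)) \<in> A"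
      by (rule subalgebra_sum[OF A ring_map_lconst])
    then show ?thesis by (simp only: poly_mapping_sum_singles)
  qed
  then show "monomial_sections n r b W \<subseteq> alg_gen lconst (t_inv ` {..<n} \<union> b_lift n r b D ` {..<r})"
    by (auto simp: alg_gen_def hull_def)
qed

section \<open>Relations by degree\<close>

lemma mon_eval_var: "mon_eval var \<beta> = Poly_Mapping.single \<beta> (1 :: 'k::comm_ring_1)"
proof (induction \<beta> rule: poly_mapping_induct)
  case (single x)
  have "var x ^ k = Poly_Mapping.single (Poly_Mapping.single x k) (1 :: 'k)" for k
    by (induction k) (simp_all add: var_def mult_single flip: single_add)
  then show ?case by (simp add: mon_eval_single)
qed (simp_all add: mon_eval_add mult_single)

definition dehom :: "(nat + nat, 'k::comm_ring_1) mpoly \<Rightarrow> (nat, 'k) mpoly" where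
  "dehom = eval_poly const (case_sum (\<lambda>_. 1) var)"

lemma dehom_add: "dehom (p + q) = dehom p + dehom q"
  and dehom_zero [simp]: "dehom 0 = 0"
  by (simp_all add: dehom_def eval_poly_add[OF ring_map_const] eval_poly_zero[OF ring_map_const])

lemma dehom_single: "dehom (Poly_Mapping.single \<alpha> c) = Poly_Mapping.single (Ypart \<alpha>) c"
proof -
  have "mon_eval (\<lambda>_::nat. 1 :: (nat, 'a) mpoly) \<gamma> = 1" for \<gamma> by (simp add: mon_eval_def)
  then show ?thesis
    by (simp add: dehom_def eval_poly_single[OF ring_map_const] mon_eval_case_sum mon_eval_var const_mult_single)
qed

lemma dehom_expand:
  "dehom p = (\<Sum>\<alpha>\<in>Poly_Mapping.keys p. Poly_Mapping.single (Ypart \<alpha>) (Poly_Mapping.lookup p \<alpha>))"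
proof -
  have "dehom p = dehom (\<Sum>\<alpha>\<in>Poly_Mapping.keys p. Poly_Mapping.single \<alpha> (Poly_Mapping.lookup p \<alpha>))"
    by (simp only: poly_mapping_sum_singles)
  also have "\<dots> = (\<Sum>\<alpha>\<in>Poly_Mapping.keys p. dehom (Poly_Mapping.single \<alpha> (Poly_Mapping.lookup p \<alpha>)))"
    by (simp only: dehom_def eval_poly_sum[OF ring_map_const])
  finally show ?thesis by (simp only: dehom_single)
qed

lemma keys_dehom: "Poly_Mapping.keys (dehom p) \<subseteq> Ypart ` Poly_Mapping.keys p"
  unfolding dehom_expand by (rule keys_sum_subset) auto

text \<open>
  Relations are treated degree by degree, because the iterations above need weights that are
  bounded on the monomials in question. The degree of \<open>Y\<^sub>j\<close> is that of \<open>b\<^sub>j\<close>.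
\<close>

locale graded_presentation =
  fixes m r :: nat and b :: "nat \<Rightarrow> 'k::field sym"
  assumes gens: "homogeneous_generators m r b"
begin

definition dg :: "nat \<Rightarrow> int" where
  "dg j = int (SOME d. homogeneous d (b j))"

lemma keys_b:
  assumes "j < r"
  shows "Poly_Mapping.keys (b j) \<subseteq> {\<gamma>. wt (\<lambda>_. 1 :: int) \<gamma> = dg j}"
proof -
  have "\<exists>d. homogeneous d (b j)" using gens assms unfolding homogeneous_generators_def by blast
  from someI_ex[OF this] show ?thesis unfolding dg_def homogeneous_iff .
qed

lemma dg_nonneg: "0 \<le> dg j" by (simp add: dg_def)

definition monomials :: "int \<Rightarrow> (nat \<Rightarrow>\<^sub>0 nat) set" where
  "monomials d = {\<beta>. Poly_Mapping.keys \<beta> \<subseteq> {..<r} \<and> wt dg \<beta> = d}"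

definition relations :: "int \<Rightarrow> (nat, 'k) mpoly set" where
  "relations d = {p. Poly_Mapping.keys p \<subseteq> monomials d \<and> eval_poly const b p = 0}"

lemma monomials_polys: "Poly_Mapping.keys p \<subseteq> monomials d \<Longrightarrow> p \<in> polys {..<r}"
  by (auto simp: monomials_def polys_def)

lemma relations_subspace: "mp.subspace (relations d)"
  unfolding mp.subspace_def
proof (intro conjI ballI allI)
  fix p q c assume p: "p \<in> relations d" and q: "q \<in> relations d"
  then show "p + q \<in> relations d"
    by (simp add: relations_def keys_add_subset eval_poly_add[OF ring_map_const])
  show "const c * p \<in> relations d"
    using p keys_const_mult[of c p] by (auto simp: relations_def eval_poly_mult[OF ring_map_const])
qed (simp add: relations_def eval_poly_zero[OF ring_map_const])

lemma eval_degree_part: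
  assumes "p \<in> polys {..<r}"
  shows "eval_poly const b (restr {\<beta>. wt dg \<beta> = d} p) = restr {\<gamma>. wt (\<lambda>_. 1) \<gamma> = d} (eval_poly const b p)"
proof (induction p rule: poly_mapping_induct)
  case (single \<alpha>)
  have "Poly_Mapping.keys (mon_eval b \<alpha>) \<subseteq> {\<gamma>. wt (\<lambda>_. 1) \<gamma> = wt dg \<alpha>}"
    by (rule keys_mon_eval_eq, rule keys_b) (use assms single in \<open>auto simp: polys_def\<close>)
  then have "restr {\<gamma>. wt (\<lambda>_. 1) \<gamma> = d} (mon_eval b \<alpha>) = (if wt dg \<alpha> = d then mon_eval b \<alpha> else 0)"
    by (force intro: restr_eq_self restr_eq_zero)
  then show ?case
    by (auto simp: restr_single eval_poly_single[OF ring_map_const] eval_poly_zero[OF ring_map_const] restr_const_mult)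
qed (simp_all add: eval_poly_zero[OF ring_map_const] eval_poly_add[OF ring_map_const] restr_add)

lemma degree_part_diff_in_relations:
  assumes "p \<in> polys {..<r}" "q \<in> polys {..<r}" "eval_poly const b p = eval_poly const b q"
  shows "restr {\<beta>. wt dg \<beta> = d} p - restr {\<beta>. wt dg \<beta> = d} q \<in> relations d"
proof -
  have "Poly_Mapping.keys (restr {\<beta>. wt dg \<beta> = d} p - restr {\<beta>. wt dg \<beta> = d} q) \<subseteq> monomials d"
    using assms(1,2) by (intro keys_diff_subset) (auto simp: monomials_def polys_def)
  then show ?thesis
    using assms by (simp add: relations_def eval_poly_minus[OF ring_map_const] eval_degree_part)
qed

text \<open>A variable of degree zero can occur to any power in a monomial of degree \<open>d\<close>, so it must not
  contribute to the weight.\<close>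

lemma weight_bound:
  fixes v :: "nat \<Rightarrow> int"
  assumes "\<And>j. j < r \<Longrightarrow> homogeneous 0 (b j) \<Longrightarrow> v j = 0" and \<beta>: "\<beta> \<in> monomials d"
  shows "wt v \<beta> \<le> (\<Sum>j<r. \<bar>v j\<bar>) * d"
proof -
  have le: "v j \<le> (\<Sum>j<r. \<bar>v j\<bar>) * dg j" if j: "j < r" for j
  proof (cases "dg j = 0")
    case True
    then have "homogeneous 0 (b j)" using keys_b[OF j] by (simp add: homogeneous_iff)
    then show ?thesis using assms(1)[OF j] True by simp
  next
    case False
    then have "1 \<le> dg j" using dg_nonneg[of j] by linarith
    have "v j \<le> \<bar>v j\<bar>" by simp
    also have "\<dots> \<le> (\<Sum>j<r. \<bar>v j\<bar>)" using j by (intro member_le_sum) auto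
    also have "\<dots> \<le> (\<Sum>j<r. \<bar>v j\<bar>) * dg j"
      using mult_left_mono[OF \<open>1 \<le> dg j\<close>, of "\<Sum>j<r. \<bar>v j\<bar>"] by (simp add: sum_nonneg)
    finally show ?thesis .
  qed
  have "wt v \<beta> \<le> (\<Sum>x\<in>Poly_Mapping.keys \<beta>. (\<Sum>j<r. \<bar>v j\<bar>) * dg x * of_nat (Poly_Mapping.lookup \<beta> x))"
    unfolding wt_def using \<beta> by (intro sum_mono mult_right_mono le) (auto simp: monomials_def)
  also have "\<dots> = (\<Sum>j<r. \<bar>v j\<bar>) * wt dg \<beta>"
    by (simp add: wt_def sum_distrib_left mult.assoc)
  finally show ?thesis using \<beta> by (simp add: monomials_def)
qed

text \<open>The bounds on \<open>p\<close> modulo relations say that \<open>p(b) t\<^sup>\<mu>\<close> is a section, and a simultaneous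
  presentation of \<open>p(b)\<close> differs from \<open>p\<close> by the relation sought.\<close>

lemma jointly_reducible_of_sections:
  assumes int: "\<And>i j. i < n \<Longrightarrow> j < r \<Longrightarrow> D i j = of_int (W i j)"
    and sections: "section_ring n m r b D \<subseteq> monomial_sections n r b W"
  shows "jointly_reducible n (monomials d) (relations d) (\<lambda>i. wt (W i))"
  unfolding jointly_reducible_def
proof (intro allI impI)
  fix p \<mu>
  assume p: "Poly_Mapping.keys p \<subseteq> monomials d"
    and each: "\<forall>i<n. \<exists>g\<in>relations d. Poly_Mapping.keys (p - g) \<subseteq> {\<beta>. \<mu> i \<le> wt (W i) \<beta>}"
  define z where "z = eval_poly const b p"
  have pp: "p \<in> polys {..<r}" using p by (rule monomials_polys)
  have p_deg: "restr {\<beta>. wt dg \<beta> = d} p = p" using p by (intro restr_eq_self) (auto simp: monomials_def)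
  have z_Sym: "z \<in> Sym m" unfolding z_def Sym_def
    using gens by (intro eval_poly_in_polys[OF pp]) (auto simp: homogeneous_generators_def Sym_def)
  have wval: "ereal (of_int (\<mu> i)) \<le> wval {..<r} b (D i) z" if i: "i < n" for i
  proof -
    obtain g where g: "g \<in> relations d" "Poly_Mapping.keys (p - g) \<subseteq> {\<beta>. \<mu> i \<le> wt (W i) \<beta>}"
      using each i by blast
    have gp: "p - g \<in> polys {..<r}"
      using pp g(1) by (intro polys_diff) (auto simp: relations_def intro: monomials_polys)
    have "ereal (of_rat (of_int (\<mu> i))) \<le> wval {..<r} b (D i) z"
    proof (rule wval_ge[OF gp])
      show "eval_poly const b (p - g) = z"
        using g(1) by (simp add: z_def relations_def eval_poly_minus[OF ring_map_const])
      show "Poly_Mapping.keys (p - g) \<subseteq> {\<beta>. of_int (\<mu> i) \<le> wt (D i) \<beta>}"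
      proof
        fix \<beta> assume \<beta>: "\<beta> \<in> Poly_Mapping.keys (p - g)"
        have "wt (D i) \<beta> = wt (\<lambda>j. of_int (W i j)) \<beta>"
          using gp \<beta> by (intro wt_cong int[OF i]) (auto simp: polys_def)
        then show "\<beta> \<in> {\<beta>. of_int (\<mu> i) \<le> wt (D i) \<beta>}" using g(2) \<beta> by (auto simp: wt_of_int)
      qed
    qed
    then show ?thesis by simp
  qed
  have "Poly_Mapping.single (t_exp n \<mu>) z \<in> section_ring n m r b D"
    using z_Sym wval keys_t_exp[of n \<mu>] by (auto simp: section_ring_def)
  then have F: "Poly_Mapping.single (t_exp n \<mu>) z \<in> monomial_sections n r b W" using sections by blast
  have "\<exists>q\<in>polys {..<r}. eval_poly const b q = z \<and> Poly_Mapping.keys q \<subseteq> {\<beta>. \<forall>i<n. \<mu> i \<le> wt (W i) \<beta>}"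
  proof (cases "z = 0")
    case True
    then show ?thesis by (intro bexI[of _ 0]) (simp_all add: eval_poly_zero[OF ring_map_const])
  next
    case False
    then have "t_exp n \<mu> \<in> Poly_Mapping.keys (Poly_Mapping.single (t_exp n \<mu>) z)" by simp
    then obtain q where "q \<in> polys {..<r}" "eval_poly const b q = z"
      "Poly_Mapping.keys q \<subseteq> {\<beta>. \<forall>i<n. Poly_Mapping.lookup (t_exp n \<mu>) i \<le> wt (W i) \<beta>}"
      using F unfolding monomial_sections_def by auto
    then show ?thesis by (intro bexI[of _ q]) auto
  qed
  then obtain q where q: "q \<in> polys {..<r}" "eval_poly const b q = z"
    "Poly_Mapping.keys q \<subseteq> {\<beta>. \<forall>i<n. \<mu> i \<le> wt (W i) \<beta>}" by blast
  have "p - restr {\<beta>. wt dg \<beta> = d} q \<in> relations d"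
    using degree_part_diff_in_relations[OF pp q(1), of d] q(2) by (simp add: z_def p_deg)
  moreover have "Poly_Mapping.keys (p - (p - restr {\<beta>. wt dg \<beta> = d} q)) \<subseteq> {\<beta>. \<forall>i<n. \<mu> i \<le> wt (W i) \<beta>}"
    using q(3) by auto
  ultimately show "\<exists>g\<in>relations d. Poly_Mapping.keys (p - g) \<subseteq> {\<beta>. \<forall>i<n. \<mu> i \<le> wt (W i) \<beta>}" by blast
qed

text \<open>The converse: the coefficient of \<open>t\<^sup>a\<close> in a section is presented by \<open>p\<close>, say; the
  components of \<open>p\<close> in the various degrees are reduced separately and added up.\<close>

lemma sections_of_jointly_reducible:
  assumes int: "\<And>i j. i < n \<Longrightarrow> j < r \<Longrightarrow> D i j = of_int (W i j)"
    and red: "\<And>d. jointly_reducible n (monomials d) (relations d) (\<lambda>i. wt (W i))"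
  shows "section_ring n m r b D \<subseteq> monomial_sections n r b W"
proof
  fix F assume F: "F \<in> section_ring n m r b D"
  show "F \<in> monomial_sections n r b W"
    unfolding monomial_sections_def
  proof (intro CollectI ballI conjI)
    fix a assume a: "a \<in> Poly_Mapping.keys F"
    show "Poly_Mapping.keys a \<subseteq> {..<n}" using F a by (auto simp: section_ring_def)
    define z where "z = Poly_Mapping.lookup F a"
    have "z \<in> Sym m" using F a by (auto simp: section_ring_def z_def)
    then obtain p where p: "p \<in> polys {..<r}" "eval_poly const b p = z"
      using gens by (auto simp: homogeneous_generators_def)
    have pw: "\<exists>q\<in>polys {..<r}. eval_poly const b q = z \<and>
        Poly_Mapping.keys q \<subseteq> {\<beta>. Poly_Mapping.lookup a i \<le> wt (W i) \<beta>}" if i: "i < n" for i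
    proof -
      have "ereal (of_int (Poly_Mapping.lookup a i)) \<le> wval {..<r} b (D i) z"
        using F a i by (auto simp: section_ring_def z_def)
      then show ?thesis by (rule wval_geD_int[where W = "W i"]) (use int[OF i] in auto)
    qed
    have "\<exists>g. g \<in> relations d \<and> Poly_Mapping.keys (restr {\<beta>. wt dg \<beta> = d} p - g)
        \<subseteq> {\<beta>. \<forall>i<n. Poly_Mapping.lookup a i \<le> wt (W i) \<beta>}" for d
    proof -
      have "Poly_Mapping.keys (restr {\<beta>. wt dg \<beta> = d} p) \<subseteq> monomials d"
        using p(1) by (auto simp: monomials_def polys_def)
      moreover have "\<exists>g\<in>relations d. Poly_Mapping.keys (restr {\<beta>. wt dg \<beta> = d} p - g)
          \<subseteq> {\<beta>. Poly_Mapping.lookup a i \<le> wt (W i) \<beta>}" if i: "i < n" for i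
      proof -
        obtain q where q: "q \<in> polys {..<r}" "eval_poly const b q = z"
          "Poly_Mapping.keys q \<subseteq> {\<beta>. Poly_Mapping.lookup a i \<le> wt (W i) \<beta>}" using pw[OF i] by blast
        have "restr {\<beta>. wt dg \<beta> = d} p - restr {\<beta>. wt dg \<beta> = d} q \<in> relations d"
          using p q by (intro degree_part_diff_in_relations) auto
        moreover have "Poly_Mapping.keys (restr {\<beta>. wt dg \<beta> = d} p - (restr {\<beta>. wt dg \<beta> = d} p - restr {\<beta>. wt dg \<beta> = d} q))
            \<subseteq> {\<beta>. Poly_Mapping.lookup a i \<le> wt (W i) \<beta>}" using q(3) by auto
        ultimately show ?thesis by blast
      qed
      ultimately obtain g where "g \<in> relations d" "Poly_Mapping.keys (restr {\<beta>. wt dg \<beta> = d} p - g)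
          \<subseteq> {\<beta>. \<forall>i<n. Poly_Mapping.lookup a i \<le> wt (W i) \<beta>}"
        by (rule jointly_reducibleD[OF red, where \<mu> = "Poly_Mapping.lookup a"])
      then show ?thesis by blast
    qed
    then have "\<exists>g. \<forall>d. g d \<in> relations d \<and> Poly_Mapping.keys (restr {\<beta>. wt dg \<beta> = d} p - g d)
        \<subseteq> {\<beta>. \<forall>i<n. Poly_Mapping.lookup a i \<le> wt (W i) \<beta>}"
      by (intro choice allI)
    then obtain g where g: "\<And>d. g d \<in> relations d"
      "\<And>d. Poly_Mapping.keys (restr {\<beta>. wt dg \<beta> = d} p - g d) \<subseteq> {\<beta>. \<forall>i<n. Poly_Mapping.lookup a i \<le> wt (W i) \<beta>}"
      by blast
    let ?ds = "wt dg ` Poly_Mapping.keys p"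
    define q where "q = (\<Sum>d\<in>?ds. restr {\<beta>. wt dg \<beta> = d} p - g d)"
    have "eval_poly const b q = (\<Sum>d\<in>?ds. eval_poly const b (restr {\<beta>. wt dg \<beta> = d} p))"
      using g(1) by (simp add: q_def eval_poly_sum[OF ring_map_const] eval_poly_minus[OF ring_map_const] relations_def)
    also have "\<dots> = eval_poly const b (\<Sum>d\<in>?ds. restr {\<beta>. wt dg \<beta> = d} p)"
      by (simp add: eval_poly_sum[OF ring_map_const])
    also have "(\<Sum>d\<in>?ds. restr {\<beta>. wt dg \<beta> = d} p) = p" by (rule sum_restr_fibres) auto
    finally have "eval_poly const b q = z" using p(2) by simp
    moreover have "q \<in> polys {..<r}"
      unfolding q_def using g(1) p(1)
      by (intro polys_sum polys_diff polys_restr) (auto simp: relations_def intro: monomials_polys)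
    moreover have "Poly_Mapping.keys q \<subseteq> {\<beta>. \<forall>i<n. Poly_Mapping.lookup a i \<le> wt (W i) \<beta>}"
      unfolding q_def by (rule keys_sum_subset) (rule g(2))
    ultimately show "\<exists>p\<in>polys {..<r}. eval_poly const b p = Poly_Mapping.lookup F a \<and>
        Poly_Mapping.keys p \<subseteq> {\<beta>. \<forall>i<n. Poly_Mapping.lookup a i \<le> wt (W i) \<beta>}"
      unfolding z_def by blast
  qed
qed

lemma monomial_sections_subset:
  assumes int: "\<And>i j. i < n \<Longrightarrow> j < r \<Longrightarrow> D i j = of_int (W i j)"
  shows "monomial_sections n r b W \<subseteq> section_ring n m r b D"
proof
  fix F assume F: "F \<in> monomial_sections n r b W"
  show "F \<in> section_ring n m r b D"
    unfolding section_ring_def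
  proof (intro CollectI ballI conjI allI impI)
    fix a assume a: "a \<in> Poly_Mapping.keys F"
    show "Poly_Mapping.keys a \<subseteq> {..<n}" using F a by (auto simp: monomial_sections_def)
    obtain p where p: "p \<in> polys {..<r}" "eval_poly const b p = Poly_Mapping.lookup F a"
      "Poly_Mapping.keys p \<subseteq> {\<beta>. \<forall>i<n. Poly_Mapping.lookup a i \<le> wt (W i) \<beta>}"
      using F a by (auto simp: monomial_sections_def)
    show "Poly_Mapping.lookup F a \<in> Sym m" unfolding p(2)[symmetric] Sym_def
      using gens by (intro eval_poly_in_polys[OF p(1)]) (auto simp: homogeneous_generators_def Sym_def)
    fix i assume i: "i < n"
    have "ereal (of_rat (of_int (Poly_Mapping.lookup a i))) \<le> wval {..<r} b (D i) (Poly_Mapping.lookup F a)"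
    proof (rule wval_ge[OF p(1,2)], rule)
      fix \<beta> assume \<beta>: "\<beta> \<in> Poly_Mapping.keys p"
      have "wt (D i) \<beta> = wt (\<lambda>j. of_int (W i j)) \<beta>"
        using p(1) \<beta> by (intro wt_cong int[OF i]) (auto simp: polys_def)
      then show "\<beta> \<in> {\<beta>. of_int (Poly_Mapping.lookup a i) \<le> wt (D i) \<beta>}"
        using p(3) \<beta> i by (auto simp: wt_of_int)
    qed
    then show "ereal (of_int (Poly_Mapping.lookup a i)) \<le> wval {..<r} b (D i) (Poly_Mapping.lookup F a)" by simp
  qed
qed

end

section \<open>Homogeneous parts of the generators\<close>

text \<open>
  A generator \<open>f\<close> is cut into the parts \<open>slice \<mu> d f\<close> by the exponents \<open>\<mu>\<close> of \<open>t\<close> and by degree \<open>d\<close>. The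
  resulting relations in degree \<open>d\<close> are indexed by \<open>(\<nu>, f, \<epsilon>)\<close>: the monomial \<open>Y\<^sup>\<nu>\<close> times the part of
  \<open>f\<close> with exponents \<open>\<epsilon>\<close>.
\<close>

locale lifted_presentation = graded_presentation m r b
  for m r :: nat and b :: "nat \<Rightarrow> 'k::field sym" +
  fixes n :: nat and W :: "nat \<Rightarrow> nat \<Rightarrow> int" and D :: "nat \<Rightarrow> nat \<Rightarrow> rat"
    and G :: "(nat + nat, 'k) mpoly set"
  assumes lift: "j < r \<Longrightarrow> b_lift n r b D j = Poly_Mapping.single (t_exp n (\<lambda>i. W i j)) (b j)"
    and G_sub: "G \<subseteq> big_ideal n r b D"
    and G_gen: "ideal_gen (XY_vars n r) G = big_ideal n r b D"
begin

definition slice :: "(nat \<Rightarrow> int) \<Rightarrow> int \<Rightarrow> (nat + nat, 'k) mpoly \<Rightarrow> (nat, 'k) mpoly" where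
  "slice \<mu> d f = dehom (restr {\<alpha>. (\<forall>i<n. wt (t_weight W i) \<alpha> = \<mu> i) \<and> wt dg (Ypart \<alpha>) = d} f)"

lemma slice_zero [simp]: "slice \<mu> d 0 = 0"
  by (simp add: slice_def)

lemma slice_add: "slice \<mu> d (f + g) = slice \<mu> d f + slice \<mu> d g"
  by (simp add: slice_def restr_add dehom_add)

lemma slice_single:
  "slice \<mu> d (Poly_Mapping.single \<alpha> c) =
    (if (\<forall>i<n. wt (t_weight W i) \<alpha> = \<mu> i) \<and> wt dg (Ypart \<alpha>) = d then Poly_Mapping.single (Ypart \<alpha>) c else 0)"
  by (auto simp: slice_def restr_single dehom_single)

lemma slice_single_mult:
  "slice \<mu> d (Poly_Mapping.single \<alpha> c * f) =
    Poly_Mapping.single (Ypart \<alpha>) c * slice (\<lambda>i. \<mu> i - wt (t_weight W i) \<alpha>) (d - wt dg (Ypart \<alpha>)) f"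
proof (induction f rule: poly_mapping_induct)
  case (single \<beta>)
  have "(\<forall>i<n. wt (t_weight W i) (\<alpha> + \<beta>) = \<mu> i) \<longleftrightarrow> (\<forall>i<n. wt (t_weight W i) \<beta> = \<mu> i - wt (t_weight W i) \<alpha>)"
    and "wt dg (Ypart (\<alpha> + \<beta>)) = d \<longleftrightarrow> wt dg (Ypart \<beta>) = d - wt dg (Ypart \<alpha>)"
    by (auto simp: wt_add Ypart_add)
  then show ?case by (auto simp: mult_single slice_single Ypart_add)
qed (simp_all add: slice_add distrib_left)

lemma keys_slice:
  assumes "\<beta> \<in> Poly_Mapping.keys (slice \<mu> d f)"
  obtains \<alpha> where "\<alpha> \<in> Poly_Mapping.keys f" "\<beta> = Ypart \<alpha>" "\<And>i. i < n \<Longrightarrow> wt (t_weight W i) \<alpha> = \<mu> i"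
    "wt dg (Ypart \<alpha>) = d"
  using assms keys_dehom[of "restr {\<alpha>. (\<forall>i<n. wt (t_weight W i) \<alpha> = \<mu> i) \<and> wt dg (Ypart \<alpha>) = d} f"]
  unfolding slice_def by auto

text \<open>The kernel is homogeneous: slicing \<open>f\<close> corresponds to taking a coefficient, and in it a
  homogeneous component, of the image of \<open>f\<close>.\<close>

lemma eval_slice:
  assumes "f \<in> polys (XY_vars n r)"
  shows "eval_poly const b (slice \<mu> d f) = restr {\<gamma>. wt (\<lambda>_. 1) \<gamma> = d}
    (Poly_Mapping.lookup (eval_poly lconst (case_sum t_inv (b_lift n r b D)) f) (t_exp n \<mu>))"
proof (induction f rule: poly_mapping_induct)
  case (single \<alpha>)
  define c where "c = Poly_Mapping.lookup f \<alpha>"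
  have \<alpha>: "Poly_Mapping.keys \<alpha> \<subseteq> XY_vars n r" using assms single by (auto simp: polys_def)
  then have Y: "Poly_Mapping.keys (Ypart \<alpha>) \<subseteq> {..<r}" by (simp add: keys_parts_XY)
  have "Poly_Mapping.keys (const c * mon_eval b (Ypart \<alpha>)) \<subseteq> {\<gamma>. wt (\<lambda>_. 1) \<gamma> = wt dg (Ypart \<alpha>)}"
    by (rule order_trans[OF keys_const_mult], rule keys_mon_eval_eq, rule keys_b) (use Y in auto)
  then have 1: "restr {\<gamma>. wt (\<lambda>_. 1) \<gamma> = d} (const c * mon_eval b (Ypart \<alpha>)) =
      (if wt dg (Ypart \<alpha>) = d then const c * mon_eval b (Ypart \<alpha>) else 0)"
    by (force intro: restr_eq_self restr_eq_zero)
  have "eval_poly lconst (case_sum t_inv (b_lift n r b D)) (Poly_Mapping.single \<alpha> c) =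
      Poly_Mapping.single (t_exp n (\<lambda>i. wt (t_weight W i) \<alpha>)) (const c * mon_eval b (Ypart \<alpha>))"
    by (simp add: eval_poly_single[OF ring_map_lconst] mon_eval_lifts[OF lift \<alpha>] lconst_def mult_single)
  then show ?case
    unfolding c_def[symmetric]
    by (auto simp: lookup_single when_def t_exp_eq_iff slice_single 1 eval_poly_single[OF ring_map_const]
        eval_poly_zero[OF ring_map_const])
qed (simp_all add: slice_add eval_poly_zero[OF ring_map_const] eval_poly_zero[OF ring_map_lconst]
      eval_poly_add[OF ring_map_const] eval_poly_add[OF ring_map_lconst] lookup_add restr_add)

lemma slice_in_relations:
  assumes "f \<in> big_ideal n r b D"
  shows "slice \<mu> d f \<in> relations d"
proof -
  have f: "f \<in> polys (XY_vars n r)" "eval_poly lconst (case_sum t_inv (b_lift n r b D)) f = 0"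
    using assms by (auto simp: big_ideal_def)
  have "Poly_Mapping.keys (slice \<mu> d f) \<subseteq> monomials d"
  proof
    fix \<beta> assume "\<beta> \<in> Poly_Mapping.keys (slice \<mu> d f)"
    then obtain \<alpha> where \<alpha>: "\<alpha> \<in> Poly_Mapping.keys f" "\<beta> = Ypart \<alpha>" "wt dg (Ypart \<alpha>) = d"
      by (rule keys_slice)
    have "Poly_Mapping.keys \<alpha> \<subseteq> XY_vars n r" using f(1) \<alpha>(1) by (auto simp: polys_def)
    then show "\<beta> \<in> monomials d" using \<alpha> by (simp add: monomials_def keys_parts_XY)
  qed
  then show ?thesis by (simp add: relations_def eval_slice[OF f(1)] f(2))
qed

type_synonym 'c gen_index = "(nat \<Rightarrow>\<^sub>0 nat) \<times> (nat + nat, 'c) mpoly \<times> (nat \<Rightarrow> int)"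

definition gen_set :: "'k gen_index set" where
  "gen_set = {(\<nu>, f, \<epsilon>). Poly_Mapping.keys \<nu> \<subseteq> {..<r} \<and> f \<in> G}"

definition gen_rel :: "int \<Rightarrow> 'k gen_index \<Rightarrow> (nat, 'k) mpoly" where
  "gen_rel d = (\<lambda>(\<nu>, f, \<epsilon>). Poly_Mapping.single \<nu> 1 * slice \<epsilon> (d - wt dg \<nu>) f)"

text \<open>The formal weight. The true weight of a monomial of \<open>gen_rel\<close> exceeds it by the exponent
  of \<open>X\<^sub>i\<close> in the term that it comes from, so a part divisible by \<open>X\<^sub>i\<close> does not attain it.\<close>

definition gen_weight :: "nat \<Rightarrow> 'k gen_index \<Rightarrow> int" where
  "gen_weight i = (\<lambda>(\<nu>, f, \<epsilon>). wt (W i) \<nu> + \<epsilon> i)"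

lemma keys_gen_rel:
  assumes "\<beta> \<in> Poly_Mapping.keys (gen_rel d (\<nu>, f, \<epsilon>))"
  obtains \<alpha> where "\<alpha> \<in> Poly_Mapping.keys f" "\<beta> = \<nu> + Ypart \<alpha>"
    "\<And>i. i < n \<Longrightarrow> wt (t_weight W i) \<alpha> = \<epsilon> i" "wt dg (Ypart \<alpha>) = d - wt dg \<nu>"
proof -
  obtain \<beta>' where "\<beta>' \<in> Poly_Mapping.keys (slice \<epsilon> (d - wt dg \<nu>) f)" "\<beta> = \<nu> + \<beta>'"
    using assms keys_mult[of "Poly_Mapping.single \<nu> (1::'k)" "slice \<epsilon> (d - wt dg \<nu>) f"]
    by (auto simp: gen_rel_def)
  then show thesis by (auto elim!: keys_slice intro: that)
qed

lemma weight_of_gen_rel: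
  assumes "wt (t_weight W i) \<alpha> = \<epsilon> i"
  shows "wt (W i) (\<nu> + Ypart \<alpha>) = gen_weight i (\<nu>, f, \<epsilon>) + int (Poly_Mapping.lookup \<alpha> (Inl i))"
  using assms by (simp add: gen_weight_def wt_add wt_t_weight)

lemma gen_rel_in_relations:
  assumes "l \<in> gen_set"
  shows "gen_rel d l \<in> relations d"
proof -
  obtain \<nu> f \<epsilon> where l: "l = (\<nu>, f, \<epsilon>)" "Poly_Mapping.keys \<nu> \<subseteq> {..<r}" "f \<in> G"
    using assms by (auto simp: gen_set_def)
  have s: "slice \<epsilon> (d - wt dg \<nu>) f \<in> relations (d - wt dg \<nu>)"
    using l(3) G_sub by (intro slice_in_relations) auto
  have "Poly_Mapping.keys (gen_rel d l) \<subseteq> monomials d"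
  proof
    fix \<beta> assume "\<beta> \<in> Poly_Mapping.keys (gen_rel d l)"
    then obtain \<beta>' where \<beta>: "\<beta>' \<in> Poly_Mapping.keys (slice \<epsilon> (d - wt dg \<nu>) f)" "\<beta> = \<nu> + \<beta>'"
      using keys_mult[of "Poly_Mapping.single \<nu> (1::'k)" "slice \<epsilon> (d - wt dg \<nu>) f"]
      by (auto simp: gen_rel_def l(1))
    then have "\<beta>' \<in> monomials (d - wt dg \<nu>)" using s by (auto simp: relations_def)
    then show "\<beta> \<in> monomials d"
      using l(2) keys_add[of \<nu> \<beta>'] by (auto simp: monomials_def \<beta>(2) wt_add)
  qed
  then show ?thesis using s
    by (simp add: relations_def gen_rel_def l(1) eval_poly_mult[OF ring_map_const])
qed

lemma shift_gen_rel:
  "Poly_Mapping.single \<kappa> 1 * gen_rel (d - wt dg \<kappa>) (\<nu>, f, \<epsilon>) = gen_rel d (\<kappa> + \<nu>, f, \<epsilon>)"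
  by (simp add: gen_rel_def wt_add mult_single algebra_simps flip: mult.assoc)

lemma shift_span:
  assumes "p \<in> mp.span (gen_rel (d - wt dg \<kappa>) ` {l \<in> gen_set. \<forall>i<n. \<mu> i \<le> gen_weight i l})"
    and \<kappa>: "Poly_Mapping.keys \<kappa> \<subseteq> {..<r}"
    and \<mu>': "\<And>i. i < n \<Longrightarrow> \<mu>' i \<le> \<mu> i + wt (W i) \<kappa>"
  shows "Poly_Mapping.single \<kappa> c * p \<in> mp.span (gen_rel d ` {l \<in> gen_set. \<forall>i<n. \<mu>' i \<le> gen_weight i l})"
  using assms(1)
proof (induction rule: mp.span_induct_alt)
  case base
  show ?case by (simp add: mp.span_zero)
next
  case (step k x y)
  obtain \<nu> f \<epsilon> where l: "x = gen_rel (d - wt dg \<kappa>) (\<nu>, f, \<epsilon>)" "(\<nu>, f, \<epsilon>) \<in> gen_set"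
    "\<And>i. i < n \<Longrightarrow> \<mu> i \<le> gen_weight i (\<nu>, f, \<epsilon>)"
    using step(1) by force
  have "(\<kappa> + \<nu>, f, \<epsilon>) \<in> gen_set"
    using l(2) \<kappa> keys_add[of \<kappa> \<nu>] by (auto simp: gen_set_def)
  moreover have "\<mu>' i \<le> gen_weight i (\<kappa> + \<nu>, f, \<epsilon>)" if "i < n" for i
    using \<mu>'[OF that] l(3)[OF that] by (simp add: gen_weight_def wt_add)
  ultimately have "gen_rel d (\<kappa> + \<nu>, f, \<epsilon>) \<in> mp.span (gen_rel d ` {l \<in> gen_set. \<forall>i<n. \<mu>' i \<le> gen_weight i l})"
    by (intro mp.span_base imageI) simp
  moreover have "Poly_Mapping.single \<kappa> c * (const k * x) = const (c * k) * gen_rel d (\<kappa> + \<nu>, f, \<epsilon>)"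
    unfolding l(1) shift_gen_rel[symmetric]
    by (simp add: const_def mult_single flip: mult.assoc)
  ultimately show ?case
    using step(2) by (simp add: distrib_left mp.span_add mp.span_scale)
qed

text \<open>The polynomials whose slices are spanned by the \<open>gen_rel\<close> with the right bounds form an ideal that
  contains \<open>\<G>\<close>. In this form homogeneous components of the generators and bookkeeping for their
  coefficients are dealt with at once.\<close>

lemma slice_in_span:
  assumes "f \<in> big_ideal n r b D"
  shows "slice \<mu> d f \<in> mp.span (gen_rel d ` {l \<in> gen_set. \<forall>i<n. \<mu> i \<le> gen_weight i l})"
proof -
  let ?S = "\<lambda>\<mu> d. mp.span (gen_rel d ` {l \<in> gen_set. \<forall>i<n. \<mu> i \<le> gen_weight i l})"
  let ?K = "{q \<in> polys (XY_vars n r). \<forall>\<mu> d. slice \<mu> d q \<in> ?S \<mu> d}"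
  have "is_ideal (XY_vars n r) ?K"
    unfolding is_ideal_def
  proof (intro conjI ballI)
    fix p q :: "(nat + nat, 'k) mpoly" assume p: "p \<in> polys (XY_vars n r)" and q: "q \<in> ?K"
    have "\<forall>\<mu> d. slice \<mu> d (p * q) \<in> ?S \<mu> d"
    proof (induction p rule: poly_mapping_induct)
      case (single \<alpha>)
      have "Poly_Mapping.keys \<alpha> \<subseteq> XY_vars n r" using p single by (auto simp: polys_def)
      then have Y: "Poly_Mapping.keys (Ypart \<alpha>) \<subseteq> {..<r}" by (simp add: keys_parts_XY)
      show ?case
        unfolding slice_single_mult using q
        by (intro allI shift_span[where \<mu> = "\<lambda>i. _ i - wt (t_weight W i) \<alpha>"] Y) (auto simp: wt_t_weight)
    qed (auto simp: distrib_right slice_add mp.span_zero mp.span_add)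
    then show "p * q \<in> ?K" using p q by (simp add: polys_mult)
  qed (auto simp: slice_add mp.span_zero mp.span_add polys_add)
  moreover have "G \<subseteq> ?K"
  proof
    fix f assume f: "f \<in> G"
    have "slice \<mu> d f \<in> ?S \<mu> d" for \<mu> d
    proof -
      have eq: "slice \<mu> d f = gen_rel d (0, f, \<mu>)" by (simp add: gen_rel_def)
      have "(0, f, \<mu>) \<in> {l \<in> gen_set. \<forall>i<n. \<mu> i \<le> gen_weight i l}"
        using f by (simp add: gen_set_def gen_weight_def)
      then show ?thesis unfolding eq by (intro mp.span_base imageI)
    qed
    then show "f \<in> ?K" using f G_sub by (auto simp: big_ideal_def)
  qed
  ultimately have "ideal_gen (XY_vars n r) G \<subseteq> ?K"
    unfolding ideal_gen_def by (intro hull_minimal)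
  then show ?thesis using assms G_gen by blast
qed

text \<open>A relation \<open>p\<close> with weights bounded below by \<open>\<mu>\<close> is a slice of its homogenization, where the term
  \<open>Y\<^sup>\<beta>\<close> is multiplied by the powers of the \<open>X\<^sub>i\<close> that bring the exponents of \<open>t\<close> down to \<open>\<mu>\<close>.\<close>

lemma filtered_generators_gen_rel:
  "filtered_generators n (relations d) (gen_rel d) gen_set (\<lambda>i. wt (W i)) gen_weight"
  unfolding filtered_generators_def
proof (intro conjI allI impI ballI)
  fix i l \<beta> assume i: "i < n" and "l \<in> gen_set" and \<beta>: "\<beta> \<in> Poly_Mapping.keys (gen_rel d l)"
  obtain \<nu> f \<epsilon> where l: "l = (\<nu>, f, \<epsilon>)" by (cases l) auto
  obtain \<alpha> where "\<alpha> \<in> Poly_Mapping.keys f" "\<beta> = \<nu> + Ypart \<alpha>" "\<And>i. i < n \<Longrightarrow> wt (t_weight W i) \<alpha> = \<epsilon> i"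
    using \<beta> unfolding l by (rule keys_gen_rel) blast
  then show "gen_weight i l \<le> wt (W i) \<beta>" using i by (simp add: l weight_of_gen_rel[where \<epsilon> = \<epsilon> and f = f])
next
  fix p \<mu> assume p: "p \<in> relations d" and keys: "Poly_Mapping.keys p \<subseteq> {\<beta>. \<forall>i<n. \<mu> i \<le> wt (W i) \<beta>}"
  define \<alpha> where "\<alpha> \<beta> = XY_mon n (\<lambda>i. nat (wt (W i) \<beta> - \<mu> i)) \<beta>" for \<beta>
  have \<alpha>_XY: "Poly_Mapping.keys (\<alpha> \<beta>) \<subseteq> XY_vars n r" if "\<beta> \<in> Poly_Mapping.keys p" for \<beta>
    unfolding \<alpha>_def using p that by (intro keys_XY_mon) (auto simp: relations_def monomials_def)
  have \<alpha>_wt: "wt (t_weight W i) (\<alpha> \<beta>) = \<mu> i" if "\<beta> \<in> Poly_Mapping.keys p" "i < n" for \<beta> i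
    using keys that by (auto simp: wt_t_weight \<alpha>_def)
  have \<alpha>_Y: "Ypart (\<alpha> \<beta>) = \<beta>" for \<beta> by (simp add: \<alpha>_def)
  define H where "H = (\<Sum>\<beta>\<in>Poly_Mapping.keys p. Poly_Mapping.single (\<alpha> \<beta>) (Poly_Mapping.lookup p \<beta>))"
  have "H \<in> polys (XY_vars n r)"
    unfolding H_def using \<alpha>_XY by (intro polys_sum) (auto simp: polys_def)
  moreover have "eval_poly lconst (case_sum t_inv (b_lift n r b D)) H = 0"
  proof -
    have "eval_poly lconst (case_sum t_inv (b_lift n r b D)) H =
      (\<Sum>\<beta>\<in>Poly_Mapping.keys p. Poly_Mapping.single (t_exp n \<mu>) (const (Poly_Mapping.lookup p \<beta>) * mon_eval b \<beta>))"
      unfolding H_def eval_poly_sum[OF ring_map_lconst]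
    proof (intro sum.cong refl)
      fix \<beta> assume \<beta>: "\<beta> \<in> Poly_Mapping.keys p"
      have "t_exp n (\<lambda>i. wt (t_weight W i) (\<alpha> \<beta>)) = t_exp n \<mu>" using \<alpha>_wt[OF \<beta>] by (simp add: t_exp_eq_iff)
      then show "eval_poly lconst (case_sum t_inv (b_lift n r b D)) (Poly_Mapping.single (\<alpha> \<beta>) (Poly_Mapping.lookup p \<beta>)) =
          Poly_Mapping.single (t_exp n \<mu>) (const (Poly_Mapping.lookup p \<beta>) * mon_eval b \<beta>)"
        by (simp add: eval_poly_single[OF ring_map_lconst] mon_eval_lifts[OF lift \<alpha>_XY[OF \<beta>]] lconst_def mult_single \<alpha>_Y)
    qed
    also have "\<dots> = Poly_Mapping.single (t_exp n \<mu>) (eval_poly const b p)"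
      unfolding eval_poly_mon by (rule poly_mapping_eqI) (simp add: lookup_sum lookup_single when_def)
    finally show ?thesis using p by (simp add: relations_def)
  qed
  ultimately have H: "H \<in> big_ideal n r b D" by (simp add: big_ideal_def)
  have "slice \<mu> d H = p"
  proof -
    have "slice \<mu> d (\<Sum>\<beta>\<in>A. Poly_Mapping.single (\<alpha> \<beta>) (Poly_Mapping.lookup p \<beta>)) =
        (\<Sum>\<beta>\<in>A. Poly_Mapping.single \<beta> (Poly_Mapping.lookup p \<beta>))" if "A \<subseteq> Poly_Mapping.keys p" for A
      using finite_subset[OF that finite_keys] that
    proof (induction A rule: finite_induct)
      case (insert \<beta> A)
      then have "wt dg \<beta> = d" using p by (auto simp: relations_def monomials_def)
      then show ?case using insert \<alpha>_wt[of \<beta>] by (simp add: slice_add slice_single \<alpha>_Y)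
    qed simp
    from this[OF order_refl] show ?thesis by (simp add: H_def poly_mapping_sum_singles)
  qed
  then show "p \<in> mp.span (gen_rel d ` {l \<in> gen_set. \<forall>i<n. \<mu> i \<le> gen_weight i l})"
    using slice_in_span[OF H, of \<mu> d] by simp
qed

end

section \<open>Initial forms\<close>

lemma init_form_restr:
  "init_form w f = restr {\<alpha>. \<forall>\<beta>\<in>Poly_Mapping.keys f. pairing w \<alpha> \<le> pairing w \<beta>} f"
proof (rule poly_mapping_eqI)
  fix \<alpha>
  show "Poly_Mapping.lookup (init_form w f) \<alpha> =
      Poly_Mapping.lookup (restr {\<alpha>. \<forall>\<beta>\<in>Poly_Mapping.keys f. pairing w \<alpha> \<le> pairing w \<beta>} f) \<alpha>"
    by (auto simp: init_form_def lookup_sum lookup_single when_def sum.delta' in_keys_iff)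
qed

lemma set_X_zero_restr: "set_X_zero i f = restr {\<alpha>. Poly_Mapping.lookup \<alpha> (Inl i) = 0} f"
proof (induction f rule: poly_mapping_induct)
  case zero
  show ?case by (simp add: set_X_zero_def eval_poly_zero[OF ring_map_const])
next
  case (single \<alpha>)
  have "mon_eval (\<lambda>v. if v = Inl i then 0 else var v :: (nat + nat, 'a) mpoly) \<alpha> =
      (if Poly_Mapping.lookup \<alpha> (Inl i) = 0 then Poly_Mapping.single \<alpha> 1 else 0)"
  proof (cases "Poly_Mapping.lookup \<alpha> (Inl i) = 0")
    case True
    then have "mon_eval (\<lambda>v. if v = Inl i then 0 else var v :: (nat + nat, 'a) mpoly) \<alpha> = mon_eval var \<alpha>"
      unfolding mon_eval_def by (intro prod.cong) (auto simp: in_keys_iff)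
    then show ?thesis using True by (simp add: mon_eval_var)
  next
    case False
    then show ?thesis by (auto simp: mon_eval_def in_keys_iff zero_power intro!: prod_zero bexI[of _ "Inl i"])
  qed
  then show ?case
    by (simp add: set_X_zero_def eval_poly_single[OF ring_map_const] restr_single const_mult_single)
next
  case (add q q')
  then show ?case by (simp add: set_X_zero_def eval_poly_add[OF ring_map_const] restr_add)
qed

lemma pairing_s_weight: "pairing (s_weight w) \<alpha> = wt w (Ypart \<alpha>)"
  by (simp add: pairing_eq_wt s_weight_def wt_case_sum) (simp add: wt_def)

lemma (in graded_presentation) b_lift_integral:
  assumes D: "\<And>i. i < n \<Longrightarrow> D i \<in> Trop_star r b"
    and int: "\<And>i j. i < n \<Longrightarrow> j < r \<Longrightarrow> D i j = of_int (W i j)" and j: "j < r"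
  shows "b_lift n r b D j = Poly_Mapping.single (t_exp n (\<lambda>i. W i j)) (b j)"
proof -
  have "\<lfloor>real_of_ereal (wval {..<r} b (D i) (b j))\<rfloor> = W i j" if "i < n" for i
    using that by (simp add: Trop_star_wval[OF gens D j] int j)
  then show ?thesis by (simp add: b_lift_def t_exp_def)
qed

text \<open>
  The formal weights for \<open>D'\<close> are those of the whole generator \<open>f\<close>, not of its parts: the minimum
  \<open>\<omega> i f\<close> is attained exactly by the terms of \<open>f\<close> without \<open>X\<^sub>i\<close> (\<open>no_X\<close>), which are the terms where
  the formal weight for \<open>D\<close> is attained.
\<close>

theorem proposition6p16:
  fixes \<Sigma> :: "(real ^ 'd) set set" and \<rho> :: "nat \<Rightarrow> (real ^ 'd) set"
    and n m r :: nat
    and b :: "nat \<Rightarrow> 'k::alg_closed_field sym"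
    and D D' :: "nat \<Rightarrow> nat \<Rightarrow> rat"
    and G :: "(nat + nat, 'k) mpoly set"
  assumes "smooth_fan \<Sigma>" and "bij_betw \<rho> {..<n} (rays \<Sigma>)"
    and "homogeneous_generators m r b"
    and "D \<in> diagrams \<Sigma> \<rho> n r b" and "integral_diagram n r D"
    and "strong_khovanskii_basis n m r b D"
    and "finite G" and "G \<subseteq> big_ideal n r b D"
    and "ideal_gen (XY_vars n r) G = big_ideal n r b D"
    and "\<forall>i<n. ideal_gen (XY_vars n r) (init_form (s_weight (D i)) ` G)
                 = init_ideal (XY_vars n r) (s_weight (D i)) (big_ideal n r b D)"
    and "\<forall>i<n. \<forall>f\<in>G. init_form (s_weight (D i)) f = set_X_zero i f"
    and "D' \<in> C_set \<Sigma> \<rho> n r b D G" and "integral_diagram n r D'"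
  shows "fin_gen_algebra lconst (section_ring n m r b D')"
proof -
  define W where "W i j = \<lfloor>D i j\<rfloor>" for i j
  define W' where "W' i j = \<lfloor>D' i j\<rfloor>" for i j
  have floor: "x = of_int \<lfloor>x\<rfloor>" if "x \<in> \<int>" for x :: rat
    using that by (elim Ints_cases) simp
  have int: "D i j = of_int (W i j)" and int': "D' i j = of_int (W' i j)" if "i < n" "j < r" for i j
    unfolding W_def W'_def by (rule floor, use assms(5,13) that in \<open>simp add: integral_diagram_def\<close>)+
  have row: "D i \<in> Trop_star r b" and row': "D' i \<in> Trop_star r b" if "i < n" for i
    using assms(4,12) that by (auto simp: C_set_def diagrams_def)
  have init': "init_form (s_weight (D' i)) f = set_X_zero i f" if "i < n" "f \<in> G" for i f
    using assms(11,12) that by (auto simp: C_set_def)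
  interpret graded_presentation m r b
    by unfold_locales (rule assms(3))
  have lift: "b_lift n r b D j = Poly_Mapping.single (t_exp n (\<lambda>i. W i j)) (b j)"
    and lift': "b_lift n r b D' j = Poly_Mapping.single (t_exp n (\<lambda>i. W' i j)) (b j)" if "j < r" for j
    by (rule b_lift_integral; fact row int row' int' that)+
  interpret lifted_presentation m r b n W D G
    by unfold_locales (fact lift assms(8,9))+
  have sections: "section_ring n m r b D \<subseteq> monomial_sections n r b W"
    using assms(6) alg_gen_lifts[OF lift] by (simp add: strong_khovanskii_basis_def)
  have red: "jointly_reducible n (monomials d) (relations d) (\<lambda>i. wt (W i))" for d
    by (rule jointly_reducible_of_sections[where D = D]; fact int sections)
  define \<omega> where "\<omega> i f = Min ((\<lambda>\<alpha>. wt (W' i) (Ypart \<alpha>)) ` Poly_Mapping.keys f)"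
    for i and f :: "(nat + nat, 'k) mpoly"
  define N' :: "nat \<Rightarrow> 'k gen_index \<Rightarrow> int" where "N' i = (\<lambda>(\<nu>, f, \<epsilon>). wt (W' i) \<nu> + \<omega> i f)" for i
  have \<omega>_le: "\<omega> i f \<le> wt (W' i) (Ypart \<alpha>)" if "\<alpha> \<in> Poly_Mapping.keys f" for i f \<alpha>
    unfolding \<omega>_def using that by (intro Min_le) auto
  have no_X: "Poly_Mapping.lookup \<alpha> (Inl i) = 0 \<longleftrightarrow> wt (W' i) (Ypart \<alpha>) = \<omega> i f"
    if i: "i < n" and f: "f \<in> G" and \<alpha>: "\<alpha> \<in> Poly_Mapping.keys f" for i f \<alpha>
  proof -
    have pair: "pairing (s_weight (D' i)) \<beta> = of_int (wt (W' i) (Ypart \<beta>))"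
      if "\<beta> \<in> Poly_Mapping.keys f" for \<beta>
    proof -
      have "Poly_Mapping.keys \<beta> \<subseteq> XY_vars n r"
        using that f assms(8) by (auto simp: big_ideal_def polys_def)
      then have "wt (D' i) (Ypart \<beta>) = wt (\<lambda>j. of_int (W' i j)) (Ypart \<beta>)"
        by (intro wt_cong int'[OF i]) (auto simp: keys_parts_XY)
      then show ?thesis by (simp add: pairing_s_weight wt_of_int)
    qed
    have "Poly_Mapping.lookup \<alpha> (Inl i) = 0 \<longleftrightarrow> \<alpha> \<in> Poly_Mapping.keys (set_X_zero i f)"
      using \<alpha> by (simp add: set_X_zero_restr)
    also have "\<dots> \<longleftrightarrow> (\<forall>\<beta>\<in>Poly_Mapping.keys f. wt (W' i) (Ypart \<alpha>) \<le> wt (W' i) (Ypart \<beta>))"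
      using \<alpha> pair by (simp add: init'[OF i f, symmetric] init_form_restr)
    also have "\<dots> \<longleftrightarrow> wt (W' i) (Ypart \<alpha>) \<le> \<omega> i f"
      unfolding \<omega>_def using \<alpha> by (subst Min_ge_iff) auto
    also have "\<dots> \<longleftrightarrow> wt (W' i) (Ypart \<alpha>) = \<omega> i f"
      using \<omega>_le[OF \<alpha>, of i] by auto
    finally show ?thesis .
  qed
  have "jointly_reducible n (monomials d) (relations d) (\<lambda>i. wt (W' i))" for d
  proof (rule change_all_rows[OF relations_subspace _ gen_rel_in_relations red filtered_generators_gen_rel,
      where N' = N' and C = "\<lambda>i. (\<Sum>j<r. \<bar>W' i j\<bar>) * d"])
    fix p assume "p \<in> relations d"
    then show "Poly_Mapping.keys p \<subseteq> monomials d" by (simp add: relations_def)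
  next
    fix i l \<beta> assume i: "i < n" and l: "l \<in> gen_set" and \<beta>: "\<beta> \<in> Poly_Mapping.keys (gen_rel d l)"
    obtain \<nu> f \<epsilon> where l': "l = (\<nu>, f, \<epsilon>)" "f \<in> G" using l by (auto simp: gen_set_def)
    obtain \<alpha> where \<alpha>: "\<alpha> \<in> Poly_Mapping.keys f" "\<beta> = \<nu> + Ypart \<alpha>" "wt (t_weight W i) \<alpha> = \<epsilon> i"
      using \<beta> i unfolding l'(1) by (auto elim: keys_gen_rel)
    show "N' i l \<le> wt (W' i) \<beta>"
      using \<omega>_le[OF \<alpha>(1)] by (simp add: N'_def l'(1) \<alpha>(2) wt_add)
    show "wt (W i) \<beta> = gen_weight i l \<longleftrightarrow> wt (W' i) \<beta> = N' i l"
      using no_X[OF i l'(2) \<alpha>(1)] weight_of_gen_rel[where \<nu> = \<nu> and f = f and \<epsilon> = \<epsilon>, OF \<alpha>(3)]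
      by (simp add: N'_def l'(1) \<alpha>(2) wt_add)
  next
    fix i \<beta> assume i: "i < n" and \<beta>: "\<beta> \<in> monomials d"
    have "W' i j = 0" if "j < r" "homogeneous 0 (b j)" for j
      using Trop_star_degree_zero[OF assms(3) row'[OF i] that] int'[OF i that(1)] by simp
    then show "wt (W' i) \<beta> \<le> (\<Sum>j<r. \<bar>W' i j\<bar>) * d" using \<beta> by (rule weight_bound)
  qed
  then have "section_ring n m r b D' = monomial_sections n r b W'"
    using int' by (intro subset_antisym sections_of_jointly_reducible monomial_sections_subset)
  also have "\<dots> = alg_gen lconst (t_inv ` {..<n} \<union> b_lift n r b D' ` {..<r})"
    by (rule alg_gen_lifts[OF lift', symmetric])
  finally show ?thesis unfolding fin_gen_algebra_def
    by (intro exI[of _ "t_inv ` {..<n} \<union> b_lift n r b D' ` {..<r}"]) simp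
qed

end
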